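(* Let $G$ be a Class 1 graph with $\Delta(G)=4$ and let $t\geq 5$ be an integer. Then every proper $t$-edge coloring of $G$ can be transformed to any proper $4$-edge coloring of $G$ by a sequence of interchanges.
   Context: All graphs are finite, without loops and multiple edges. $\Delta(G)$ is the maximum degree of $G$. A proper $t$-edge coloring of $G$ is a map $f:E(G)\to\{1,\dots,t\}$ with $f(e)\neq f(e')$ for adjacent edges $e,e'$. The chromatic index $\chi'(G)$ is the least $k$ for which a proper $k$-edge coloring exists; $G$ is Class 1 if $\chi'(G)=\Delta(G)$ and Class 2 if $\chi'(G)=\Delta(G)+1$. For a proper edge coloring $f$ and colors $a,b$, $G_f(a,b)$ is the subgraph induced by the edges colored $a$ or $b$. An interchange (Kempe change) consists of swapping colors $a$ and $b$ on one connected component of $G_f(a,b)$; this yields another proper edge coloring. A proper $4$-edge coloring is regarded as a proper $t$-edge coloring using only colors from $\{1,2,3,4\}$. *)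

theory Defs
  imports Main
begin

definition simple_graph :: "'a set \<Rightarrow> 'a set set \<Rightarrow> bool" where
  "simple_graph V E \<longleftrightarrow> finite V \<and>
     (\<forall>e\<in>E. \<exists>u v. e = {u, v} \<and> u \<noteq> v \<and> u \<in> V \<and> v \<in> V)"

definition degree :: "'a set set \<Rightarrow> 'a \<Rightarrow> nat" where
  "degree E v = card {e\<in>E. v \<in> e}"

definition max_degree :: "'a set \<Rightarrow> 'a set set \<Rightarrow> nat" where
  "max_degree V E = Max (insert 0 (degree E ` V))"

definition proper_edge_coloring :: "'a set set \<Rightarrow> nat \<Rightarrow> ('a set \<Rightarrow> nat) \<Rightarrow> bool" where
  "proper_edge_coloring E t f \<longleftrightarrow>
     (\<forall>e\<in>E. f e \<in> {1..t}) \<and>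
     (\<forall>e\<in>E. \<forall>e'\<in>E. e \<noteq> e' \<and> e \<inter> e' \<noteq> {} \<longrightarrow> f e \<noteq> f e')"

definition chromatic_index :: "'a set set \<Rightarrow> nat" where
  "chromatic_index E = (LEAST k. \<exists>f. proper_edge_coloring E k f)"

definition class1 :: "'a set \<Rightarrow> 'a set set \<Rightarrow> bool" where
  "class1 V E \<longleftrightarrow> chromatic_index E = max_degree V E"

definition kempe_edges :: "'a set set \<Rightarrow> ('a set \<Rightarrow> nat) \<Rightarrow> nat \<Rightarrow> nat \<Rightarrow> 'a set set" where
  "kempe_edges E f a b = {e\<in>E. f e = a \<or> f e = b}"

definition edge_adj :: "'a set set \<Rightarrow> 'a set \<Rightarrow> 'a set \<Rightarrow> bool" where
  "edge_adj H e e' \<longleftrightarrow> e \<in> H \<and> e' \<in> H \<and> e \<inter> e' \<noteq> {}"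

text \<open>Edge sets of the (non-trivial) connected components of G_f(a,b).\<close>
definition kempe_component :: "'a set set \<Rightarrow> ('a set \<Rightarrow> nat) \<Rightarrow> nat \<Rightarrow> nat \<Rightarrow> 'a set set \<Rightarrow> bool" where
  "kempe_component E f a b C \<longleftrightarrow>
     (\<exists>e \<in> kempe_edges E f a b. C = {e'. (edge_adj (kempe_edges E f a b))\<^sup>*\<^sup>* e e'})"

definition swap_color :: "nat \<Rightarrow> nat \<Rightarrow> nat \<Rightarrow> nat" where
  "swap_color a b x = (if x = a then b else if x = b then a else x)"

definition interchange :: "'a set set \<Rightarrow> nat \<Rightarrow> ('a set \<Rightarrow> nat) \<Rightarrow> ('a set \<Rightarrow> nat) \<Rightarrow> bool" where
  "interchange E t f f' \<longleftrightarrow>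
     (\<exists>a b C. a \<in> {1..t} \<and> b \<in> {1..t} \<and> kempe_component E f a b C \<and>
        f' = (\<lambda>e. if e \<in> C then swap_color a b (f e) else f e))"

end

theory Submission
  imports Defs
begin

text \<open>Surplus colours are removed with Vizing fans, so let \<open>f\<close> use five colours. It suffices to reach a
  colouring in which the colour class of \<open>s\<close> equals a prescribed class \<open>M\<close> of \<open>g\<close>: interchanges of
  the other colours do not disturb it, and the argument is repeated on the remaining edges with one
  colour less. Among the reachable classes \<open>N\<close> of \<open>s\<close> choose one with \<open>(|M - N|, |N - M|)\<close>
  lexicographically minimal. For an edge \<open>xy\<close> of \<open>N - M\<close> the fan at \<open>x\<close> that starts with \<open>xy\<close> must
  close up to a cycle whose last vertex \<open>z\<close> misses only \<open>s\<close>. As such a cycle has at most four edges,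
  it can be rotated by interchanges unless there is a \<open>K5\<close>, and this replaces \<open>xy\<close> by \<open>xz\<close> in \<open>N\<close>.
  Since degrees are at most 4, playing such replacements against the minimality of \<open>N\<close> forces a \<open>K4\<close>
  spanned by two edges of \<open>M - N\<close> and an edge of \<open>N - M\<close> between them, and five colours do not
  suffice for its edges.\<close>

section \<open>Swaps on closed vertex sets\<close>

text \<open>While a class is being matched, the palette \<open>A\<close> has one colour more than
  \<open>g\<close> uses on the edges still in play. Hence every vertex misses a colour in every
  colouring, which drives the fans, and a vertex of degree \<open>card A - 1\<close> sees every
  colour of \<open>g\<close>, so that \<open>M\<close> covers it; the end vertex \<open>z\<close> of
  a closed fan is of this kind. The obstacle is the closed fan itself: its last vertex frees no
  colour but \<open>s\<close>, so no shift along the fan is available, and the rotation has to be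
  simulated by swaps on chains in two colours. Such a chain has at most two ends, so three vertices
  that each miss one of its colours never lie on it together; nearly every contradiction about fans
  comes from such a third end. Moreover, a cycle that resists rotation keeps resisting after any
  swap that spares it, since the swap commutes with the rotation. The surroundings of the cycle can
  therefore be normalised by swaps until they become impossible.\<close>

locale palette_graph =
  fixes E :: "'a set set" and A :: "nat set"
  assumes finite_E: "finite E"
    and edgeD: "e \<in> E \<Longrightarrow> \<exists>u v. e = {u, v} \<and> u \<noteq> v"
    and finite_A: "finite A"
begin

definition miss :: "('a set \<Rightarrow> nat) \<Rightarrow> 'a \<Rightarrow> nat \<Rightarrow> bool" where
  "miss f v c \<longleftrightarrow> (\<forall>e\<in>E. v \<in> e \<longrightarrow> f e \<noteq> c)"

definition col :: "('a set \<Rightarrow> nat) \<Rightarrow> bool" where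
  "col f \<longleftrightarrow> (\<forall>e\<in>E. f e \<in> A) \<and> (\<forall>e\<in>E. \<forall>e'\<in>E. e \<noteq> e' \<and> e \<inter> e' \<noteq> {} \<longrightarrow> f e \<noteq> f e')"

text \<open>A union of components in the colours \<open>p\<close> and \<open>q\<close>, isolated
  vertices included. Unlike a component it may be replaced by its complement, so a swap can be made
  on either side.\<close>

definition closed_on :: "('a set \<Rightarrow> nat) \<Rightarrow> nat \<Rightarrow> nat \<Rightarrow> 'a set \<Rightarrow> bool" where
  "closed_on f p q S \<longleftrightarrow> (\<forall>e\<in>E. f e = p \<or> f e = q \<longrightarrow> e \<inter> S \<noteq> {} \<longrightarrow> e \<subseteq> S)"

definition swap_on :: "('a set \<Rightarrow> nat) \<Rightarrow> nat \<Rightarrow> nat \<Rightarrow> 'a set \<Rightarrow> 'a set \<Rightarrow> nat" where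
  "swap_on f p q S = (\<lambda>e. if e \<in> E \<and> e \<inter> S \<noteq> {} then swap_color p q (f e) else f e)"

text \<open>A swap on a closed set performs the interchanges on all components inside it, which allows one
  to argue without naming components.\<close>

definition swap_step :: "('a set \<Rightarrow> nat) \<Rightarrow> ('a set \<Rightarrow> nat) \<Rightarrow> bool" where
  "swap_step f f' \<longleftrightarrow> (\<exists>p\<in>A. \<exists>q\<in>A. \<exists>S. closed_on f p q S \<and> f' = swap_on f p q S)"

abbreviation keq :: "('a set \<Rightarrow> nat) \<Rightarrow> ('a set \<Rightarrow> nat) \<Rightarrow> bool" (infix "\<approx>" 50) where
  "keq \<equiv> swap_step\<^sup>*\<^sup>*"

lemma swap_color_swap_color [simp]: "swap_color p q (swap_color p q c) = c"
  by (simp add: swap_color_def)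

lemma edge_neq: "{u, v} \<in> E \<Longrightarrow> u \<noteq> v"
  using edgeD[of "{u, v}"] by (auto simp: doubleton_eq_iff)

lemma edge_with: "\<lbrakk>e \<in> E; v \<in> e\<rbrakk> \<Longrightarrow> \<exists>w. e = {v, w} \<and> v \<noteq> w"
  using edgeD[of e] by (auto simp: doubleton_eq_iff)

lemma col_A: "\<lbrakk>col f; e \<in> E\<rbrakk> \<Longrightarrow> f e \<in> A"
  by (simp add: col_def)

lemma col_inj: "\<lbrakk>col f; e \<in> E; e' \<in> E; v \<in> e; v \<in> e'; f e = f e'\<rbrakk> \<Longrightarrow> e = e'"
  unfolding col_def by blast

lemma col_nbr: "\<lbrakk>col f; {v, u} \<in> E; {v, w} \<in> E; f {v, u} = f {v, w}\<rbrakk> \<Longrightarrow> u = w"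
  using col_inj[of f "{v, u}" "{v, w}" v] by (auto simp: doubleton_eq_iff)

lemma closed_onD:
  "\<lbrakk>closed_on f p q S; {u, v} \<in> E; f {u, v} = p \<or> f {u, v} = q; u \<in> S\<rbrakk> \<Longrightarrow> v \<in> S"
  unfolding closed_on_def by blast

lemma closed_on_iff:
  "\<lbrakk>closed_on f p q S; {u, v} \<in> E; f {u, v} = p \<or> f {u, v} = q\<rbrakk> \<Longrightarrow> u \<in> S \<longleftrightarrow> v \<in> S"
  using closed_onD[of f p q S u v] closed_onD[of f p q S v u] by (auto simp: insert_commute)

lemma closed_onI:
  assumes "\<And>u v. \<lbrakk>{u, v} \<in> E; f {u, v} = p \<or> f {u, v} = q; u \<in> S\<rbrakk> \<Longrightarrow> v \<in> S"
  shows "closed_on f p q S"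
  unfolding closed_on_def
proof (intro ballI impI)
  fix e assume e: "e \<in> E" "f e = p \<or> f e = q" "e \<inter> S \<noteq> {}"
  obtain u where "u \<in> e" "u \<in> S" using e(3) by blast
  moreover obtain v where "e = {u, v}" using edge_with[OF e(1) \<open>u \<in> e\<close>] by blast
  ultimately show "e \<subseteq> S" using assms[of u v] e by blast
qed

lemma closed_on_compl: "closed_on f p q S \<Longrightarrow> closed_on f p q (- S)"
  unfolding closed_on_def by blast

lemma closed_on_commute: "closed_on f p q S \<Longrightarrow> closed_on f q p S"
  unfolding closed_on_def by blast

lemma closed_on_swap: "closed_on f p q S \<Longrightarrow> closed_on (swap_on f p q S) p q S"
  unfolding closed_on_def swap_on_def swap_color_def by auto

lemma swap_on_swap_on [simp]: "swap_on (swap_on f p q S) p q S = f"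
  unfolding swap_on_def by auto

lemma keq_swap: "\<lbrakk>p \<in> A; q \<in> A; closed_on f p q S\<rbrakk> \<Longrightarrow> f \<approx> swap_on f p q S"
  unfolding swap_step_def by blast

lemma keq_sym: "f \<approx> f' \<Longrightarrow> f' \<approx> f"
proof -
  have "symp swap_step"
    unfolding symp_def swap_step_def by (metis closed_on_swap swap_on_swap_on)
  then show "f \<approx> f' \<Longrightarrow> f' \<approx> f" by (metis symp_rtranclp sympD)
qed

lemma keq_trans: "\<lbrakk>f \<approx> g; g \<approx> h\<rbrakk> \<Longrightarrow> f \<approx> h"
  by (rule rtranclp_trans)

lemma swap_on_edge:
  assumes "closed_on f p q S" "e \<in> E" "v \<in> e"
  shows "swap_on f p q S e = (if v \<in> S then swap_color p q (f e) else f e)"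
  using assms unfolding closed_on_def swap_on_def swap_color_def by auto

lemma miss_swap:
  assumes "closed_on f p q S"
  shows "miss (swap_on f p q S) v c \<longleftrightarrow> miss f v (if v \<in> S then swap_color p q c else c)"
proof -
  have "swap_color p q a = c \<longleftrightarrow> a = swap_color p q c" for a
    by (auto simp: swap_color_def)
  then show ?thesis
    unfolding miss_def by (auto simp: swap_on_edge[OF assms])
qed

lemma col_swap:
  assumes "col f" "p \<in> A" "q \<in> A" "closed_on f p q S"
  shows "col (swap_on f p q S)"
proof -
  have "swap_on f p q S e \<in> A" if "e \<in> E" for e
    using that assms unfolding swap_on_def swap_color_def by (auto simp: col_A)
  moreover have "swap_on f p q S e \<noteq> swap_on f p q S e'"
    if ee: "e \<in> E" "e' \<in> E" "e \<noteq> e'" "e \<inter> e' \<noteq> {}" for e e'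
  proof -
    obtain v where v: "v \<in> e" "v \<in> e'" using ee by blast
    then have "f e \<noteq> f e'" using ee col_inj[OF assms(1)] by blast
    then show ?thesis
      using swap_on_edge[OF assms(4) ee(1) v(1)] swap_on_edge[OF assms(4) ee(2) v(2)]
      by (auto simp: swap_color_def split: if_splits)
  qed
  ultimately show ?thesis unfolding col_def by blast
qed

lemma keq_col: "f \<approx> f' \<Longrightarrow> col f \<Longrightarrow> col f'"
  by (induction rule: rtranclp_induct) (auto simp: swap_step_def col_swap)

lemma miss_other: "\<lbrakk>miss f v d; v = x \<or> v = y \<Longrightarrow> c \<noteq> d\<rbrakk> \<Longrightarrow> miss (f({x, y} := c)) v d"
  unfolding miss_def by auto

lemma miss_old:
  "\<lbrakk>col f; {x, y} \<in> E; v = x \<or> v = y; d = f {x, y}; c \<noteq> d\<rbrakk> \<Longrightarrow> miss (f({x, y} := c)) v d"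
  unfolding miss_def using col_inj[of f "{x, y}" _ v] by (metis fun_upd_apply insert_iff)

lemma missD: "\<lbrakk>miss f v c; {v, w} \<in> E\<rbrakk> \<Longrightarrow> f {v, w} \<noteq> c"
  unfolding miss_def by blast

lemma missD': "\<lbrakk>miss f v c; {w, v} \<in> E\<rbrakk> \<Longrightarrow> f {w, v} \<noteq> c"
  unfolding miss_def by blast

lemma not_missE:
  assumes "\<not> miss f v c"
  obtains w where "{v, w} \<in> E" "f {v, w} = c" "v \<noteq> w"
  using assms edge_with unfolding miss_def by blast

text \<open>The edge alone is a component in its old colour and \<open>c\<close>. This is the
  elementary move of all fan arguments.\<close>

lemma keq_recolor:
  assumes "col f" "{x, y} \<in> E" "miss f x c" "miss f y c" "c \<in> A"
  shows "f \<approx> f({x, y} := c)" and "col (f({x, y} := c))"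
    and "f {x, y} = a \<Longrightarrow> miss (f({x, y} := c)) x a" and "f {x, y} = a \<Longrightarrow> miss (f({x, y} := c)) y a"
proof -
  let ?p = "f {x, y}"
  have only: "e = {x, y}" if "e \<in> E" "f e = ?p \<or> f e = c" "e \<inter> {x, y} \<noteq> {}" for e
    using that assms(3,4) col_inj[OF assms(1) that(1) assms(2)] unfolding miss_def by auto
  have cl: "closed_on f ?p c {x, y}"
    unfolding closed_on_def using only by blast
  have "swap_on f ?p c {x, y} = f({x, y} := c)"
  proof
    fix e show "swap_on f ?p c {x, y} e = (f({x, y} := c)) e"
      using only[of e] assms(2) by (auto simp: swap_on_def swap_color_def)
  qed
  with keq_swap[OF _ assms(5) cl] col_A[OF assms(1,2)] show "f \<approx> f({x, y} := c)" by simp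
  then show "col (f({x, y} := c))" using keq_col assms(1) by blast
  show "miss (f({x, y} := c)) x a" "miss (f({x, y} := c)) y a" if "f {x, y} = a"
    using that assms missD[OF assms(3), of y] by (auto intro!: miss_old)
qed

section \<open>Chains in two colours and their ends\<close>

text \<open>The path from \<open>u\<close> is followed by deleting its first edge; the other end
  \<open>u'\<close> then has degree at most 1 and starts the rest. If \<open>u'\<close> has no
  further edge, it is the second end. Otherwise its degree in \<open>H\<close> is 2, so it is no
  end, and the second end of the rest is kept.\<close>

lemma three_ends_aux:
  assumes "finite H" "\<And>e. e \<in> H \<Longrightarrow> \<exists>u v. e = {u, v} \<and> u \<noteq> v"
    and "\<And>v. card {e \<in> H. v \<in> e} \<le> 2" "card {e \<in> H. u \<in> e} \<le> 1"
  shows "\<exists>S v. u \<in> S \<and> (\<forall>e\<in>H. e \<inter> S \<noteq> {} \<longrightarrow> e \<subseteq> S) \<and>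
    (\<forall>w\<in>S. card {e \<in> H. w \<in> e} \<le> 1 \<longrightarrow> w = u \<or> w = v)"
  using assms
proof (induction "card H" arbitrary: H u rule: less_induct)
  case less
  show ?case
  proof (cases "{e \<in> H. u \<in> e} = {}")
    case True
    then show ?thesis by (intro exI[of _ "{u}"]) blast
  next
    case False
    then obtain e0 where e0: "e0 \<in> H" "u \<in> e0" by blast
    have eu: "{e \<in> H. u \<in> e} = {e0}"
    proof -
      have "finite {e \<in> H. u \<in> e}" using less.prems(1) by simp
      moreover have "{e0} \<subseteq> {e \<in> H. u \<in> e}" using e0 by blast
      ultimately show ?thesis using less.prems(4) by (metis card_seteq card.empty card_insert_disjoint finite.emptyI empty_iff One_nat_def)
    qed
    obtain u' where u': "e0 = {u, u'}" "u \<noteq> u'"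
      using less.prems(2)[OF e0(1)] e0(2) by (auto simp: doubleton_eq_iff)
    define H' where "H' = H - {e0}"
    have fin: "finite {e \<in> H. w \<in> e}" for w using less.prems(1) by simp
    have deg': "{e \<in> H'. w \<in> e} = {e \<in> H. w \<in> e} - {e0}" for w unfolding H'_def by blast
    have degu': "card {e \<in> H'. u' \<in> e} + 1 = card {e \<in> H. u' \<in> e}"
      unfolding deg' using e0(1) u'(1) fin[of u'] 
      by (metis (no_types, lifting) Suc_eq_plus1 card_Suc_Diff1 insertCI mem_Collect_eq)
    show ?thesis
    proof (cases "{e \<in> H'. u' \<in> e} = {}")
      case True
      then have "e = e0" if "e \<in> H" "u' \<in> e \<or> u \<in> e" for e
        using that eu unfolding H'_def by blast
      then show ?thesis using u' by (intro exI[of _ "{u, u'}"] exI[of _ u']) blast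
    next
      case False
      have "\<exists>S v. u' \<in> S \<and> (\<forall>e\<in>H'. e \<inter> S \<noteq> {} \<longrightarrow> e \<subseteq> S) \<and>
        (\<forall>w\<in>S. card {e \<in> H'. w \<in> e} \<le> 1 \<longrightarrow> w = u' \<or> w = v)"
      proof (rule less.hyps)
        show "card H' < card H" unfolding H'_def using e0(1) less.prems(1) by (rule card_Diff1_less[rotated])
        show "finite H'" unfolding H'_def using less.prems(1) by simp
        show "\<exists>u v. e = {u, v} \<and> u \<noteq> v" if "e \<in> H'" for e
          using less.prems(2) that unfolding H'_def by blast
        show "card {e \<in> H'. v \<in> e} \<le> 2" for v
          unfolding deg' using less.prems(3)[of v] fin[of v] card_mono[of "{e \<in> H. v \<in> e}" "{e \<in> H. v \<in> e} - {e0}"] by auto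
        show "card {e \<in> H'. u' \<in> e} \<le> 1" using degu' less.prems(3)[of u'] by simp
      qed
      then obtain S v where S: "u' \<in> S" "\<forall>e\<in>H'. e \<inter> S \<noteq> {} \<longrightarrow> e \<subseteq> S"
        "\<forall>w\<in>S. card {e \<in> H'. w \<in> e} \<le> 1 \<longrightarrow> w = u' \<or> w = v" by blast
      have pos: "card {e \<in> H'. u' \<in> e} > 0" using False fin[of u'] unfolding deg' by (simp add: card_gt_0_iff)
      show ?thesis
      proof (intro exI conjI ballI impI)
        show "u \<in> insert u S" by simp
        show "e \<subseteq> insert u S" if "e \<in> H" "e \<inter> insert u S \<noteq> {}" for e
        proof (cases "e = e0")
          case True then show ?thesis using u' S(1) by blast
        next
          case False
          then have "e \<in> H'" "u \<notin> e" using that(1) eu unfolding H'_def by blast+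
          then show ?thesis using S(2) that(2) by blast
        qed
        show "w = u \<or> w = v" if "w \<in> insert u S" "card {e \<in> H. w \<in> e} \<le> 1" for w
        proof (rule ccontr)
          assume n: "\<not> (w = u \<or> w = v)"
          have "w \<noteq> u'" using that(2) degu' pos by auto
          then have "w \<notin> e0" using n u' by blast
          then have "{e \<in> H'. w \<in> e} = {e \<in> H. w \<in> e}" unfolding deg' by blast
          then show False using S(3) that n \<open>w \<noteq> u'\<close> by auto
        qed
      qed
    qed
  qed
qed

text \<open>In the subgraph of the colours \<open>p\<close> and \<open>q\<close> all degrees are at
  most 2, and at most 1 at a vertex missing one of them. Two vertices of this kind in
  \<open>S\<close> other than \<open>u\<close> must coincide, which is how a third end is ruled out
  later.\<close>

lemma three_ends:
  assumes "col f" "miss f u p \<or> miss f u q"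
  obtains S v where "closed_on f p q S" "u \<in> S"
    "\<And>w. \<lbrakk>w \<in> S; miss f w p \<or> miss f w q\<rbrakk> \<Longrightarrow> w = u \<or> w = v"
proof -
  let ?H = "{e \<in> E. f e = p \<or> f e = q}"
  have inj: "inj_on f {e \<in> ?H. v \<in> e}" for v
    using col_inj[OF assms(1)] by (auto simp: inj_on_def)
  have le: "card {e \<in> ?H. v \<in> e} \<le> card C" if "f ` {e \<in> ?H. v \<in> e} \<subseteq> C" "finite C" for v C
    using card_inj_on_le[OF inj that] .
  have two: "card {e \<in> ?H. v \<in> e} \<le> 2" for v
  proof -
    have "card {e \<in> ?H. v \<in> e} \<le> card {p, q}" by (rule le) auto
    also have "\<dots> \<le> 2" using card_insert_le_m1[of 2 "{q}" p] by simp
    finally show ?thesis .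
  qed
  have one: "card {e \<in> ?H. w \<in> e} \<le> 1" if "miss f w p \<or> miss f w q" for w
  proof -
    have "f ` {e \<in> ?H. w \<in> e} \<subseteq> {p} \<or> f ` {e \<in> ?H. w \<in> e} \<subseteq> {q}"
      using that unfolding miss_def by auto
    then show ?thesis using le[of w "{p}"] le[of w "{q}"] by auto
  qed
  have "\<exists>S v. u \<in> S \<and> (\<forall>e\<in>?H. e \<inter> S \<noteq> {} \<longrightarrow> e \<subseteq> S) \<and>
    (\<forall>w\<in>S. card {e \<in> ?H. w \<in> e} \<le> 1 \<longrightarrow> w = u \<or> w = v)"
    by (rule three_ends_aux) (use finite_E edgeD two one[OF assms(2)] in auto)
  then obtain S v where S: "u \<in> S" "\<forall>e\<in>?H. e \<inter> S \<noteq> {} \<longrightarrow> e \<subseteq> S"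
    "\<forall>w\<in>S. card {e \<in> ?H. w \<in> e} \<le> 1 \<longrightarrow> w = u \<or> w = v" by blast
  show ?thesis
  proof (rule that[of S v])
    show "closed_on f p q S" unfolding closed_on_def using S(2) by blast
    show "u \<in> S" by fact
    show "w = u \<or> w = v" if "w \<in> S" "miss f w p \<or> miss f w q" for w
      using S(3) one that by blast
  qed
qed

text \<open>A fan cycle of length two: the path \<open>y\<close>, \<open>x\<close>, \<open>z\<close>
  is an entire chain in \<open>a\<close>, \<open>b\<close>, and swapping it rotates the
  cycle.\<close>

lemma keq_pair:
  assumes c: "col f" and e: "{x, y} \<in> E" "{x, z} \<in> E" "y \<noteq> z"
    and f: "f {x, y} = a" "f {x, z} = b" and m: "miss f y b" "miss f z a"
  shows "f \<approx> f({x, y} := b, {x, z} := a)"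
proof -
  have ne: "x \<noteq> y" "x \<noteq> z" using e edge_neq by auto
  have only: "d = {x, y} \<or> d = {x, z}"
    if d: "d \<in> E" "f d = a \<or> f d = b" "d \<inter> {x, y, z} \<noteq> {}" for d
  proof -
    have "v \<in> d \<Longrightarrow> v \<in> {x, y} \<Longrightarrow> f d = a \<Longrightarrow> d = {x, y}" for v
      using col_inj[OF c d(1) e(1), of v] f by auto
    moreover have "v \<in> d \<Longrightarrow> v \<in> {x, z} \<Longrightarrow> f d = b \<Longrightarrow> d = {x, z}" for v
      using col_inj[OF c d(1) e(2), of v] f by auto
    ultimately show ?thesis using d m unfolding miss_def by blast
  qed
  have cl: "closed_on f a b {x, y, z}"
    unfolding closed_on_def using only by blast
  have "swap_on f a b {x, y, z} = f({x, y} := b, {x, z} := a)"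
  proof
    fix d show "swap_on f a b {x, y, z} d = (f({x, y} := b, {x, z} := a)) d"
      using only[of d] e f by (auto simp: swap_on_def swap_color_def doubleton_eq_iff)
  qed
  then show ?thesis using keq_swap[OF _ _ cl] col_A[OF c e(1)] col_A[OF c e(2)] f by simp
qed

text \<open>Used to undo the swap on \<open>S\<close> after the edges of \<open>X\<close> at \<open>x\<close> have been recoloured.\<close>

lemma swap_on_restore:
  assumes "\<And>e. \<lbrakk>e \<in> E; x \<in> e \<and> e \<in> X\<rbrakk> \<Longrightarrow> swap_on f' p q T e = h e"
    and "\<And>e. \<not> (e \<in> E \<and> x \<in> e \<and> e \<in> X) \<Longrightarrow> f' e = swap_on f p q S e \<and> h e = f e"
    and "\<And>e. \<lbrakk>e \<in> E; \<not> (x \<in> e \<and> e \<in> X); f e = p \<or> f e = q\<rbrakk> \<Longrightarrow> e \<inter> S = {} \<longleftrightarrow> e \<inter> T = {}"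
  shows "swap_on f' p q T = h"
proof
  fix e show "swap_on f' p q T e = h e"
  proof (cases "e \<in> E \<and> x \<in> e \<and> e \<in> X")
    case True then show ?thesis using assms(1) by blast
  next
    case False
    then show ?thesis using assms(2)[OF False] assms(3)[of e]
      by (auto simp: swap_on_def swap_color_def split: if_splits)
  qed
qed

section \<open>Rotating fan cycles of length three\<close>

text \<open>A closed fan, in which each leaf misses the colour of the next edge. The colour
  \<open>\<alpha>\<close> free at \<open>x\<close> is carried along because chains from
  \<open>x\<close> to the cycle start with it.\<close>

definition cyc3 where
  "cyc3 f x \<alpha> y0 c0 y1 c1 y2 c2 \<longleftrightarrow> col f \<and> \<alpha> \<in> A \<and> miss f x \<alpha> \<and> distinct [y0, y1, y2] \<and>
     {x, y0} \<in> E \<and> {x, y1} \<in> E \<and> {x, y2} \<in> E \<and> f {x, y0} = c0 \<and> f {x, y1} = c1 \<and> f {x, y2} = c2 \<and>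
     miss f y0 c1 \<and> miss f y1 c2 \<and> miss f y2 c0"

definition rot3 :: "('a set \<Rightarrow> nat) \<Rightarrow> 'a \<Rightarrow> 'a \<Rightarrow> nat \<Rightarrow> 'a \<Rightarrow> nat \<Rightarrow> 'a \<Rightarrow> nat \<Rightarrow> 'a set \<Rightarrow> nat" where
  "rot3 f x y0 c0 y1 c1 y2 c2 = f({x, y0} := c1, {x, y1} := c2, {x, y2} := c0)"

lemma cyc3D:
  assumes "cyc3 f x \<alpha> y0 c0 y1 c1 y2 c2"
  shows "col f" "\<alpha> \<in> A" "c0 \<in> A" "c1 \<in> A" "c2 \<in> A" "miss f x \<alpha>"
    "y0 \<noteq> y1" "y0 \<noteq> y2" "y1 \<noteq> y2" "x \<noteq> y0" "x \<noteq> y1" "x \<noteq> y2"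
    "{x, y0} \<in> E" "{x, y1} \<in> E" "{x, y2} \<in> E" "f {x, y0} = c0" "f {x, y1} = c1" "f {x, y2} = c2"
    "miss f y0 c1" "miss f y1 c2" "miss f y2 c0"
    "c0 \<noteq> c1" "c1 \<noteq> c2" "c2 \<noteq> c0" "\<alpha> \<noteq> c0" "\<alpha> \<noteq> c1" "\<alpha> \<noteq> c2"
  using assms missD col_nbr unfolding cyc3_def by (auto simp: col_A edge_neq)

lemma cyc3_rotate: "cyc3 f x \<alpha> y0 c0 y1 c1 y2 c2 \<Longrightarrow> cyc3 f x \<alpha> y1 c1 y2 c2 y0 c0"
  unfolding cyc3_def by auto

lemma rot3_rotate: "cyc3 f x \<alpha> y0 c0 y1 c1 y2 c2 \<Longrightarrow> rot3 f x y1 c1 y2 c2 y0 c0 = rot3 f x y0 c0 y1 c1 y2 c2"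
  using cyc3D[of f x \<alpha> y0 c0 y1 c1 y2 c2] unfolding rot3_def
  by (auto simp: fun_eq_iff doubleton_eq_iff)

text \<open>The swap on \<open>S\<close> frees \<open>\<alpha>\<close> at \<open>y0\<close> and
  spares the edges at \<open>x\<close>. Now the cycle opens: \<open>{x, y0}\<close> takes
  \<open>\<alpha>\<close>, \<open>{x, y2}\<close> takes \<open>c0\<close>, \<open>{x, y1}\<close>
  takes \<open>c2\<close>, and \<open>c1\<close> becomes free at \<open>x\<close>. Swapping back on
  \<open>S\<close> with \<open>x\<close> added restores the other edges and turns the
  \<open>\<alpha>\<close> on \<open>{x, y0}\<close> into \<open>c1\<close>.\<close>

lemma rot3_unlinked_center:
  assumes cy: "cyc3 f x \<alpha> y0 c0 y1 c1 y2 c2"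
    and S: "closed_on f \<alpha> c1 S" "y0 \<in> S" "x \<notin> S"
  shows "f \<approx> rot3 f x y0 c0 y1 c1 y2 c2"
proof -
  note [simp] = cyc3D[OF cy] cyc3D(7-12)[OF cy, symmetric] cyc3D(22-27)[OF cy, symmetric] doubleton_eq_iff
  have xS: "\<And>e. e \<in> E \<Longrightarrow> x \<in> e \<Longrightarrow> swap_on f \<alpha> c1 S e = f e"
    using swap_on_edge[OF S(1), of _ x] S(3) by simp
  let ?f1 = "swap_on f \<alpha> c1 S"
  have c1: "col ?f1" "f \<approx> ?f1" using col_swap keq_swap S by auto
  have y1S: "y1 \<notin> S" using closed_on_iff[OF S(1), of x y1] S(3) by simp
  have m1: "miss ?f1 x \<alpha>" "miss ?f1 y0 \<alpha>" "miss ?f1 y1 c2" "miss ?f1 y2 c0"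
    using S by (simp_all add: miss_swap swap_color_def)
  have e1: "?f1 {x, y0} = c0" "?f1 {x, y1} = c1" "?f1 {x, y2} = c2" by (simp_all add: xS)
  let ?f2 = "?f1({x, y0} := \<alpha>)"
  have c2: "?f1 \<approx> ?f2" "col ?f2" using keq_recolor[of ?f1 x y0 \<alpha>] c1 m1 by auto
  have m2: "miss ?f2 x c0" "miss ?f2 y2 c0" "miss ?f2 y1 c2"
    using m1 keq_recolor(3)[of ?f1 x y0 \<alpha> c0] c1 e1 by (auto intro: miss_other)
  let ?f3 = "?f2({x, y2} := c0)"
  have c3: "?f2 \<approx> ?f3" "col ?f3" using keq_recolor[of ?f2 x y2 c0] c2 m2 by auto
  have m3: "miss ?f3 x c2" "miss ?f3 y1 c2"
    using m2 keq_recolor(3)[of ?f2 x y2 c0 c2] c2 e1 by (auto intro: miss_other)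
  let ?f4 = "?f3({x, y1} := c2)"
  have c4: "?f3 \<approx> ?f4" "col ?f4" using keq_recolor[of ?f3 x y1 c2] c3 m3 by auto
  have m4: "miss ?f4 x c1" using m3 keq_recolor(3)[of ?f3 x y1 c2 c1] c3 e1 by simp
  let ?X = "{{x, y0}, {x, y1}, {x, y2}}"
  have old: "f e \<noteq> \<alpha> \<and> f e \<noteq> c1" if "e \<in> E" "x \<in> e" "e \<notin> ?X" for e
    using that cyc3D(6)[OF cy] col_inj[of f e "{x, y1}" x] unfolding miss_def by auto
  \<comment> \<open>At \<open>x\<close> only \<open>{x, y0}\<close> has one of the two colours now,
    and \<open>y0\<close> lies in \<open>S\<close>.\<close>
  have cl4: "closed_on ?f4 \<alpha> c1 (insert x S)"
  proof (rule closed_onI)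
    fix u v assume uv: "{u, v} \<in> E" "?f4 {u, v} = \<alpha> \<or> ?f4 {u, v} = c1" "u \<in> insert x S"
    show "v \<in> insert x S"
    proof (cases "x = u \<or> x = v")
      case True
      then show ?thesis using uv old[of "{u, v}"] S xS[of "{u, v}"]
        by (auto split: if_splits)
    next
      case False
      then have "?f1 {u, v} = \<alpha> \<or> ?f1 {u, v} = c1" "u \<in> S" using uv by auto
      then show ?thesis using closed_onD[OF closed_on_swap[OF S(1)] uv(1)] by simp
    qed
  qed
  have "swap_on ?f4 \<alpha> c1 (insert x S) = rot3 f x y0 c0 y1 c1 y2 c2"
  proof (rule swap_on_restore[where x = x and X = ?X and S = S and f = f])
    fix e assume e: "e \<in> E" "x \<in> e \<and> e \<in> ?X"
    then show "swap_on ?f4 \<alpha> c1 (insert x S) e = rot3 f x y0 c0 y1 c1 y2 c2 e"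
      using swap_on_edge[OF cl4 e(1), of x] e1(2) by (elim conjE insertE) (simp_all add: swap_color_def rot3_def)
  next
    fix e assume "\<not> (e \<in> E \<and> x \<in> e \<and> e \<in> ?X)"
    then have "e \<notin> ?X" by auto
    then show "?f4 e = ?f1 e \<and> rot3 f x y0 c0 y1 c1 y2 c2 e = f e" by (simp add: rot3_def)
  next
    fix e assume "e \<in> E" "\<not> (x \<in> e \<and> e \<in> ?X)" "f e = \<alpha> \<or> f e = c1"
    then have "x \<notin> e" using old by blast
    then show "e \<inter> S = {} \<longleftrightarrow> e \<inter> insert x S = {}" by blast
  qed
  then have "?f4 \<approx> rot3 f x y0 c0 y1 c1 y2 c2" using keq_swap[OF _ _ cl4] by simp
  then show ?thesis using c1(2) c2(1) c3(1) c4(1) by (meson keq_trans)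
qed

text \<open>After the swap on \<open>S\<close>, \<open>y2\<close> and \<open>y0\<close> form a fan cycle of length two.\<close>

lemma rot3_unlinked_leaves:
  assumes cy: "cyc3 f x \<alpha> y0 c0 y1 c1 y2 c2"
    and S: "closed_on f c1 c2 S" "y0 \<in> S" "y1 \<notin> S"
  shows "f \<approx> rot3 f x y0 c0 y1 c1 y2 c2"
proof -
  note [simp] = cyc3D[OF cy] cyc3D(7-12)[OF cy, symmetric] cyc3D(22-27)[OF cy, symmetric] doubleton_eq_iff
  have xnS: "x \<notin> S" using closed_on_iff[OF S(1), of x y1] S(3) by simp
  have xS: "\<And>e. e \<in> E \<Longrightarrow> x \<in> e \<Longrightarrow> swap_on f c1 c2 S e = f e"
    using swap_on_edge[OF S(1), of _ x] xnS by simp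
  let ?f1 = "swap_on f c1 c2 S"
  have c1: "col ?f1" "f \<approx> ?f1" using col_swap keq_swap S by auto
  have m1: "miss ?f1 y0 c2" "miss ?f1 y1 c2" "miss ?f1 y2 c0"
    using S by (simp_all add: miss_swap swap_color_def)
  have e1: "?f1 {x, y0} = c0" "?f1 {x, y1} = c1" "?f1 {x, y2} = c2" by (simp_all add: xS)
  let ?f2 = "?f1({x, y0} := c2, {x, y2} := c0)"
  have c2: "?f1 \<approx> ?f2" using keq_pair[of ?f1 x y0 y2 c0 c2] c1 e1 m1 by simp
  let ?X = "{{x, y0}, {x, y1}, {x, y2}}"
  have old: "f e \<noteq> c1 \<and> f e \<noteq> c2" if "e \<in> E" "x \<in> e" "e \<notin> ?X" for e
    using that col_inj[of f e "{x, y1}" x] col_inj[of f e "{x, y2}" x] by auto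
  have y1: "f e \<noteq> c2 \<and> (f e = c1 \<longrightarrow> e = {x, y1})" if "e \<in> E" "y1 \<in> e" for e
    using that cyc3D(20)[OF cy] col_inj[of f e "{x, y1}" y1] unfolding miss_def by auto
  \<comment> \<open>Swapping back on this set also gives \<open>c1\<close> to \<open>{x, y0}\<close>
    and \<open>c2\<close> to \<open>{x, y1}\<close>. Adding \<open>y1\<close> is harmless, since
    \<open>{x, y1}\<close> is its only edge in these colours.\<close>
  let ?T = "insert x (insert y1 S)"
  have cl2: "closed_on ?f2 c1 c2 ?T"
  proof (rule closed_onI)
    fix u v assume uv: "{u, v} \<in> E" "?f2 {u, v} = c1 \<or> ?f2 {u, v} = c2" "u \<in> ?T"
    show "v \<in> ?T"
    proof (cases "x = u \<or> x = v")
      case True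
      then show ?thesis using uv old[of "{u, v}"] S xS[of "{u, v}"]
        by (auto split: if_splits)
    next
      case F: False
      then have f1: "?f1 {u, v} = c1 \<or> ?f1 {u, v} = c2" using uv by auto
      have "u \<noteq> y1" using y1[OF uv(1)] swap_on_edge[OF S(1) uv(1), of y1] S(3) f1 F by auto
      then have "u \<in> S" using uv(3) F by auto
      then show ?thesis using closed_onD[OF closed_on_swap[OF S(1)] uv(1) f1] by simp
    qed
  qed
  have "swap_on ?f2 c1 c2 ?T = rot3 f x y0 c0 y1 c1 y2 c2"
  proof (rule swap_on_restore[where x = x and X = ?X and S = S and f = f])
    fix e assume e: "e \<in> E" "x \<in> e \<and> e \<in> ?X"
    then show "swap_on ?f2 c1 c2 ?T e = rot3 f x y0 c0 y1 c1 y2 c2 e"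
      using swap_on_edge[OF cl2 e(1), of x] e1(2) by (elim conjE insertE) (simp_all add: swap_color_def rot3_def)
  next
    fix e assume n: "\<not> (e \<in> E \<and> x \<in> e \<and> e \<in> ?X)"
    then have "e \<notin> ?X" by auto
    then show "?f2 e = ?f1 e \<and> rot3 f x y0 c0 y1 c1 y2 c2 e = f e" by (simp add: rot3_def)
  next
    fix e assume e: "e \<in> E" "\<not> (x \<in> e \<and> e \<in> ?X)" "f e = c1 \<or> f e = c2"
    then have "x \<notin> e" "y1 \<notin> e" using old y1[of e] by blast+
    then show "e \<inter> S = {} \<longleftrightarrow> e \<inter> ?T = {}" by blast
  qed
  then have "?f2 \<approx> rot3 f x y0 c0 y1 c1 y2 c2" using keq_swap[OF _ _ cl2] by simp
  then show ?thesis using c1(2) c2(1) by (meson keq_trans)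
qed

section \<open>Cycles of length three that resist rotation\<close>

definition stuck3 where
  "stuck3 f x \<alpha> y0 c0 y1 c1 y2 c2 \<longleftrightarrow>
     cyc3 f x \<alpha> y0 c0 y1 c1 y2 c2 \<and> \<not> f \<approx> rot3 f x y0 c0 y1 c1 y2 c2"

lemma stuck3_rotate: "stuck3 f x \<alpha> y0 c0 y1 c1 y2 c2 \<Longrightarrow> stuck3 f x \<alpha> y1 c1 y2 c2 y0 c0"
  using cyc3_rotate[of f x \<alpha> y0 c0 y1 c1 y2 c2] rot3_rotate[of f x \<alpha> y0 c0 y1 c1 y2 c2]
  unfolding stuck3_def by simp

lemma stuck3_cyc3: "stuck3 f x \<alpha> y0 c0 y1 c1 y2 c2 \<Longrightarrow> cyc3 f x \<alpha> y0 c0 y1 c1 y2 c2"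
  by (simp add: stuck3_def)

text \<open>The conditions say that the swap changes neither the cycle edges, before or after
  rotation, nor the colours the leaves have to miss. It then commutes with the rotation, and a
  rotation after the swap would yield one before it. If \<open>x\<close> lies in \<open>S\<close>,
  the role of \<open>\<alpha>\<close> may pass to another colour.\<close>

lemma stuck3_swap:
  assumes st: "stuck3 f x \<alpha> y0 c0 y1 c1 y2 c2"
    and S: "closed_on f p q S" "p \<in> A" "q \<in> A"
    and x: "x \<in> S \<Longrightarrow> {p, q} \<inter> {c0, c1, c2} = {}"
    and y: "y0 \<in> S \<Longrightarrow> c1 \<notin> {p, q}" "y1 \<in> S \<Longrightarrow> c2 \<notin> {p, q}" "y2 \<in> S \<Longrightarrow> c0 \<notin> {p, q}"
  shows "stuck3 (swap_on f p q S) x (if x \<in> S then swap_color p q \<alpha> else \<alpha>) y0 c0 y1 c1 y2 c2"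
proof -
  let ?g = "swap_on f p q S" and ?r = "\<lambda>f. rot3 f x y0 c0 y1 c1 y2 c2"
  have cy: "cyc3 f x \<alpha> y0 c0 y1 c1 y2 c2" using st by (simp add: stuck3_def)
  note D = cyc3D[OF cy]
  have ne: "{x, y0} \<noteq> {x, y1}" "{x, y1} \<noteq> {x, y2}" "{x, y0} \<noteq> {x, y2}"
    using D by (auto simp: doubleton_eq_iff)
  have rg: "?r g {x, y0} = c1" "?r g {x, y1} = c2" "?r g {x, y2} = c0" for g
    using ne by (simp_all add: rot3_def)
  have xc: "x \<in> S \<Longrightarrow> c0 \<noteq> p \<and> c0 \<noteq> q \<and> c1 \<noteq> p \<and> c1 \<noteq> q \<and> c2 \<noteq> p \<and> c2 \<noteq> q"
    using x by auto
  have "?g {x, y0} = c0" "?g {x, y1} = c1" "?g {x, y2} = c2"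
    using swap_on_edge[OF S(1), of _ x] x D by (auto simp: swap_color_def)
  moreover have "miss ?g x (if x \<in> S then swap_color p q \<alpha> else \<alpha>)" using D by (simp add: miss_swap[OF S(1)])
  moreover have "miss ?g y0 c1" "miss ?g y1 c2" "miss ?g y2 c0"
    using D y by (auto simp: miss_swap[OF S(1)] swap_color_def)
  moreover have "(if x \<in> S then swap_color p q \<alpha> else \<alpha>) \<in> A" using D S by (auto simp: swap_color_def)
  ultimately have cyg: "cyc3 ?g x (if x \<in> S then swap_color p q \<alpha> else \<alpha>) y0 c0 y1 c1 y2 c2"
    unfolding cyc3_def using D col_swap[OF D(1) S(2,3,1)] by simp
  have clr: "closed_on (?r f) p q S"
    unfolding closed_on_def
  proof (intro ballI impI)
    fix e assume e: "e \<in> E" "?r f e = p \<or> ?r f e = q" "e \<inter> S \<noteq> {}"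
    show "e \<subseteq> S"
    proof (cases "e \<in> {{x, y0}, {x, y1}, {x, y2}}")
      case True
      then show ?thesis using e xc y by (elim insertE emptyE) (auto simp: rg)
    next
      case False
      then show ?thesis using e S(1) by (auto simp: rot3_def closed_on_def)
    qed
  qed
  have comm: "swap_on (?r f) p q S = ?r ?g"
  proof
    fix e show "swap_on (?r f) p q S e = ?r ?g e"
    proof (cases "e \<in> {{x, y0}, {x, y1}, {x, y2}}")
      case True
      then have "swap_color p q (?r f e) = ?r f e \<or> e \<inter> S = {}"
        using xc y by (elim insertE emptyE) (auto simp: rg swap_color_def)
      moreover have "?r ?g e = ?r f e" using True by (auto simp: rg)
      ultimately show ?thesis by (auto simp: swap_on_def)
    next
      case False
      then show ?thesis by (simp add: rot3_def swap_on_def)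
    qed
  qed
  have "\<not> ?g \<approx> ?r ?g"
  proof
    assume "?g \<approx> ?r ?g"
    then have "f \<approx> ?r ?g" using keq_swap[OF S(2,3,1)] keq_trans by blast
    moreover have "?r ?g \<approx> ?r f" using keq_swap[OF S(2,3) clr] comm keq_sym by metis
    ultimately show False using st keq_trans unfolding stuck3_def by blast
  qed
  with cyg show ?thesis by (simp add: stuck3_def)
qed

text \<open>The contrapositive of \<open>rot3_unlinked_center\<close> for \<open>S\<close> and for
  its complement: no closed set separates the two vertices, so they lie on one chain.\<close>

lemma stuck3_link_center:
  assumes st: "stuck3 f x \<alpha> y0 c0 y1 c1 y2 c2" and S: "closed_on f \<alpha> c1 S"
  shows "x \<in> S \<longleftrightarrow> y0 \<in> S"
  using rot3_unlinked_center[OF stuck3_cyc3[OF st] S]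
    rot3_unlinked_center[OF stuck3_cyc3[OF st] closed_on_compl[OF S]] st
  unfolding stuck3_def by blast

lemma stuck3_link_leaves:
  assumes st: "stuck3 f x \<alpha> y0 c0 y1 c1 y2 c2" and S: "closed_on f c1 c2 S"
  shows "y0 \<in> S \<longleftrightarrow> y1 \<in> S"
  using rot3_unlinked_leaves[OF stuck3_cyc3[OF st] S]
    rot3_unlinked_leaves[OF stuck3_cyc3[OF st] closed_on_compl[OF S]] st
  unfolding stuck3_def by blast

lemma closed_on_pair:
  assumes "col f" "{u, v} \<in> E" "f {u, v} = p" "miss f u q" "miss f v q"
  shows "closed_on f p q {u, v}"
proof -
  have "e = {u, v}" if "e \<in> E" "f e = p \<or> f e = q" "e \<inter> {u, v} \<noteq> {}" for e
    using that assms col_inj[OF assms(1) that(1) assms(2)] unfolding miss_def by auto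
  then show ?thesis unfolding closed_on_def by blast
qed

lemma closed_on_single: "\<lbrakk>miss f u p; miss f u q\<rbrakk> \<Longrightarrow> closed_on f p q {u}"
  unfolding closed_on_def miss_def by blast

lemma stuck3_link_prev:
  assumes st: "stuck3 f x \<alpha> y0 c0 y1 c1 y2 c2" and S: "closed_on f c0 c1 S"
  shows "y2 \<in> S \<longleftrightarrow> y0 \<in> S"
  using stuck3_link_leaves[OF stuck3_rotate[OF stuck3_rotate[OF st]] S] .

text \<open>Otherwise a swap away from \<open>x\<close> and the cycle makes \<open>r\<close> miss \<open>c1\<close>, and then the edge
  \<open>{y0, r}\<close> is a whole component that should contain \<open>x\<close> or \<open>y1\<close>.\<close>

lemma stuck3_leaf_nbr:
  assumes st: "stuck3 f x \<alpha> y0 c0 y1 c1 y2 c2" and r: "{y0, r} \<in> E" "f {y0, r} = \<alpha> \<or> f {y0, r} = c2"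
    and rW: "r \<noteq> y1" "r \<noteq> y2" and m: "\<mu> \<in> {\<alpha>, c0, c1, c2}"
  shows "\<not> miss f r \<mu>"
proof
  assume mr: "miss f r \<mu>"
  note D = cyc3D[OF stuck3_cyc3[OF st]]
  have rx: "r \<noteq> x" using r D by (auto simp: insert_commute)
  have ry: "r \<noteq> y0" using r edge_neq by blast
  have base: False if st': "stuck3 g x \<alpha> y0 c0 y1 c1 y2 c2" and g: "g {y0, r} = f {y0, r}" "miss g r c1" for g
  proof -
    note D' = cyc3D[OF stuck3_cyc3[OF st']]
    have "closed_on g (f {y0, r}) c1 {y0, r}"
      using closed_on_pair[OF D'(1) r(1) g(1)] D' g(2) by simp
    then have "closed_on g \<alpha> c1 {y0, r} \<or> closed_on g c1 c2 {y0, r}"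
      using r(2) closed_on_commute by auto
    then show False
      using stuck3_link_center[OF st', of "{y0, r}"] stuck3_link_leaves[OF st', of "{y0, r}"] D rx rW by auto
  qed
  show False
  proof (cases "\<mu> = c1")
    case True
    then show False using base st mr by blast
  next
    case False
    obtain K v where K: "closed_on f \<mu> c1 K" "y0 \<in> K"
      and Kv: "\<And>w. \<lbrakk>w \<in> K; miss f w \<mu> \<or> miss f w c1\<rbrakk> \<Longrightarrow> w = y0 \<or> w = v"
      using three_ends[OF D(1), of y0 \<mu> c1] D by blast
    \<comment> \<open>The chain of \<open>y0\<close> already has a known second end, namely
      \<open>x\<close>, \<open>y2\<close> or \<open>y1\<close> depending on \<open>\<mu>\<close>. So
      \<open>r\<close> would be a third end, and a swap off \<open>K\<close> affects
      \<open>r\<close> but not the cycle.\<close>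
    have xK: "x \<in> K \<and> r \<notin> K \<and> (\<mu> = c0 \<longrightarrow> y2 \<in> K) \<and> (\<mu> = c2 \<longrightarrow> y1 \<in> K)"
    proof -
      consider "\<mu> = \<alpha>" | "\<mu> = c0" | "\<mu> = c2" using m False by blast
      then show ?thesis
      proof cases
        case 1
        then have "x \<in> K" using stuck3_link_center[OF st] K by simp
        then show ?thesis using Kv[of x] Kv[of r] D mr rx ry 1 by auto
      next
        case 2
        then have "y2 \<in> K" using stuck3_link_prev[OF st, of K] K by simp
        moreover have "x \<in> K" using closed_on_iff[OF K(1), of x y0] D K(2) 2 by simp
        ultimately show ?thesis using Kv[of y2] Kv[of r] D mr rW ry 2 by auto
      next
        case 3
        then have y1: "y1 \<in> K" using stuck3_link_leaves[OF st, of K] K closed_on_commute by simp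
        moreover have "x \<in> K" using closed_on_iff[OF K(1), of x y1] D y1 by simp
        ultimately show ?thesis using Kv[of y1] Kv[of r] D mr rW ry 3 by auto
      qed
    qed
    have clK: "closed_on f \<mu> c1 (- K)" using closed_on_compl[OF K(1)] .
    have "stuck3 (swap_on f \<mu> c1 (- K)) x \<alpha> y0 c0 y1 c1 y2 c2"
      using stuck3_swap[OF st clK] m D xK K(2) by auto
    moreover have "swap_on f \<mu> c1 (- K) {y0, r} = f {y0, r}"
      using swap_on_edge[OF clK r(1), of y0] K(2) by simp
    moreover have "miss (swap_on f \<mu> c1 (- K)) r c1"
      using xK mr by (simp add: miss_swap[OF clK] swap_color_def)
    ultimately show False using base by blast
  qed
qed

text \<open>If \<open>y0\<close> missed \<open>\<kappa>\<close> besides \<open>c1\<close>, then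
  \<open>{y0}\<close> would be closed in these two colours and would cut \<open>y0\<close> off from
  \<open>x\<close> or \<open>y1\<close>.\<close>

lemma stuck3_leaf_edge:
  assumes st: "stuck3 f x \<alpha> y0 c0 y1 c1 y2 c2" and k: "\<kappa> = \<alpha> \<or> \<kappa> = c2"
  obtains r where "{y0, r} \<in> E" "f {y0, r} = \<kappa>" "r \<noteq> x" "r \<noteq> y0"
proof -
  note D = cyc3D[OF stuck3_cyc3[OF st]]
  have "\<not> miss f y0 \<kappa>"
  proof
    assume "miss f y0 \<kappa>"
    then have "closed_on f \<kappa> c1 {y0}" using closed_on_single D by blast
    then show False using k stuck3_link_center[OF st, of "{y0}"] stuck3_link_leaves[OF st, of "{y0}"] D closed_on_commute by auto
  qed
  then obtain r where "{y0, r} \<in> E" "f {y0, r} = \<kappa>" "y0 \<noteq> r" by (rule not_missE)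
  moreover then have "r \<noteq> x" using D k by (auto simp: insert_commute)
  ultimately show ?thesis using that by blast
qed

text \<open>Stands for the chain in \<open>\<alpha>\<close>, \<open>\<gamma>\<close> that starts at
  \<open>x\<close>; what matters is that it is closed and has at most one end besides
  \<open>x\<close>.\<close>

definition short_set where
  "short_set f x \<alpha> \<gamma> C \<longleftrightarrow> closed_on f \<alpha> \<gamma> C \<and> x \<in> C \<and>
     (\<exists>v. \<forall>w\<in>C. miss f w \<alpha> \<or> miss f w \<gamma> \<longrightarrow> w = x \<or> w = v)"

lemma short_set_exists: "\<lbrakk>col f; miss f x \<alpha>\<rbrakk> \<Longrightarrow> \<exists>C. short_set f x \<alpha> \<gamma> C"
  unfolding short_set_def by (rule three_ends[of f x \<alpha> \<gamma>]) blast+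

text \<open>Swapping \<open>\<alpha>\<close>, \<open>\<gamma>\<close> outside \<open>C\<close> and then \<open>\<alpha>\<close>, \<open>c1\<close> at \<open>r\<close> turns \<open>r\<close> into a \<open>\<gamma>\<close>-neighbour of \<open>y0\<close>
  that misses \<open>c1\<close>. This is impossible unless \<open>y0\<close> has joined the \<open>\<alpha>\<close>-\<open>\<gamma>\<close>-chain of \<open>x\<close>.\<close>

lemma stuck3_outside:
  assumes missing: "\<And>f v. col f \<Longrightarrow> \<exists>c\<in>A. miss f v c"
    and A: "A = {\<alpha>, c0, c1, c2, \<gamma>}" "\<gamma> \<notin> {\<alpha>, c0, c1, c2}"
    and st: "stuck3 f x \<alpha> y0 c0 y1 c1 y2 c2"
    and C: "short_set f x \<alpha> \<gamma> C"
    and r: "{y0, r} \<in> E" "f {y0, r} = \<alpha>" "r \<noteq> y1" "r \<noteq> y2"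
  shows "y0 \<notin> C \<and> (\<exists>h C' y'. stuck3 h x \<alpha> y0 c0 y1 c1 y2 c2 \<and> short_set h x \<alpha> \<gamma> C' \<and> y0 \<in> C' \<and>
    (y' = y1 \<or> y' = y2) \<and> {y0, y'} \<in> E \<and> h {y0, y'} = \<alpha> \<and> f {y0, y'} = \<gamma>)"
proof -
  note D = cyc3D[OF stuck3_cyc3[OF st]]
  have rx: "r \<noteq> x" "r \<noteq> y0" using r D edge_neq by (auto simp: insert_commute)
  have gA: "\<gamma> \<in> A" using A by simp
  \<comment> \<open>Otherwise both \<open>z\<close> and the \<open>c2\<close>-neighbour
    \<open>Z\<close> of \<open>y0\<close> lie off the cycle and miss \<open>\<gamma>\<close>, the
    only colour that \<open>stuck3_leaf_nbr\<close> leaves them. After a swap on \<open>C'\<close>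
    the free colour of \<open>x\<close> is \<open>\<gamma>\<close>, and the same lemma makes
    \<open>Z\<close> miss \<open>\<alpha>\<close>. So the swap has changed \<open>Z\<close>, and
    \<open>C'\<close> has the three ends \<open>x\<close>, \<open>z\<close> and
    \<open>Z\<close>.\<close>
  have out: "z = y1 \<or> z = y2"
    if st': "stuck3 g x \<alpha> y0 c0 y1 c1 y2 c2" and C': "short_set g x \<alpha> \<gamma> C'" "y0 \<in> C'"
      and z: "{y0, z} \<in> E" "g {y0, z} = \<alpha>" for g :: "'a set \<Rightarrow> nat" and C' z
  proof (rule ccontr)
    assume "\<not> ?thesis"
    then have zW: "z \<noteq> y1" "z \<noteq> y2" by auto
    note D' = cyc3D[OF stuck3_cyc3[OF st']]
    have zx: "z \<noteq> x" using z D' by (auto simp: insert_commute)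
    have cl: "closed_on g \<alpha> \<gamma> C'" "x \<in> C'" using C' by (auto simp: short_set_def)
    have zC: "z \<in> C'" using closed_on_iff[OF cl(1) z(1)] z(2) C'(2) by blast
    have mz: "miss g z \<gamma>" using missing[OF D'(1), of z] stuck3_leaf_nbr[OF st' z(1) _ zW] z(2) A by blast
    obtain Z where Z: "{y0, Z} \<in> E" "g {y0, Z} = c2" "Z \<noteq> x" "Z \<noteq> y0" using stuck3_leaf_edge[OF st'] by blast
    have Zne: "Z \<noteq> z" using Z z D' by auto
    have ZW: "Z \<noteq> y1" "Z \<noteq> y2"
      using missD'[OF D'(20), of y0] Z col_nbr[OF D'(1), of y2 x y0] D' by (auto simp: insert_commute)
    have mZ: "miss g Z \<gamma>" using missing[OF D'(1), of Z] stuck3_leaf_nbr[OF st' Z(1) _ ZW] Z(2) A by blast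
    let ?g = "swap_on g \<alpha> \<gamma> C'"
    have st2: "stuck3 ?g x \<gamma> y0 c0 y1 c1 y2 c2"
      using stuck3_swap[OF st' cl(1) D(2) gA] A D cl(2) by (auto simp: swap_color_def)
    have "?g {y0, Z} = c2" using Z(2) D' A by (auto simp: swap_on_def swap_color_def)
    then have "\<not> miss ?g Z \<mu>" if "\<mu> \<in> {\<gamma>, c0, c1, c2}" for \<mu>
      using stuck3_leaf_nbr[OF st2 Z(1) _ ZW that] by simp
    then have "miss ?g Z \<alpha>" using missing[of ?g Z] cyc3D(1)[OF stuck3_cyc3[OF st2]] A by blast
  
    moreover have "\<not> miss g Z \<alpha>" using stuck3_leaf_nbr[OF st' Z(1) _ ZW] Z(2) by blast
    ultimately have "Z \<in> C'" by (auto simp: miss_swap[OF cl(1)] swap_color_def split: if_splits)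
    then show False using C'(1) zC mz mZ Zne Z(3) zx unfolding short_set_def by metis
  qed
  have y0C: "y0 \<notin> C" using out[OF st C _ r(1,2)] r by blast
  have cl: "closed_on f \<alpha> \<gamma> C" "x \<in> C" using C by (auto simp: short_set_def)
  have mr: "miss f r \<gamma>" using missing[OF D(1), of r] stuck3_leaf_nbr[OF st r(1) _ r(3,4)] r(2) A by blast
  have rC: "r \<notin> C" using closed_on_iff[OF cl(1) r(1)] r(2) y0C by blast
  have cl': "closed_on f \<alpha> \<gamma> (- C)" using closed_on_compl[OF cl(1)] .
  let ?h = "swap_on f \<alpha> \<gamma> (- C)"
  have sth: "stuck3 ?h x \<alpha> y0 c0 y1 c1 y2 c2"
    using stuck3_swap[OF st cl' D(2) gA] A D cl(2) by auto
  note Dh = cyc3D[OF stuck3_cyc3[OF sth]]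
  have hr: "?h {y0, r} = \<gamma>" using swap_on_edge[OF cl' r(1), of y0] y0C r(2) by (simp add: swap_color_def)
  have mhr: "miss ?h r \<alpha>" using mr rC by (simp add: miss_swap[OF cl'] swap_color_def)
  obtain K v where K: "closed_on ?h \<alpha> c1 K" "x \<in> K"
    and Kv: "\<And>w. \<lbrakk>w \<in> K; miss ?h w \<alpha> \<or> miss ?h w c1\<rbrakk> \<Longrightarrow> w = x \<or> w = v"
    using three_ends[OF Dh(1), of x \<alpha> c1] Dh by blast
  have yK: "y0 \<in> K" using stuck3_link_center[OF sth K(1)] K(2) by simp
  \<comment> \<open>The ends of this chain are \<open>x\<close> and \<open>y0\<close>, which miss
    \<open>\<alpha>\<close> and \<open>c1\<close>.\<close>
  have rK: "r \<notin> K" using Kv[of r] Kv[of y0] mhr Dh yK rx by auto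
  have clK: "closed_on ?h \<alpha> c1 (- K)" using closed_on_compl[OF K(1)] .
  let ?k = "swap_on ?h \<alpha> c1 (- K)"
  have stk: "stuck3 ?k x \<alpha> y0 c0 y1 c1 y2 c2"
    using stuck3_swap[OF sth clK D(2,4)] D K(2) yK by auto
  note Dk = cyc3D[OF stuck3_cyc3[OF stk]]
  have kr: "?k {y0, r} = \<gamma>" using swap_on_edge[OF clK r(1), of y0] yK hr by simp
  have mkr: "miss ?k r c1" using mhr rK by (simp add: miss_swap[OF clK] swap_color_def)
  obtain C' where C': "short_set ?k x \<alpha> \<gamma> C'" using short_set_exists[OF Dk(1,6)] by blast
  have clC': "closed_on ?k \<alpha> \<gamma> C'" "x \<in> C'" using C' by (auto simp: short_set_def)
  \<comment> \<open>If not, a swap on \<open>C'\<close> would make \<open>\<gamma>\<close> the free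
    colour of \<open>x\<close> and leave \<open>{y0, r}\<close> a whole component in
    \<open>\<gamma>\<close>, \<open>c1\<close>, separating \<open>y0\<close> from
    \<open>x\<close>.\<close>
  have y0C': "y0 \<in> C'"
  proof (rule ccontr)
    assume n: "y0 \<notin> C'"
    let ?l = "swap_on ?k \<alpha> \<gamma> C'"
    have stl: "stuck3 ?l x \<gamma> y0 c0 y1 c1 y2 c2"
      using stuck3_swap[OF stk clC'(1) D(2) gA] A D clC'(2) by (auto simp: swap_color_def)
    note Dl = cyc3D[OF stuck3_cyc3[OF stl]]
    have "?l {y0, r} = \<gamma>" using swap_on_edge[OF clC'(1) r(1), of y0] n kr by simp
    moreover have "miss ?l r c1" using mkr A D by (auto simp: miss_swap[OF clC'(1)] swap_color_def)
    ultimately have "closed_on ?l \<gamma> c1 {y0, r}" using closed_on_pair[OF Dl(1) r(1)] Dl by blast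
    then show False using stuck3_link_center[OF stl] D rx by blast
  qed
  obtain y' where y': "{y0, y'} \<in> E" "?k {y0, y'} = \<alpha>" using stuck3_leaf_edge[OF stk] by metis
  have y'W: "y' = y1 \<or> y' = y2" using out[OF stk C' y0C' y'] by blast
  have "?h {y0, y'} = \<alpha>" using swap_on_edge[OF clK y'(1), of y0] yK y'(2) by simp
  then have "f {y0, y'} = \<gamma>"
    using swap_on_edge[OF cl' y'(1), of y0] y0C by (auto simp: swap_color_def split: if_splits)
  then show ?thesis using y0C stk C' y0C' y'W y' by blast
qed

text \<open>An outside neighbour yields a colouring \<open>h\<close> in which \<open>y0\<close> and
  another leaf \<open>y'\<close> are joined by an \<open>\<alpha>\<close>-edge inside
  \<open>C'\<close>. Then the \<open>\<alpha>\<close>-edge of the third leaf leaves the cycle too.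
  Applied to that leaf, \<open>stuck3_outside\<close> places it off \<open>C'\<close> but joins it
  by a \<open>\<gamma>\<close>-edge to \<open>y0\<close> or \<open>y'\<close>, against the
  closedness of \<open>C'\<close>.\<close>

lemma stuck3_no_outside:
  assumes missing: "\<And>f v. col f \<Longrightarrow> \<exists>c\<in>A. miss f v c"
    and A: "A = {\<alpha>, c0, c1, c2, \<gamma>}" "\<gamma> \<notin> {\<alpha>, c0, c1, c2}"
    and st: "stuck3 f x \<alpha> y0 c0 y1 c1 y2 c2"
    and r: "{y0, r} \<in> E" "f {y0, r} = \<alpha>"
  shows "r = y1 \<or> r = y2"
proof (rule ccontr)
  assume n: "\<not> (r = y1 \<or> r = y2)"
  note D = cyc3D[OF stuck3_cyc3[OF st]]
  obtain C where C: "short_set f x \<alpha> \<gamma> C" using short_set_exists[OF D(1,6)] by blast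
  obtain h C' y' where h: "stuck3 h x \<alpha> y0 c0 y1 c1 y2 c2" "short_set h x \<alpha> \<gamma> C'" "y0 \<in> C'"
    "y' = y1 \<or> y' = y2" "{y0, y'} \<in> E" "h {y0, y'} = \<alpha>"
    using stuck3_outside[OF missing A st C r] n by blast
  note Dh = cyc3D[OF stuck3_cyc3[OF h(1)]]
  have cl: "closed_on h \<alpha> \<gamma> C'" using h(2) by (simp add: short_set_def)
  have y'C: "y' \<in> C'" using closed_on_iff[OF cl h(5)] h(3,6) by blast
  have third: False
    if st': "stuck3 h x \<alpha> z d0 z1 d1 z2 d2" and z: "A = {\<alpha>, d0, d1, d2, \<gamma>}" "\<gamma> \<notin> {\<alpha>, d0, d1, d2}"
      "{z1, z2} = {y0, y'}" for z d0 z1 d1 z2 d2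
  proof -
    note D' = cyc3D[OF stuck3_cyc3[OF st']]
    obtain s where s: "{z, s} \<in> E" "h {z, s} = \<alpha>" using stuck3_leaf_edge[OF st'] by metis
    have "s \<noteq> y0" using col_nbr[OF D'(1), of y0 z y'] s h(5,6) z(3) D' by (auto simp: insert_commute doubleton_eq_iff)
    moreover have "s \<noteq> y'" using col_nbr[OF D'(1), of y' z y0] s h(5,6) z(3) D' by (auto simp: insert_commute doubleton_eq_iff)
    ultimately have sz: "s \<noteq> z1" "s \<noteq> z2" using z(3) by (auto simp: doubleton_eq_iff)
    obtain y'' where y'': "z \<notin> C'" "y'' = z1 \<or> y'' = z2" "{z, y''} \<in> E" "h {z, y''} = \<gamma>"
      using stuck3_outside[OF missing z(1,2) st' h(2) s sz] by blast
    then have "y'' \<in> C'" using z(3) h(3) y'C by (auto simp: doubleton_eq_iff)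
    then show False using closed_on_iff[OF cl y''(3)] y''(1,4) by blast
  qed
  have A1: "A = {\<alpha>, c1, c2, c0, \<gamma>}" "A = {\<alpha>, c2, c0, c1, \<gamma>}" using A(1) by auto
  have st1: "stuck3 h x \<alpha> y1 c1 y2 c2 y0 c0" "stuck3 h x \<alpha> y2 c2 y0 c0 y1 c1"
    using h(1) stuck3_rotate by blast+
  show False
    using h(4) third[OF st1(1) A1(1)] third[OF st1(2) A1(2)] A(2) by auto
qed

text \<open>In a stuck cycle the \<open>\<alpha>\<close>-edges of the leaves would match three
  vertices perfectly among themselves. The neighbour \<open>Z\<close> of \<open>y0\<close> provides
  the fifth colour \<open>\<gamma>\<close>: the colour it misses is none of the other four.\<close>

theorem cyc3_rotatable:
  assumes missing: "\<And>f v. col f \<Longrightarrow> \<exists>c\<in>A. miss f v c"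
    and A: "card A \<le> 5"
    and cy: "cyc3 f x \<alpha> y0 c0 y1 c1 y2 c2"
  shows "f \<approx> rot3 f x y0 c0 y1 c1 y2 c2"
proof (rule ccontr)
  assume "\<not> ?thesis"
  then have st: "stuck3 f x \<alpha> y0 c0 y1 c1 y2 c2" using cy by (simp add: stuck3_def)
  have st1: "stuck3 f x \<alpha> y1 c1 y2 c2 y0 c0" "stuck3 f x \<alpha> y2 c2 y0 c0 y1 c1"
    using st stuck3_rotate by blast+
  note D = cyc3D[OF cy]
  obtain Z where Z: "{y0, Z} \<in> E" "f {y0, Z} = c2" "Z \<noteq> x" "Z \<noteq> y0" using stuck3_leaf_edge[OF st] by blast
  have ZW: "Z \<noteq> y1" "Z \<noteq> y2"
    using missD'[OF D(20), of y0] Z col_nbr[OF D(1), of y2 x y0] D by (auto simp: insert_commute)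
  obtain \<gamma> where g: "\<gamma> \<in> A" "miss f Z \<gamma>" using missing[OF D(1)] by blast
  then have gn: "\<gamma> \<notin> {\<alpha>, c0, c1, c2}" using stuck3_leaf_nbr[OF st Z(1) _ ZW] Z(2) by blast
  have "A = {\<alpha>, c0, c1, c2, \<gamma>}"
  proof (rule card_seteq[symmetric])
    have "card {\<alpha>, c0, c1, c2, \<gamma>} = 5" using gn D by auto
    then show "card A \<le> card {\<alpha>, c0, c1, c2, \<gamma>}" using A by simp
  qed (use finite_A D g in auto)
  then have A': "A = {\<alpha>, c0, c1, c2, \<gamma>}" "A = {\<alpha>, c1, c2, c0, \<gamma>}" "A = {\<alpha>, c2, c0, c1, \<gamma>}" by auto
  have gn': "\<gamma> \<notin> {\<alpha>, c1, c2, c0}" "\<gamma> \<notin> {\<alpha>, c2, c0, c1}" using gn by auto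
  obtain r0 r1 r2 where r: "{y0, r0} \<in> E" "f {y0, r0} = \<alpha>" "{y1, r1} \<in> E" "f {y1, r1} = \<alpha>"
    "{y2, r2} \<in> E" "f {y2, r2} = \<alpha>"
    using stuck3_leaf_edge[OF st] stuck3_leaf_edge[OF st1(1)] stuck3_leaf_edge[OF st1(2)] by metis
  have "r0 = y1 \<or> r0 = y2" using stuck3_no_outside[OF missing A'(1) gn st r(1,2)] .
  moreover have "r1 = y2 \<or> r1 = y0" using stuck3_no_outside[OF missing A'(2) gn'(1) st1(1) r(3,4)] .
  moreover have "r2 = y0 \<or> r2 = y1" using stuck3_no_outside[OF missing A'(3) gn'(2) st1(2) r(5,6)] .
  moreover have bk: "u = w" if "{u, v} \<in> E" "f {u, v} = \<alpha>" "{v, w} \<in> E" "f {v, w} = \<alpha>" for u v w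
    using col_nbr[OF D(1), of v u w] that by (simp add: insert_commute)
  have "r0 = y1 \<Longrightarrow> y0 = r1" "r0 = y2 \<Longrightarrow> y0 = r2" "r1 = y2 \<Longrightarrow> y1 = r2"
    "r1 = y0 \<Longrightarrow> y1 = r0" "r2 = y0 \<Longrightarrow> y2 = r0" "r2 = y1 \<Longrightarrow> y2 = r1"
    using bk r by blast+
  ultimately show False using D(7-9) by metis
qed

section \<open>Rotating fan cycles of length four\<close>

definition cyc4 where
  "cyc4 f x \<alpha> y0 c0 y1 c1 y2 c2 y3 c3 \<longleftrightarrow> col f \<and> \<alpha> \<in> A \<and> miss f x \<alpha> \<and> distinct [y0, y1, y2, y3] \<and>
     {x, y0} \<in> E \<and> {x, y1} \<in> E \<and> {x, y2} \<in> E \<and> {x, y3} \<in> E \<and>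
     f {x, y0} = c0 \<and> f {x, y1} = c1 \<and> f {x, y2} = c2 \<and> f {x, y3} = c3 \<and>
     miss f y0 c1 \<and> miss f y1 c2 \<and> miss f y2 c3 \<and> miss f y3 c0"

definition rot4 :: "('a set \<Rightarrow> nat) \<Rightarrow> 'a \<Rightarrow> 'a \<Rightarrow> nat \<Rightarrow> 'a \<Rightarrow> nat \<Rightarrow> 'a \<Rightarrow> nat \<Rightarrow> 'a \<Rightarrow> nat \<Rightarrow> 'a set \<Rightarrow> nat" where
  "rot4 f x y0 c0 y1 c1 y2 c2 y3 c3 = f({x, y0} := c1, {x, y1} := c2, {x, y2} := c3, {x, y3} := c0)"

lemma cyc4D:
  assumes "cyc4 f x \<alpha> y0 c0 y1 c1 y2 c2 y3 c3"
  shows "col f" "\<alpha> \<in> A" "c0 \<in> A" "c1 \<in> A" "c2 \<in> A" "c3 \<in> A" "miss f x \<alpha>"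
    "y0 \<noteq> y1" "y0 \<noteq> y2" "y0 \<noteq> y3" "y1 \<noteq> y2" "y1 \<noteq> y3" "y2 \<noteq> y3"
    "x \<noteq> y0" "x \<noteq> y1" "x \<noteq> y2" "x \<noteq> y3"
    "{x, y0} \<in> E" "{x, y1} \<in> E" "{x, y2} \<in> E" "{x, y3} \<in> E"
    "f {x, y0} = c0" "f {x, y1} = c1" "f {x, y2} = c2" "f {x, y3} = c3"
    "miss f y0 c1" "miss f y1 c2" "miss f y2 c3" "miss f y3 c0"
    "c0 \<noteq> c1" "c0 \<noteq> c2" "c0 \<noteq> c3" "c1 \<noteq> c2" "c1 \<noteq> c3" "c2 \<noteq> c3"
    "\<alpha> \<noteq> c0" "\<alpha> \<noteq> c1" "\<alpha> \<noteq> c2" "\<alpha> \<noteq> c3"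
  using assms missD col_nbr unfolding cyc4_def by (auto simp: col_A edge_neq)

lemma cyc4_rotate: "cyc4 f x \<alpha> y0 c0 y1 c1 y2 c2 y3 c3 \<Longrightarrow> cyc4 f x \<alpha> y1 c1 y2 c2 y3 c3 y0 c0"
  unfolding cyc4_def by auto

lemma rot4_rotate:
  assumes "cyc4 f x \<alpha> y0 c0 y1 c1 y2 c2 y3 c3"
  shows "rot4 f x y1 c1 y2 c2 y3 c3 y0 c0 = rot4 f x y0 c0 y1 c1 y2 c2 y3 c3"
proof -
  have "{x, y0} \<noteq> {x, y1}" "{x, y0} \<noteq> {x, y2}" "{x, y0} \<noteq> {x, y3}"
    using cyc4D(8-17)[OF assms] by (auto simp: doubleton_eq_iff)
  then show ?thesis unfolding rot4_def by (metis fun_upd_twist)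
qed

text \<open>As for length three: after the swap on \<open>S\<close> the edges to \<open>y0\<close>,
  \<open>y3\<close>, \<open>y2\<close>, \<open>y1\<close> are recoloured in this order, and the swap
  back on \<open>S\<close> with \<open>x\<close> added turns \<open>\<alpha>\<close> on
  \<open>{x, y0}\<close> into \<open>c1\<close>.\<close>

lemma rot4_unlinked_center:
  assumes cy: "cyc4 f x \<alpha> y0 c0 y1 c1 y2 c2 y3 c3"
    and S: "closed_on f \<alpha> c1 S" "y0 \<in> S" "x \<notin> S"
  shows "f \<approx> rot4 f x y0 c0 y1 c1 y2 c2 y3 c3"
proof -
  note D = cyc4D[OF cy]
  note [simp] = D D(8-17)[symmetric] D(30-39)[symmetric] doubleton_eq_iff
  have xS: "\<And>e. e \<in> E \<Longrightarrow> x \<in> e \<Longrightarrow> swap_on f \<alpha> c1 S e = f e"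
    using swap_on_edge[OF S(1), of _ x] S(3) by simp
  let ?f1 = "swap_on f \<alpha> c1 S"
  have c1: "col ?f1" "f \<approx> ?f1" using col_swap keq_swap S by auto
  have y1S: "y1 \<notin> S" using closed_on_iff[OF S(1), of x y1] S(3) by simp
  have m1: "miss ?f1 x \<alpha>" "miss ?f1 y0 \<alpha>" "miss ?f1 y1 c2" "miss ?f1 y2 c3" "miss ?f1 y3 c0"
    using S by (simp_all add: miss_swap swap_color_def)
  have e1: "?f1 {x, y0} = c0" "?f1 {x, y1} = c1" "?f1 {x, y2} = c2" "?f1 {x, y3} = c3" by (simp_all add: xS)
  let ?f2 = "?f1({x, y0} := \<alpha>)"
  have c2: "?f1 \<approx> ?f2" "col ?f2" "miss ?f2 x c0" using keq_recolor(1,2)[of ?f1 x y0 "\<alpha>"] keq_recolor(3)[of ?f1 x y0 "\<alpha>" c0] c1 m1 e1 by auto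
  have m2: "miss ?f2 y1 c2" "miss ?f2 y2 c3" "miss ?f2 y3 c0" using m1 by (simp_all add: miss_other)
  let ?f3 = "?f2({x, y3} := c0)"
  have c3: "?f2 \<approx> ?f3" "col ?f3" "miss ?f3 x c3" using keq_recolor(1,2)[of ?f2 x y3 "c0"] keq_recolor(3)[of ?f2 x y3 "c0" c3] c2 m2 e1 by auto
  have m3: "miss ?f3 y1 c2" "miss ?f3 y2 c3" using m2 by (simp_all add: miss_other)
  let ?f4 = "?f3({x, y2} := c3)"
  have c4: "?f3 \<approx> ?f4" "col ?f4" "miss ?f4 x c2" using keq_recolor(1,2)[of ?f3 x y2 "c3"] keq_recolor(3)[of ?f3 x y2 "c3" c2] c3 m3 e1 by auto
  have m4: "miss ?f4 y1 c2" using m3 by (simp_all add: miss_other)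
  let ?f5 = "?f4({x, y1} := c2)"
  have c5: "?f4 \<approx> ?f5" "miss ?f5 x c1" using keq_recolor(1,2)[of ?f4 x y1 "c2"] keq_recolor(3)[of ?f4 x y1 "c2" c1] c4 m4 e1 by auto
  let ?X = "{{x, y0}, {x, y1}, {x, y2}, {x, y3}}"
  have old: "f e \<noteq> \<alpha> \<and> f e \<noteq> c1" if "e \<in> E" "x \<in> e" "e \<notin> ?X" for e
    using that D(7) col_inj[of f e "{x, y1}" x] unfolding miss_def by auto
  have cl5: "closed_on ?f5 \<alpha> c1 (insert x S)"
  proof (rule closed_onI)
    fix u v assume uv: "{u, v} \<in> E" "?f5 {u, v} = \<alpha> \<or> ?f5 {u, v} = c1" "u \<in> insert x S"
    show "v \<in> insert x S"
    proof (cases "x = u \<or> x = v")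
      case True
      then show ?thesis using uv old[of "{u, v}"] S xS[of "{u, v}"]
        by (auto split: if_splits)
    next
      case False
      then have "?f1 {u, v} = \<alpha> \<or> ?f1 {u, v} = c1" "u \<in> S" using uv by auto
      then show ?thesis using closed_onD[OF closed_on_swap[OF S(1)] uv(1)] by simp
    qed
  qed
  have "swap_on ?f5 \<alpha> c1 (insert x S) = rot4 f x y0 c0 y1 c1 y2 c2 y3 c3"
  proof (rule swap_on_restore[where x = x and X = ?X and S = S and f = f])
    fix e assume e: "e \<in> E" "x \<in> e \<and> e \<in> ?X"
    then show "swap_on ?f5 \<alpha> c1 (insert x S) e = rot4 f x y0 c0 y1 c1 y2 c2 y3 c3 e"
      using swap_on_edge[OF cl5 e(1), of x] e1(2) by (elim conjE insertE) (simp_all add: swap_color_def rot4_def)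
  next
    fix e assume "\<not> (e \<in> E \<and> x \<in> e \<and> e \<in> ?X)"
    then have "e \<notin> ?X" by auto
    then show "?f5 e = ?f1 e \<and> rot4 f x y0 c0 y1 c1 y2 c2 y3 c3 e = f e" by (simp add: rot4_def)
  next
    fix e assume "e \<in> E" "\<not> (x \<in> e \<and> e \<in> ?X)" "f e = \<alpha> \<or> f e = c1"
    then have "x \<notin> e" using old by blast
    then show "e \<inter> S = {} \<longleftrightarrow> e \<inter> insert x S = {}" by blast
  qed
  then have "?f5 \<approx> rot4 f x y0 c0 y1 c1 y2 c2 y3 c3" using keq_swap[OF _ _ cl5] by simp
  then show ?thesis using c1(2) c2(1) c3(1) c4(1) c5(1) by (meson keq_trans)
qed

text \<open>After the swap on \<open>S\<close>, \<open>y2\<close>, \<open>y3\<close> and \<open>y0\<close> form a fan cycle of length three.\<close>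

lemma rot4_unlinked_leaves:
  assumes missing: "\<And>f v. col f \<Longrightarrow> \<exists>c\<in>A. miss f v c" and A: "card A \<le> 5"
    and cy: "cyc4 f x \<alpha> y0 c0 y1 c1 y2 c2 y3 c3"
    and S: "closed_on f c1 c2 S" "y0 \<in> S" "y1 \<notin> S"
  shows "f \<approx> rot4 f x y0 c0 y1 c1 y2 c2 y3 c3"
proof -
  note D = cyc4D[OF cy]
  note [simp] = D D(8-17)[symmetric] D(30-39)[symmetric] doubleton_eq_iff
  have xnS: "x \<notin> S" using closed_on_iff[OF S(1), of x y1] S(3) by simp
  have xS: "\<And>e. e \<in> E \<Longrightarrow> x \<in> e \<Longrightarrow> swap_on f c1 c2 S e = f e"
    using swap_on_edge[OF S(1), of _ x] xnS by simp
  let ?f1 = "swap_on f c1 c2 S"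
  have c1: "col ?f1" "f \<approx> ?f1" using col_swap keq_swap S by auto
  have m1: "miss ?f1 x \<alpha>" "miss ?f1 y0 c2" "miss ?f1 y2 c3" "miss ?f1 y3 c0"
    using S xnS by (simp_all add: miss_swap swap_color_def)
  have e1: "?f1 {x, y0} = c0" "?f1 {x, y1} = c1" "?f1 {x, y2} = c2" "?f1 {x, y3} = c3" by (simp_all add: xS)
  have cy1: "cyc3 ?f1 x \<alpha> y2 c2 y3 c3 y0 c0"
    unfolding cyc3_def using c1 m1 e1 by simp
  let ?f2 = "?f1({x, y2} := c3, {x, y3} := c0, {x, y0} := c2)"
  have c2: "?f1 \<approx> ?f2" using cyc3_rotatable[OF missing A cy1] by (simp add: rot3_def)
  let ?X = "{{x, y0}, {x, y1}, {x, y2}, {x, y3}}"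
  have old: "f e \<noteq> c1 \<and> f e \<noteq> c2" if "e \<in> E" "x \<in> e" "e \<notin> ?X" for e
    using that col_inj[of f e "{x, y1}" x] col_inj[of f e "{x, y2}" x] by auto
  have y1: "f e \<noteq> c2 \<and> (f e = c1 \<longrightarrow> e = {x, y1})" if "e \<in> E" "y1 \<in> e" for e
    using that D(27) col_inj[of f e "{x, y1}" y1] unfolding miss_def by auto
  let ?T = "insert x (insert y1 S)"
  have cl2: "closed_on ?f2 c1 c2 ?T"
  proof (rule closed_onI)
    fix u v assume uv: "{u, v} \<in> E" "?f2 {u, v} = c1 \<or> ?f2 {u, v} = c2" "u \<in> ?T"
    show "v \<in> ?T"
    proof (cases "x = u \<or> x = v")
      case True
      then show ?thesis using uv old[of "{u, v}"] S xS[of "{u, v}"]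
        by (auto split: if_splits)
    next
      case F: False
      then have f1: "?f1 {u, v} = c1 \<or> ?f1 {u, v} = c2" using uv by auto
      have "u \<noteq> y1" using y1[OF uv(1)] swap_on_edge[OF S(1) uv(1), of y1] S(3) f1 F by auto
      then have "u \<in> S" using uv(3) F by auto
      then show ?thesis using closed_onD[OF closed_on_swap[OF S(1)] uv(1) f1] by simp
    qed
  qed
  have "swap_on ?f2 c1 c2 ?T = rot4 f x y0 c0 y1 c1 y2 c2 y3 c3"
  proof (rule swap_on_restore[where x = x and X = ?X and S = S and f = f])
    fix e assume e: "e \<in> E" "x \<in> e \<and> e \<in> ?X"
    then show "swap_on ?f2 c1 c2 ?T e = rot4 f x y0 c0 y1 c1 y2 c2 y3 c3 e"
      using swap_on_edge[OF cl2 e(1), of x] e1(2) by (elim conjE insertE) (simp_all add: swap_color_def rot4_def)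
  next
    fix e assume n: "\<not> (e \<in> E \<and> x \<in> e \<and> e \<in> ?X)"
    then have "e \<notin> ?X" by auto
    then show "?f2 e = ?f1 e \<and> rot4 f x y0 c0 y1 c1 y2 c2 y3 c3 e = f e" by (simp add: rot4_def)
  next
    fix e assume e: "e \<in> E" "\<not> (x \<in> e \<and> e \<in> ?X)" "f e = c1 \<or> f e = c2"
    then have "x \<notin> e" "y1 \<notin> e" using old y1[of e] by blast+
    then show "e \<inter> S = {} \<longleftrightarrow> e \<inter> ?T = {}" by blast
  qed
  then have "?f2 \<approx> rot4 f x y0 c0 y1 c1 y2 c2 y3 c3" using keq_swap[OF _ _ cl2] by simp
  then show ?thesis using c1(2) c2(1) by (meson keq_trans)
qed

text \<open>The swap on \<open>S\<close> splits the fan cycle into the cycles \<open>y0\<close>, \<open>y3\<close> and \<open>y1\<close>, \<open>y2\<close>.\<close>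

lemma rot4_separated:
  assumes cy: "cyc4 f x \<alpha> y0 c0 y1 c1 y2 c2 y3 c3"
    and S: "closed_on f c1 c3 S" "x \<in> S" "y0 \<notin> S" "y2 \<notin> S"
  shows "f \<approx> rot4 f x y0 c0 y1 c1 y2 c2 y3 c3"
proof -
  note D = cyc4D[OF cy]
  note [simp] = D D(8-17)[symmetric] D(30-39)[symmetric] doubleton_eq_iff
  have xS: "\<And>e. e \<in> E \<Longrightarrow> x \<in> e \<Longrightarrow> swap_on f c1 c3 S e = swap_color c1 c3 (f e)"
    using swap_on_edge[OF S(1), of _ x] S(2) by simp
  let ?f1 = "swap_on f c1 c3 S"
  have c1: "col ?f1" "f \<approx> ?f1" using col_swap keq_swap S by auto
  have m1: "miss ?f1 y0 c1" "miss ?f1 y1 c2" "miss ?f1 y2 c3" "miss ?f1 y3 c0"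
    using S by (simp_all add: miss_swap swap_color_def)
  have e1: "?f1 {x, y0} = c0" "?f1 {x, y1} = c3" "?f1 {x, y2} = c2" "?f1 {x, y3} = c1"
    by (simp_all add: xS swap_color_def)
  let ?f2 = "?f1({x, y0} := c1, {x, y3} := c0)"
  have c2: "?f1 \<approx> ?f2" using keq_pair[of ?f1 x y0 y3 c0 c1] c1 e1 m1 by simp
  have col2: "col ?f2" using keq_col[OF c2 c1(1)] .
  have m2: "miss ?f2 y1 c2" "miss ?f2 y2 c3"
    using m1 by (simp_all add: miss_other)
  let ?f3 = "?f2({x, y1} := c2, {x, y2} := c3)"
  have c3: "?f2 \<approx> ?f3" using keq_pair[of ?f2 x y1 y2 c3 c2] col2 e1 m2 by simp
  let ?X = "{{x, y0}, {x, y1}, {x, y2}, {x, y3}}"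
  \<comment> \<open>By now the edges at \<open>x\<close> coloured \<open>c1\<close> and
    \<open>c3\<close> lead to \<open>y0\<close> and \<open>y2\<close>, which are outside
    \<open>S\<close>. So \<open>S\<close> without \<open>x\<close> is closed, and swapping back on
    it spares the edges at \<open>x\<close>.\<close>
  let ?T = "S - {x}"
  have old: "f e \<noteq> c1 \<and> f e \<noteq> c3" if "e \<in> E" "x \<in> e" "e \<notin> ?X" for e
    using that col_inj[of f e "{x, y1}" x] col_inj[of f e "{x, y3}" x] by auto
  have cl3: "closed_on ?f3 c1 c3 ?T"
  proof (rule closed_onI)
    fix u v assume uv: "{u, v} \<in> E" "?f3 {u, v} = c1 \<or> ?f3 {u, v} = c3" "u \<in> ?T"
    show "v \<in> ?T"
    proof (cases "x = u \<or> x = v")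
      case True
      then show ?thesis using uv old[of "{u, v}"] S xS[of "{u, v}"]
        by (auto simp: swap_color_def split: if_splits)
    next
      case F: False
      then have f1: "?f1 {u, v} = c1 \<or> ?f1 {u, v} = c3" using uv by auto
      show ?thesis using closed_onD[OF closed_on_swap[OF S(1)] uv(1) f1] uv(3) F by blast
    qed
  qed
  have "swap_on ?f3 c1 c3 ?T = rot4 f x y0 c0 y1 c1 y2 c2 y3 c3"
  proof (rule swap_on_restore[where x = x and X = ?X and S = S and f = f])
    fix e assume e: "e \<in> E" "x \<in> e \<and> e \<in> ?X"
    then have "swap_on ?f3 c1 c3 ?T e = ?f3 e" using swap_on_edge[OF cl3 e(1), of x] by simp
    then show "swap_on ?f3 c1 c3 ?T e = rot4 f x y0 c0 y1 c1 y2 c2 y3 c3 e"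
      using e(2) by (elim conjE insertE) (simp_all add: rot4_def)
  next
    fix e assume n: "\<not> (e \<in> E \<and> x \<in> e \<and> e \<in> ?X)"
    then have "e \<notin> ?X" by auto
    then show "?f3 e = ?f1 e \<and> rot4 f x y0 c0 y1 c1 y2 c2 y3 c3 e = f e" by (simp add: rot4_def)
  next
    fix e assume e: "e \<in> E" "\<not> (x \<in> e \<and> e \<in> ?X)" "f e = c1 \<or> f e = c3"
    then have "x \<notin> e" using old by blast
    then show "e \<inter> S = {} \<longleftrightarrow> e \<inter> ?T = {}" by blast
  qed
  then have "?f3 \<approx> rot4 f x y0 c0 y1 c1 y2 c2 y3 c3" using keq_swap[OF _ _ cl3] by simp
  then show ?thesis using c1(2) c2(1) c3 by (meson keq_trans)
qed

section \<open>Cycles of length four that resist rotation\<close>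

definition stuck4 where
  "stuck4 f x \<alpha> y0 c0 y1 c1 y2 c2 y3 c3 \<longleftrightarrow>
     cyc4 f x \<alpha> y0 c0 y1 c1 y2 c2 y3 c3 \<and> \<not> f \<approx> rot4 f x y0 c0 y1 c1 y2 c2 y3 c3"

lemma stuck4_rotate:
  "stuck4 f x \<alpha> y0 c0 y1 c1 y2 c2 y3 c3 \<Longrightarrow> stuck4 f x \<alpha> y1 c1 y2 c2 y3 c3 y0 c0"
  using cyc4_rotate[of f x \<alpha> y0 c0 y1 c1 y2 c2 y3 c3] rot4_rotate[of f x \<alpha> y0 c0 y1 c1 y2 c2 y3 c3]
  unfolding stuck4_def by simp

lemma stuck4_cyc4:
  "stuck4 f x \<alpha> y0 c0 y1 c1 y2 c2 y3 c3 \<Longrightarrow> cyc4 f x \<alpha> y0 c0 y1 c1 y2 c2 y3 c3"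
  by (simp add: stuck4_def)

lemma stuck4_swap:
  assumes st: "stuck4 f x \<alpha> y0 c0 y1 c1 y2 c2 y3 c3"
    and S: "closed_on f p q S" "p \<in> A" "q \<in> A" and x: "x \<notin> S"
    and y: "y0 \<in> S \<Longrightarrow> c1 \<noteq> p \<and> c1 \<noteq> q" "y1 \<in> S \<Longrightarrow> c2 \<noteq> p \<and> c2 \<noteq> q"
      "y2 \<in> S \<Longrightarrow> c3 \<noteq> p \<and> c3 \<noteq> q" "y3 \<in> S \<Longrightarrow> c0 \<noteq> p \<and> c0 \<noteq> q"
  shows "stuck4 (swap_on f p q S) x \<alpha> y0 c0 y1 c1 y2 c2 y3 c3"
proof -
  let ?g = "swap_on f p q S" and ?r = "\<lambda>f. rot4 f x y0 c0 y1 c1 y2 c2 y3 c3"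
  have cy: "cyc4 f x \<alpha> y0 c0 y1 c1 y2 c2 y3 c3" using st by (simp add: stuck4_def)
  note D = cyc4D[OF cy]
  have ne: "{x, y0} \<noteq> {x, y1}" "{x, y0} \<noteq> {x, y2}" "{x, y0} \<noteq> {x, y3}"
    "{x, y1} \<noteq> {x, y2}" "{x, y1} \<noteq> {x, y3}" "{x, y2} \<noteq> {x, y3}"
    using D by (auto simp: doubleton_eq_iff)
  have rg: "?r g {x, y0} = c1" "?r g {x, y1} = c2" "?r g {x, y2} = c3" "?r g {x, y3} = c0" for g
    using ne by (simp_all add: rot4_def)
  have "?g {x, y0} = c0" "?g {x, y1} = c1" "?g {x, y2} = c2" "?g {x, y3} = c3"
    using swap_on_edge[OF S(1), of _ x] x D by auto
  moreover have "miss ?g x \<alpha>" using D x by (simp add: miss_swap[OF S(1)])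
  moreover have "miss ?g y0 c1" "miss ?g y1 c2" "miss ?g y2 c3" "miss ?g y3 c0"
    using D y by (auto simp: miss_swap[OF S(1)] swap_color_def)
  ultimately have cyg: "cyc4 ?g x \<alpha> y0 c0 y1 c1 y2 c2 y3 c3"
    unfolding cyc4_def using D col_swap[OF D(1) S(2,3,1)] by simp
  have clr: "closed_on (?r f) p q S"
    unfolding closed_on_def
  proof (intro ballI impI)
    fix e assume e: "e \<in> E" "?r f e = p \<or> ?r f e = q" "e \<inter> S \<noteq> {}"
    show "e \<subseteq> S"
    proof (cases "e \<in> {{x, y0}, {x, y1}, {x, y2}, {x, y3}}")
      case True
      then show ?thesis using e x y by (elim insertE emptyE) (auto simp: rg)
    next
      case False
      then show ?thesis using e S(1) by (auto simp: rot4_def closed_on_def)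
    qed
  qed
  have comm: "swap_on (?r f) p q S = ?r ?g"
  proof
    fix e show "swap_on (?r f) p q S e = ?r ?g e"
    proof (cases "e \<in> {{x, y0}, {x, y1}, {x, y2}, {x, y3}}")
      case True
      then have "swap_color p q (?r f e) = ?r f e \<or> e \<inter> S = {}"
        using x y by (elim insertE emptyE) (auto simp: rg swap_color_def)
      moreover have "?r ?g e = ?r f e" using True by (auto simp: rg)
      ultimately show ?thesis by (auto simp: swap_on_def)
    next
      case False
      then show ?thesis by (simp add: rot4_def swap_on_def)
    qed
  qed
  have "\<not> ?g \<approx> ?r ?g"
  proof
    assume "?g \<approx> ?r ?g"
    then have "f \<approx> ?r ?g" using keq_swap[OF S(2,3,1)] keq_trans by blast
    moreover have "?r ?g \<approx> ?r f" using keq_swap[OF S(2,3) clr] comm keq_sym by metis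
    ultimately show False using st keq_trans unfolding stuck4_def by blast
  qed
  with cyg show ?thesis by (simp add: stuck4_def)
qed

lemma stuck4_link_center:
  assumes st: "stuck4 f x \<alpha> y0 c0 y1 c1 y2 c2 y3 c3" and S: "closed_on f \<alpha> c1 S"
  shows "x \<in> S \<longleftrightarrow> y0 \<in> S"
  using rot4_unlinked_center[OF stuck4_cyc4[OF st] S]
    rot4_unlinked_center[OF stuck4_cyc4[OF st] closed_on_compl[OF S]] st
  unfolding stuck4_def by blast

lemma stuck4_link_leaves:
  assumes missing: "\<And>f v. col f \<Longrightarrow> \<exists>c\<in>A. miss f v c" and A: "card A \<le> 5"
    and st: "stuck4 f x \<alpha> y0 c0 y1 c1 y2 c2 y3 c3" and S: "closed_on f c1 c2 S"
  shows "y0 \<in> S \<longleftrightarrow> y1 \<in> S"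
  using rot4_unlinked_leaves[OF missing A stuck4_cyc4[OF st] S]
    rot4_unlinked_leaves[OF missing A stuck4_cyc4[OF st] closed_on_compl[OF S]] st
  unfolding stuck4_def by blast

text \<open>The chain through \<open>x\<close> in the colours missing at two opposite leaves has
  exactly these leaves as its ends. Such a link has no counterpart for length three.\<close>

definition opposite_linked where
  "opposite_linked f x y c z d \<longleftrightarrow> (\<exists>K. closed_on f c d K \<and> x \<in> K \<and> y \<in> K \<and> z \<in> K \<and>
     (\<forall>w\<in>K. miss f w c \<or> miss f w d \<longrightarrow> w = y \<or> w = z))"

lemma opposite_linked_commute: "opposite_linked f x y c z d \<Longrightarrow> opposite_linked f x z d y c"
  unfolding opposite_linked_def using closed_on_commute by blast

lemma stuck4_leaf_edge:
  assumes missing: "\<And>f v. col f \<Longrightarrow> \<exists>c\<in>A. miss f v c" and A: "card A \<le> 5"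
    and st: "stuck4 f x \<alpha> y0 c0 y1 c1 y2 c2 y3 c3" and k: "\<kappa> = \<alpha> \<or> \<kappa> = c2"
  obtains r where "{y0, r} \<in> E" "f {y0, r} = \<kappa>" "r \<noteq> x" "r \<noteq> y0"
proof -
  note D = cyc4D[OF stuck4_cyc4[OF st]]
  have "\<not> miss f y0 \<kappa>"
  proof
    assume "miss f y0 \<kappa>"
    then have "closed_on f \<kappa> c1 {y0}" using closed_on_single D by blast
    then show False using k stuck4_link_center[OF st, of "{y0}"] stuck4_link_leaves[OF missing A st, of "{y0}"] D closed_on_commute by auto
  qed
  then obtain r where "{y0, r} \<in> E" "f {y0, r} = \<kappa>" "y0 \<noteq> r" by (rule not_missE)
  moreover then have "r \<noteq> x" using D k by (auto simp: insert_commute)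
  ultimately show ?thesis using that by blast
qed

text \<open>Here \<open>\<alpha>\<close> and the cycle colours exhaust the palette, so a vertex
  \<open>r\<close> off the cycle would have to miss one of them. Each case is refuted as for length
  three, by making \<open>r\<close> miss \<open>c1\<close>; for the colour \<open>c3\<close> the
  second end of the chain is the opposite leaf \<open>y2\<close>, which \<open>op\<close>
  supplies.\<close>

lemma stuck4_leaf_nbr:
  assumes missing: "\<And>f v. col f \<Longrightarrow> \<exists>c\<in>A. miss f v c" and A: "card A \<le> 5"
    and st: "stuck4 f x \<alpha> y0 c0 y1 c1 y2 c2 y3 c3"
    and op: "opposite_linked f x y0 c1 y2 c3"
    and r: "{y0, r} \<in> E" "f {y0, r} = \<alpha> \<or> f {y0, r} = c2"
  shows "r = y1 \<or> r = y2 \<or> r = y3"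
proof (rule ccontr)
  assume "\<not> ?thesis"
  then have rW: "r \<noteq> y1" "r \<noteq> y2" "r \<noteq> y3" by auto
  note D = cyc4D[OF stuck4_cyc4[OF st]]
  have "A = {\<alpha>, c0, c1, c2, c3}"
  proof (rule card_seteq[symmetric])
    have "card {\<alpha>, c0, c1, c2, c3} = 5" using D by auto
    then show "card A \<le> card {\<alpha>, c0, c1, c2, c3}" using A by simp
  qed (use finite_A D in auto)
  then obtain \<mu> where m: "\<mu> \<in> {\<alpha>, c0, c1, c2, c3}" "\<mu> \<in> A" and mr: "miss f r \<mu>" using missing[OF D(1), of r] by blast
  have rx: "r \<noteq> x" using r D by (auto simp: insert_commute)
  have ry: "r \<noteq> y0" using r edge_neq by blast
  have base: False if st': "stuck4 g x \<alpha> y0 c0 y1 c1 y2 c2 y3 c3" and g: "g {y0, r} = f {y0, r}" "miss g r c1" for g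
  proof -
    note D' = cyc4D[OF stuck4_cyc4[OF st']]
    have "closed_on g (f {y0, r}) c1 {y0, r}"
      using closed_on_pair[OF D'(1) r(1) g(1)] D' g(2) by simp
    then have "closed_on g \<alpha> c1 {y0, r} \<or> closed_on g c1 c2 {y0, r}"
      using r(2) closed_on_commute by auto
    then show False
      using stuck4_link_center[OF st', of "{y0, r}"] stuck4_link_leaves[OF missing A st', of "{y0, r}"] D rx rW by auto
  qed
  have step: False if K: "closed_on f \<mu> c1 K" "y0 \<in> K" "x \<in> K" "r \<notin> K"
    and yK: "\<mu> = c0 \<Longrightarrow> y3 \<in> K" "\<mu> = c2 \<Longrightarrow> y1 \<in> K" "\<mu> = c3 \<Longrightarrow> y2 \<in> K" for K
  proof -
    have clK: "closed_on f \<mu> c1 (- K)" using closed_on_compl[OF K(1)] .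
    have "stuck4 (swap_on f \<mu> c1 (- K)) x \<alpha> y0 c0 y1 c1 y2 c2 y3 c3"
      using stuck4_swap[OF st clK m(2) D(4)] D K yK by auto
    moreover have "swap_on f \<mu> c1 (- K) {y0, r} = f {y0, r}"
      using swap_on_edge[OF clK r(1), of y0] K(2) by simp
    moreover have "miss (swap_on f \<mu> c1 (- K)) r c1"
      using K(4) mr by (simp add: miss_swap[OF clK] swap_color_def)
    ultimately show False using base by blast
  qed
  show False
  proof (cases "\<mu> = c1")
    case True
    then show False using base st mr by blast
  next
    case n1: False
    show False
    proof (cases "\<mu> = c3")
      case True
      then show False using step op mr ry rW D unfolding opposite_linked_def
        by (metis closed_on_commute)
    next
      case n3: False
      obtain K v where K: "closed_on f \<mu> c1 K" "y0 \<in> K"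
        and Kv: "\<And>w. \<lbrakk>w \<in> K; miss f w \<mu> \<or> miss f w c1\<rbrakk> \<Longrightarrow> w = y0 \<or> w = v"
        using three_ends[OF D(1), of y0 \<mu> c1] D by blast
      consider "\<mu> = \<alpha>" | "\<mu> = c0" | "\<mu> = c2" using m n1 n3 by blast
      then show False
      proof cases
        case 1
        then have "x \<in> K" using stuck4_link_center[OF st] K by simp
        then show ?thesis using Kv[of x] Kv[of r] D mr rx ry 1 K step by auto
      next
        case 2
        then have y3: "y3 \<in> K"
          using stuck4_link_leaves[OF missing A stuck4_rotate[OF stuck4_rotate[OF stuck4_rotate[OF st]]], of K] K by simp
        moreover have "x \<in> K" using closed_on_iff[OF K(1), of x y0] D K(2) 2 by simp
        ultimately show ?thesis using Kv[of y3] Kv[of r] D mr rW ry 2 K step by auto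
      next
        case 3
        then have y1: "y1 \<in> K" using stuck4_link_leaves[OF missing A st, of K] K closed_on_commute by simp
        moreover have "x \<in> K" using closed_on_iff[OF K(1), of x y1] D y1 by simp
        ultimately show ?thesis using Kv[of y1] Kv[of r] D mr rW ry 3 K step by auto
      qed
    qed
  qed
qed

section \<open>Taking an edge out of a colour class\<close>

text \<open>Only the class of \<open>s\<close> is recorded and the remaining colours are left open,
  so swaps of two other colours may precede the actual step.\<close>

definition removable :: "('a set \<Rightarrow> nat) \<Rightarrow> nat \<Rightarrow> 'a set \<Rightarrow> bool" where
  "removable f s e \<longleftrightarrow> (\<exists>g. f \<approx> g \<and> (\<forall>d\<in>E. g d = s \<longleftrightarrow> f d = s \<and> d \<noteq> e))"

definition movable :: "('a set \<Rightarrow> nat) \<Rightarrow> nat \<Rightarrow> 'a set \<Rightarrow> 'a set \<Rightarrow> bool" where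
  "movable f s e e' \<longleftrightarrow> (\<exists>g. f \<approx> g \<and> (\<forall>d\<in>E. g d = s \<longleftrightarrow> f d = s \<and> d \<noteq> e \<or> d = e'))"

lemma swap_on_other: "\<lbrakk>s \<noteq> p; s \<noteq> q\<rbrakk> \<Longrightarrow> swap_on f p q S e = s \<longleftrightarrow> f e = s"
  by (auto simp: swap_on_def swap_color_def)

lemma removable_swap:
  assumes "p \<in> A" "q \<in> A" "closed_on f p q S" "s \<noteq> p" "s \<noteq> q" "removable (swap_on f p q S) s e"
  shows "removable f s e"
  using assms keq_trans[OF keq_swap[OF assms(1-3)]] unfolding removable_def
  by (simp add: swap_on_other) blast

lemma removable_recolor:
  assumes "col f" "{x, y} \<in> E" "f {x, y} = s" "miss f x c" "miss f y c" "c \<in> A"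
  shows "removable f s {x, y}"
  unfolding removable_def
  using keq_recolor(1)[OF assms(1,2,4,5,6)] missD[OF assms(4), of y] assms
  by (intro exI[of _ "f({x, y} := c)"]) auto

lemma removable_recolor_other:
  assumes "col f" "{x, y} \<in> E" "miss f x c" "miss f y c" "c \<in> A" "c \<noteq> s" "f {x, y} \<noteq> s"
    "removable (f({x, y} := c)) s e"
  shows "removable f s e"
proof -
  obtain g where g: "f({x, y} := c) \<approx> g" "\<forall>d\<in>E. g d = s \<longleftrightarrow> (f({x, y} := c)) d = s \<and> d \<noteq> e"
    using assms(8) unfolding removable_def by blast
  have "f \<approx> g" using keq_trans[OF keq_recolor(1)[OF assms(1-5)] g(1)] .
  moreover have "\<forall>d\<in>E. g d = s \<longleftrightarrow> f d = s \<and> d \<noteq> e" using g(2) assms(6,7) by auto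
  ultimately show ?thesis unfolding removable_def by blast
qed

text \<open>With \<open>x\<close> outside \<open>S\<close>, the swap on \<open>S\<close> makes
  \<open>y0\<close> and \<open>y3\<close> a fan cycle of length two. With \<open>x\<close> inside,
  the swap off \<open>S\<close> makes \<open>y2\<close> miss \<open>c1\<close> as \<open>y0\<close>
  does, so \<open>x\<close>, \<open>y0\<close> and \<open>y2\<close> cannot share a chain in
  \<open>\<alpha>\<close>, \<open>c1\<close>. If \<open>x\<close> is off the chain of
  \<open>y0\<close>, then \<open>\<alpha>\<close> can be freed at \<open>y0\<close>; otherwise it
  can be freed at \<open>y2\<close>.\<close>

lemma cyc4_opposite:
  assumes cy: "cyc4 f x \<alpha> y0 s y1 c1 y2 c2 y3 c3"
    and S: "closed_on f c1 c3 S" "y0 \<in> S" "y2 \<notin> S"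
  shows "removable f s {x, y0} \<or> movable f s {x, y0} {x, y3}"
proof (cases "x \<in> S")
  case False
  note D = cyc4D[OF cy]
  note [simp] = D(1-38) D(8-17)[symmetric] D(30-39)[symmetric]
  let ?f1 = "swap_on f c1 c3 S"
  have c1: "col ?f1" "f \<approx> ?f1" using col_swap keq_swap S by auto
  have m1: "miss ?f1 y0 c3" "miss ?f1 y3 s"
    using S by (simp_all add: miss_swap swap_color_def)
  have e1: "?f1 {x, y0} = s" "?f1 {x, y3} = c3"
    using False swap_on_edge[OF S(1), of _ x] by simp_all
  have "?f1 \<approx> ?f1({x, y0} := c3, {x, y3} := s)"
    using keq_pair[OF c1(1) _ _ _ e1 m1] by simp
  then have "f \<approx> ?f1({x, y0} := c3, {x, y3} := s)" using c1(2) keq_trans by blast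
  then have "movable f s {x, y0} {x, y3}"
    unfolding movable_def
    by (intro exI[of _ "?f1({x, y0} := c3, {x, y3} := s)"]) (auto simp: swap_on_other)
  then show ?thesis ..
next
  case True
  note D = cyc4D[OF cy]
  note [simp] = D(1-38) D(8-17)[symmetric] D(30-39)[symmetric] doubleton_eq_iff
  have cl: "closed_on f c1 c3 (- S)" using closed_on_compl[OF S(1)] .
  let ?f1 = "swap_on f c1 c3 (- S)"
  have c1: "col ?f1" using col_swap cl by auto
  have m1: "miss ?f1 x \<alpha>" "miss ?f1 y0 c1" "miss ?f1 y1 c2" "miss ?f1 y2 c1"
    using S True by (simp_all add: miss_swap[OF cl] swap_color_def)
  have e1: "?f1 {x, y0} = s" "?f1 {x, y1} = c1" "?f1 {x, y2} = c2"
    using True swap_on_edge[OF cl, of _ x] by simp_all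
  obtain K v where K: "closed_on ?f1 \<alpha> c1 K" "y0 \<in> K"
    and Kv: "\<And>w. \<lbrakk>w \<in> K; miss ?f1 w \<alpha> \<or> miss ?f1 w c1\<rbrakk> \<Longrightarrow> w = y0 \<or> w = v"
    using three_ends[OF c1, of y0 \<alpha> c1] m1 by blast
  have "removable ?f1 s {x, y0}"
  proof (cases "x \<in> K")
    case False
    let ?f2 = "swap_on ?f1 \<alpha> c1 K"
    have "col ?f2" using col_swap c1 K by auto
    moreover have "miss ?f2 x \<alpha>" "miss ?f2 y0 \<alpha>"
      using m1 K(2) False by (simp_all add: miss_swap[OF K(1)] swap_color_def)
    moreover have "?f2 {x, y0} = s" using e1 by (simp add: swap_on_other)
    ultimately have "removable ?f2 s {x, y0}" using removable_recolor by simp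
    then show ?thesis using removable_swap[OF _ _ K(1)] by simp
  next
    case True
    have y2: "y2 \<notin> K" using Kv[of y2] Kv[of x] True m1 D(9,14,16) by metis
    have clK: "closed_on ?f1 \<alpha> c1 (- K)" using closed_on_compl[OF K(1)] .
    let ?f2 = "swap_on ?f1 \<alpha> c1 (- K)"
    have c2: "col ?f2" using col_swap c1 clK by auto
    have m2: "miss ?f2 x \<alpha>" "miss ?f2 y0 c1" "miss ?f2 y1 c2" "miss ?f2 y2 \<alpha>"
      using m1 K(2) True y2 by (simp_all add: miss_swap[OF clK] swap_color_def)
    have e2: "?f2 {x, y0} = s" "?f2 {x, y1} = c1" "?f2 {x, y2} = c2"
      using True e1 swap_on_edge[OF clK, of _ x] by simp_all
    \<comment> \<open>A shift along the fan \<open>y0\<close>, \<open>y1\<close>, \<open>y2\<close>,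
      whose last vertex now misses \<open>\<alpha>\<close>.\<close>
    let ?f3 = "?f2({x, y2} := \<alpha>)"
    have c3: "col ?f3" "miss ?f3 x c2"
      using keq_recolor(2)[of ?f2 x y2 \<alpha>] keq_recolor(3)[of ?f2 x y2 \<alpha> c2] c2 m2 e2 by auto
    have m3: "miss ?f3 y1 c2" "miss ?f3 y0 c1" using m2 by (simp_all add: miss_other)
    let ?f4 = "?f3({x, y1} := c2)"
    have c4: "col ?f4" "miss ?f4 x c1"
      using keq_recolor(2)[of ?f3 x y1 c2] keq_recolor(3)[of ?f3 x y1 c2 c1] c3 m3 e2 by auto
    have "miss ?f4 y0 c1" using m3 by (simp add: miss_other)
    then have "removable ?f4 s {x, y0}" using removable_recolor c4 e2 by simp
    then have "removable ?f3 s {x, y0}"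
      using removable_recolor_other[of ?f3 x y1 c2] c3 m3 e2 by simp
    then have "removable ?f2 s {x, y0}"
      using removable_recolor_other[of ?f2 x y2 \<alpha>] c2 m2 e2 by simp
    then show ?thesis using removable_swap[OF _ _ clK] by simp
  qed
  then show ?thesis using removable_swap[OF _ _ cl] by simp
qed

text \<open>A rotation would move \<open>s\<close> to \<open>{x, y3}\<close>, so the cycle is stuck.
  Every leaf then has an edge in \<open>\<alpha>\<close> and in the colour of the edge two steps
  ahead; these edges stay within the cycle, and the colours already placed leave one possible end
  for each.\<close>

theorem cyc4_movable:
  assumes missing: "\<And>f v. col f \<Longrightarrow> \<exists>c\<in>A. miss f v c" and A: "card A \<le> 5"
    and cy: "cyc4 f x \<alpha> y0 s y1 c1 y2 c2 y3 c3"
    and not: "\<not> removable f s {x, y0}" "\<not> movable f s {x, y0} {x, y3}"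
  shows "{y0, y1} \<in> E \<and> {y0, y2} \<in> E \<and> {y0, y3} \<in> E \<and> {y1, y2} \<in> E \<and> {y1, y3} \<in> E \<and> {y2, y3} \<in> E"
proof -
  note D = cyc4D[OF cy]
  have "\<not> f \<approx> rot4 f x y0 s y1 c1 y2 c2 y3 c3"
  proof
    assume r: "f \<approx> rot4 f x y0 s y1 c1 y2 c2 y3 c3"
    have ne: "{x, y0} \<noteq> {x, y1}" "{x, y0} \<noteq> {x, y2}" "{x, y0} \<noteq> {x, y3}"
      "{x, y1} \<noteq> {x, y2}" "{x, y1} \<noteq> {x, y3}" "{x, y2} \<noteq> {x, y3}"
      using D(8-17) by (auto simp: doubleton_eq_iff)
    have "\<forall>d\<in>E. rot4 f x y0 s y1 c1 y2 c2 y3 c3 d = s \<longleftrightarrow> f d = s \<and> d \<noteq> {x, y0} \<or> d = {x, y3}"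
      using D(22-25,30-35) ne by (auto simp: rot4_def)
    then show False using r not(2) unfolding movable_def by blast
  qed
  then have st: "stuck4 f x \<alpha> y0 s y1 c1 y2 c2 y3 c3" using cy by (simp add: stuck4_def)
  have st1: "stuck4 f x \<alpha> y1 c1 y2 c2 y3 c3 y0 s" using stuck4_rotate[OF st] .
  have st2: "stuck4 f x \<alpha> y2 c2 y3 c3 y0 s y1 c1" using stuck4_rotate[OF st1] .
  have st3: "stuck4 f x \<alpha> y3 c3 y0 s y1 c1 y2 c2" using stuck4_rotate[OF st2] .
  have op: "opposite_linked f x y0 c1 y2 c3"
  proof -
    obtain K v where K: "closed_on f c1 c3 K" "y0 \<in> K"
      and Kv: "\<And>w. \<lbrakk>w \<in> K; miss f w c1 \<or> miss f w c3\<rbrakk> \<Longrightarrow> w = y0 \<or> w = v"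
      using three_ends[OF D(1), of y0 c1 c3] D by blast
    have y2: "y2 \<in> K" using cyc4_opposite[OF cy K] not by blast
    then have "x \<in> K"
      using rot4_separated[OF cy closed_on_compl[OF K(1)]] K(2) st unfolding stuck4_def by blast
    moreover have "\<forall>w\<in>K. miss f w c1 \<or> miss f w c3 \<longrightarrow> w = y0 \<or> w = y2"
      using Kv Kv[of y2] y2 D by auto
    ultimately show ?thesis unfolding opposite_linked_def using K y2 by blast
  qed
  have nb: "u = w" if "{v, u} \<in> E" "f {v, u} = c" "{v, w} \<in> E" "f {v, w} = c" for u v w c
    using col_nbr[OF D(1) that(1,3)] that by simp
  have ms: "f {u, v} \<noteq> c" if "miss f v c" "{u, v} \<in> E" for u v c
    using missD'[OF that] .
  have xe: "{y0, x} \<in> E" "{y1, x} \<in> E" "{y2, x} \<in> E" "{y3, x} \<in> E"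
    "f {y0, x} = s" "f {y1, x} = c1" "f {y2, x} = c2" "f {y3, x} = c3"
    using D by (simp_all add: insert_commute)
  have e03: "{y0, y3} \<in> E" "f {y0, y3} = c2"
  proof -
    obtain r where r: "{y0, r} \<in> E" "f {y0, r} = c2" "r \<noteq> x" using stuck4_leaf_edge[OF missing A st] by metis
    have "r \<noteq> y1" using ms[OF D(27), of y0] r by auto
    moreover have "r \<noteq> y2" using nb[of y2 y0 c2 x] r xe D by (auto simp: insert_commute)
    ultimately have "r = y3" using stuck4_leaf_nbr[OF missing A st op r(1)] r(2) by blast
    then show "{y0, y3} \<in> E" "f {y0, y3} = c2" using r by auto
  qed
  have e21: "{y2, y1} \<in> E" "f {y2, y1} = s"
  proof -
    obtain r where r: "{y2, r} \<in> E" "f {y2, r} = s" "r \<noteq> x" using stuck4_leaf_edge[OF missing A st2] by metis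
    have "r \<noteq> y3" using ms[OF D(29), of y2] r by auto
    moreover have "r \<noteq> y0" using nb[of y0 y2 s x] r xe D by (auto simp: insert_commute)
    ultimately have "r = y1"
      using stuck4_leaf_nbr[OF missing A st2 opposite_linked_commute[OF op] r(1)] r(2) by blast
    then show "{y2, y1} \<in> E" "f {y2, y1} = s" using r by auto
  qed
  \<comment> \<open>\<open>cyc4_opposite\<close> concerns only the pair of leaves that contains the
    end of the \<open>s\<close>-edge. For the other pair the edges just found form the chain
    \<open>y1\<close>, \<open>y2\<close>, \<open>x\<close>, \<open>y0\<close>, \<open>y3\<close> in
    \<open>s\<close> and \<open>c2\<close>.\<close>
  have op1: "opposite_linked f x y1 c2 y3 s"
  proof -
    obtain K v where K: "closed_on f c2 s K" "y1 \<in> K"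
      and Kv: "\<And>w. \<lbrakk>w \<in> K; miss f w c2 \<or> miss f w s\<rbrakk> \<Longrightarrow> w = y1 \<or> w = v"
      using three_ends[OF D(1), of y1 c2 s] D by blast
    have "y2 \<in> K" using closed_on_iff[OF K(1) e21(1)] e21(2) K(2) by blast
    then have x: "x \<in> K" using closed_on_iff[OF K(1) xe(3)] xe by blast
    then have "y0 \<in> K" using closed_on_iff[OF K(1) xe(1)] xe by blast
    then have y3: "y3 \<in> K" using closed_on_iff[OF K(1) e03(1)] e03(2) by blast
    moreover have "\<forall>w\<in>K. miss f w c2 \<or> miss f w s \<longrightarrow> w = y1 \<or> w = y3"
      using Kv Kv[of y3] y3 D by auto
    ultimately show ?thesis unfolding opposite_linked_def using K x by blast
  qed
  have e10: "{y1, y0} \<in> E" "f {y1, y0} = c3"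
  proof -
    obtain r where r: "{y1, r} \<in> E" "f {y1, r} = c3" "r \<noteq> x" using stuck4_leaf_edge[OF missing A st1] by metis
    have "r \<noteq> y2" using ms[OF D(28), of y1] r by auto
    moreover have "r \<noteq> y3" using nb[of y3 y1 c3 x] r xe D by (auto simp: insert_commute)
    ultimately have "r = y0" using stuck4_leaf_nbr[OF missing A st1 op1 r(1)] r(2) by blast
    then show "{y1, y0} \<in> E" "f {y1, y0} = c3" using r by auto
  qed
  have e32: "{y3, y2} \<in> E" "f {y3, y2} = c1"
  proof -
    obtain r where r: "{y3, r} \<in> E" "f {y3, r} = c1" "r \<noteq> x" using stuck4_leaf_edge[OF missing A st3] by metis
    have "r \<noteq> y0" using ms[OF D(26), of y3] r by auto
    moreover have "r \<noteq> y1" using nb[of y1 y3 c1 x] r xe D by (auto simp: insert_commute)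
    ultimately have "r = y2"
      using stuck4_leaf_nbr[OF missing A st3 opposite_linked_commute[OF op1] r(1)] r(2) by blast
    then show "{y3, y2} \<in> E" "f {y3, y2} = c1" using r by auto
  qed
  have e02: "{y0, y2} \<in> E"
  proof -
    obtain r where r: "{y0, r} \<in> E" "f {y0, r} = \<alpha>" "r \<noteq> x" using stuck4_leaf_edge[OF missing A st] by metis
    then have "r \<noteq> y3" "r \<noteq> y1" using e03 e10 D by (auto simp: insert_commute)
    then show ?thesis using stuck4_leaf_nbr[OF missing A st op r(1)] r by blast
  qed
  have e13: "{y1, y3} \<in> E"
  proof -
    obtain r where r: "{y1, r} \<in> E" "f {y1, r} = \<alpha>" "r \<noteq> x" using stuck4_leaf_edge[OF missing A st1] by metis
    then have "r \<noteq> y0" "r \<noteq> y2" using e21 e10 D by (auto simp: insert_commute)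
    then show ?thesis using stuck4_leaf_nbr[OF missing A st1 op1 r(1)] r by blast
  qed
  show ?thesis using e03 e21 e10 e32 e02 e13 by (simp add: insert_commute)
qed

section \<open>Fans\<close>

definition fan :: "('a set \<Rightarrow> nat) \<Rightarrow> 'a \<Rightarrow> nat \<Rightarrow> 'a list \<Rightarrow> bool" where
  "fan f x s ys \<longleftrightarrow> ys \<noteq> [] \<and> distinct ys \<and> (\<forall>y\<in>set ys. {x, y} \<in> E) \<and> f {x, ys ! 0} = s \<and>
     (\<forall>i. Suc i < length ys \<longrightarrow> miss f (ys ! i) (f {x, ys ! Suc i}))"

lemma fan_color_inj:
  assumes "col f" "fan f x s ys" "i < length ys" "j < length ys" "f {x, ys ! i} = f {x, ys ! j}"
  shows "i = j"
proof -
  have "{x, ys ! i} \<in> E" "{x, ys ! j} \<in> E" "distinct ys" using assms(2-4) by (auto simp: fan_def)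
  then show ?thesis
    using col_nbr[OF assms(1) _ _ assms(5)] nth_eq_iff_index_eq assms(3,4) by blast
qed

text \<open>Giving \<open>\<alpha>\<close> to the last edge frees its old colour at
  \<open>x\<close>, and the preceding fan vertex misses this colour. It takes the place of
  \<open>\<alpha>\<close> for the shorter fan.\<close>

lemma fan_shift:
  assumes "col f" "fan f x s ys" "\<alpha> \<in> A" "\<alpha> \<noteq> s" "miss f x \<alpha>" "miss f (last ys) \<alpha>"
  shows "removable f s {x, ys ! 0}"
  using assms
proof (induction ys arbitrary: f \<alpha> rule: rev_induct)
  case Nil
  then show ?case by (simp add: fan_def)
next
  case (snoc y zs)
  have xy: "{x, y} \<in> E" using snoc.prems(2) by (simp add: fan_def)
  show ?case
  proof (cases "zs = []")
    case True
    then show ?thesis using snoc.prems xy removable_recolor[of f x y s \<alpha>] by (simp add: fan_def)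
  next
    case False
    let ?c = "f {x, y}" and ?g = "f({x, y} := \<alpha>)"
    let ?ys = "zs @ [y]"
    have c_s: "?c \<noteq> s"
      using fan_color_inj[OF snoc.prems(1,2), of 0 "length zs"] False snoc.prems(2)
      by (auto simp: fan_def nth_append)
    have fan_nth: "miss f (?ys ! i) (f {x, ?ys ! Suc i})" if "Suc i < length ?ys" for i
      using snoc.prems(2) that by (simp add: fan_def)
    have mlast: "miss f (last zs) ?c"
      using fan_nth[of "length zs - 1"] False by (simp add: nth_append last_conv_nth)
    have yzs: "y \<notin> set zs" using snoc.prems(2) by (simp add: fan_def)
    have xne: "x \<noteq> y" using edge_neq xy by blast
    have ge: "?g {x, v} = f {x, v}" if "v \<in> set zs" for v
      using that yzs xne by (auto simp: doubleton_eq_iff)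
    have fz: "fan ?g x s zs"
      unfolding fan_def
    proof (intro conjI allI impI)
      show "distinct zs" "\<forall>y\<in>set zs. {x, y} \<in> E" using snoc.prems(2) by (auto simp: fan_def)
      have "f {x, zs ! 0} = s" using snoc.prems(2) False by (simp add: fan_def nth_append)
      then show "?g {x, zs ! 0} = s" using ge[of "zs ! 0"] False by simp
    next
      fix i assume i: "Suc i < length zs"
      have "miss f (zs ! i) (f {x, zs ! Suc i})" using fan_nth[of i] i by (simp add: nth_append)
      moreover have "zs ! i \<in> set zs" "zs ! Suc i \<in> set zs" using i by auto
      moreover have "zs ! i \<noteq> x" using edge_neq snoc.prems(2) calculation(2) by (auto simp: fan_def)
      ultimately show "miss ?g (zs ! i) (?g {x, zs ! Suc i})"
        using ge yzs by (simp add: miss_other) (metis miss_other)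
    qed (use False in simp)
    have my: "miss f y \<alpha>" using snoc.prems(6) by simp
    have lz: "last zs \<noteq> x" "last zs \<noteq> y" "last zs \<in> set zs"
      using yzs edge_neq[of x "last zs"] snoc.prems(2) last_in_set[OF False] by (auto simp: fan_def)
    have "removable ?g s {x, zs ! 0}"
    proof (rule snoc.IH[where \<alpha> = ?c])
      show "col ?g" using keq_recolor(2)[OF snoc.prems(1) xy snoc.prems(5) my snoc.prems(3)] .
      show "fan ?g x s zs" by (rule fz)
      show "?c \<in> A" using col_A[OF snoc.prems(1) xy] .
      show "?c \<noteq> s" by (rule c_s)
      show "miss ?g x ?c" using keq_recolor(3)[OF snoc.prems(1) xy snoc.prems(5) my snoc.prems(3)] by simp
      show "miss ?g (last zs) ?c" using miss_other[OF mlast] lz by blast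
    qed
    then show ?thesis
      using removable_recolor_other[OF snoc.prems(1) xy snoc.prems(5) my snoc.prems(3,4) c_s] False
      by (simp add: nth_append)
  qed
qed

lemma fan_swap:
  assumes "fan f x s ys" "closed_on f p q S" "x \<notin> S"
    and "\<And>i. \<lbrakk>Suc i < length ys; f {x, ys ! Suc i} = p \<or> f {x, ys ! Suc i} = q\<rbrakk> \<Longrightarrow> ys ! i \<notin> S"
  shows "fan (swap_on f p q S) x s ys"
proof -
  have e: "swap_on f p q S {x, y} = f {x, y}" if "y \<in> set ys" for y
    using swap_on_edge[OF assms(2), of "{x, y}" x] assms(1,3) that by (simp add: fan_def)
  have "miss (swap_on f p q S) (ys ! i) (f {x, ys ! Suc i})" if "Suc i < length ys" for i
    using assms(1,4) that by (auto simp: miss_swap[OF assms(2)] fan_def swap_color_def)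
  then show ?thesis using assms(1) e unfolding fan_def by simp
qed

lemma fan_take: "\<lbrakk>fan f x s ys; 0 < j\<rbrakk> \<Longrightarrow> fan f x s (take j ys)"
  unfolding fan_def using set_take_subset[of j ys] by (simp add: subset_iff)

text \<open>The vertex before \<open>ys ! j\<close> and the last vertex both miss the repeated
  colour, and \<open>x\<close> misses \<open>\<alpha>\<close>, so the three do not share a chain. A
  swap therefore frees \<open>\<alpha>\<close> at one of the two fan vertices while \<open>x\<close>
  still misses it, and the fan up to that vertex is shifted.\<close>

lemma fan_repeat:
  assumes f: "col f" and fan: "fan f x s ys" and a: "\<alpha> \<in> A" "\<alpha> \<noteq> s" "miss f x \<alpha>"
    and j: "0 < j" "j < length ys" and m: "miss f (last ys) (f {x, ys ! j})"
  shows "removable f s {x, ys ! 0}"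
proof -
  let ?m = "f {x, ys ! j}" and ?u = "ys ! (j - 1)" and ?w = "last ys"
  have ne: "ys \<noteq> []" using j by auto
  have edge: "{x, ys ! i} \<in> E" if "i < length ys" for i using fan that by (simp add: fan_def)
  have mA: "?m \<in> A" using col_A[OF f edge[OF j(2)]] .
  have am: "\<alpha> \<noteq> ?m" using missD[OF a(3) edge[OF j(2)]] by simp
  have ms: "?m \<noteq> s" using fan_color_inj[OF f fan, of j 0] j fan by (auto simp: fan_def)
  have mu: "miss f ?u ?m"
  proof -
    have "Suc (j - 1) < length ys" "Suc (j - 1) = j" using j by auto
    then show ?thesis using fan unfolding fan_def by metis
  qed
  have "j \<noteq> length ys - 1"
  proof
    assume "j = length ys - 1"
    then have "?w = ys ! j" using ne by (simp add: last_conv_nth)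
    then show False using missD'[OF m, of x] edge[OF j(2)] by simp
  qed
  then have "j - 1 \<noteq> length ys - 1" "j - 1 < length ys" "length ys - 1 < length ys" using j by auto
  moreover have "distinct ys" using fan by (simp add: fan_def)
  ultimately have uw: "?u \<noteq> ?w"
    using ne by (simp add: last_conv_nth nth_eq_iff_index_eq)
  have xu: "x \<noteq> ?u" "x \<noteq> ?w"
    using edge_neq[OF edge[of "j - 1"]] edge_neq[OF edge[of "length ys - 1"]] j ne by (auto simp: last_conv_nth)
  have inj: "f {x, ys ! Suc i} = ?m \<Longrightarrow> Suc i = j" "f {x, ys ! Suc i} \<noteq> \<alpha>" if "Suc i < length ys" for i
    using fan_color_inj[OF f fan that j(2)] missD[OF a(3) edge[OF that]] by auto
  obtain K v where K: "closed_on f \<alpha> ?m K" "?u \<in> K"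
    and Kv: "\<And>w. \<lbrakk>w \<in> K; miss f w \<alpha> \<or> miss f w ?m\<rbrakk> \<Longrightarrow> w = ?u \<or> w = v"
    using three_ends[OF f, of ?u \<alpha> ?m] mu by blast
  show ?thesis
  proof (cases "x \<in> K")
    case False
    let ?g = "swap_on f \<alpha> ?m K"
    \<comment> \<open>The fan is cut because \<open>?u\<close> no longer misses the colour of the
      edge to \<open>ys ! j\<close> after this swap.\<close>
    have "fan ?g x s (take j ys)"
    proof (rule fan_swap[OF fan_take[OF fan j(1)] K(1) False])
      fix i assume i: "Suc i < length (take j ys)"
        "f {x, take j ys ! Suc i} = \<alpha> \<or> f {x, take j ys ! Suc i} = ?m"
      then show "take j ys ! i \<notin> K" using inj[of i] j by auto
    qed
    moreover have "last (take j ys) = ?u" using j by (subst last_conv_nth) (auto simp: min_def)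
    moreover have "miss ?g x \<alpha>" "miss ?g ?u \<alpha>"
      using a mu K(2) False by (simp_all add: miss_swap[OF K(1)] swap_color_def)
    ultimately have "removable ?g s {x, take j ys ! 0}"
      using fan_shift[OF col_swap[OF f a(1) mA K(1)] _ a(1,2)] by simp
    then show ?thesis using removable_swap[OF a(1) mA K(1)] a(2) ms j by simp
  next
    case True
    have "?w \<notin> K" using Kv[of ?w] Kv[of x] True a m uw xu by metis
    have cl: "closed_on f \<alpha> ?m (- K)" using closed_on_compl[OF K(1)] .
    let ?g = "swap_on f \<alpha> ?m (- K)"
    have "fan ?g x s ys"
    proof (rule fan_swap[OF fan cl])
      fix i assume i: "Suc i < length ys" "f {x, ys ! Suc i} = \<alpha> \<or> f {x, ys ! Suc i} = ?m"
      then have "Suc i = j" using inj[of i] by blast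
      then have "i = j - 1" by simp
      then show "ys ! i \<notin> - K" using K(2) by simp
    qed (use True in simp)
    moreover have "miss ?g x \<alpha>" "miss ?g ?w \<alpha>"
      using a m True \<open>?w \<notin> K\<close> by (simp_all add: miss_swap[OF cl] swap_color_def)
    ultimately have "removable ?g s {x, ys ! 0}"
      using fan_shift[OF col_swap[OF f a(1) mA cl] _ a(1,2)] by simp
    then show ?thesis using removable_swap[OF a(1) mA cl] a(2) ms by simp
  qed
qed

text \<open>A longest fan is taken. If its end missed a colour other than \<open>s\<close>, that
  colour would be free at \<open>x\<close>, lie on an edge of the fan, or lie on another edge at
  \<open>x\<close>: a shift, a repetition, or an extension.\<close>

lemma removable_or_fan:
  assumes missing: "\<And>f v. col f \<Longrightarrow> \<exists>c\<in>A. miss f v c"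
    and f: "col f" and e: "{x, y0} \<in> E" "f {x, y0} = s" and a: "\<alpha> \<in> A" "\<alpha> \<noteq> s" "miss f x \<alpha>"
    and nr: "\<not> removable f s {x, y0}"
  obtains ys where "fan f x s ys" "ys ! 0 = y0" "miss f (last ys) s" "\<And>c. \<lbrakk>c \<in> A; c \<noteq> s\<rbrakk> \<Longrightarrow> \<not> miss f (last ys) c"
proof -
  let ?P = "\<lambda>ys. fan f x s ys \<and> ys ! 0 = y0"
  have "?P [y0]" using e by (simp add: fan_def)
  moreover have "\<forall>ys. ?P ys \<longrightarrow> length ys < Suc (card (\<Union>E))"
  proof (intro allI impI)
    fix ys assume "?P ys"
    then have "distinct ys" "set ys \<subseteq> \<Union>E" by (auto simp: fan_def)
    moreover have "finite (\<Union>E)" using finite_E by (intro finite_Union) (auto dest: edgeD)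
    ultimately have "length ys \<le> card (\<Union>E)" by (metis card_mono distinct_card)
    then show "length ys < Suc (card (\<Union>E))" by simp
  qed
  ultimately have "\<exists>ys. ?P ys \<and> (\<forall>zs. ?P zs \<longrightarrow> length zs \<le> length ys)"
    by (rule ex_has_greatest_nat)
  then obtain ys where ys: "fan f x s ys" "ys ! 0 = y0"
    and mx: "\<And>zs. ?P zs \<Longrightarrow> length zs \<le> length ys"
    by blast
  have ne: "ys \<noteq> []" using ys by (simp add: fan_def)
  have no: "\<not> miss f (last ys) c" if c: "c \<in> A" "c \<noteq> s" for c
  proof
    assume m: "miss f (last ys) c"
    show False
    proof (cases "miss f x c")
      case True
      then show False using fan_shift[OF f ys(1) c True m] nr ys(2) by simp
    next
      case False
      then obtain y where y: "{x, y} \<in> E" "f {x, y} = c" by (rule not_missE)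
      show False
      proof (cases "y \<in> set ys")
        case True
        then obtain j where j: "j < length ys" "ys ! j = y" by (auto simp: in_set_conv_nth)
        then have "0 < j" using y c ys e by (cases j) auto
        then show False using fan_repeat[OF f ys(1) a] j m y nr ys(2) by auto
      next
        case n: False
        have "miss f ((ys @ [y]) ! i) (f {x, (ys @ [y]) ! Suc i})" if "Suc i < length (ys @ [y])" for i
        proof (cases "Suc i < length ys")
          case True
          then show ?thesis using ys(1) by (simp add: fan_def nth_append)
        next
          case False
          then have "i = length ys - 1" "Suc i = length ys" using that by auto
          then show ?thesis using m y ne by (simp add: nth_append last_conv_nth)
        qed
        then have "?P (ys @ [y])" using ys n y ne by (auto simp: fan_def nth_append)
        then show False using mx[of "ys @ [y]"] by simp
      qed
    qed
  qed
  moreover have "miss f (last ys) s" using missing[OF f, of "last ys"] no by blast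
  ultimately show ?thesis using that ys by blast
qed

text \<open>The last vertex misses the colour \<open>s\<close> of the first edge, so the fan is a
  cycle, and rotating it carries \<open>s\<close> to the last edge. Its edges have distinct colours
  other than \<open>\<alpha>\<close>, whence its length is at most four.\<close>

theorem removable_or_movable:
  assumes missing: "\<And>f v. col f \<Longrightarrow> \<exists>c\<in>A. miss f v c" and A: "card A \<le> 5"
    and no_K5: "\<And>W. card W = 5 \<Longrightarrow> \<exists>u\<in>W. \<exists>v\<in>W. u \<noteq> v \<and> {u, v} \<notin> E"
    and f: "col f" and e: "{x, y0} \<in> E" "f {x, y0} = s"
    and nr: "\<not> removable f s {x, y0}"
  obtains z where "{x, z} \<in> E" "z \<noteq> y0" "miss f z s" "\<And>c. \<lbrakk>c \<in> A; c \<noteq> s\<rbrakk> \<Longrightarrow> \<not> miss f z c"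
    "movable f s {x, y0} {x, z}"
proof -
  obtain \<alpha> where a: "\<alpha> \<in> A" "miss f x \<alpha>" using missing[OF f] by blast
  then have as: "\<alpha> \<noteq> s" using missD e by blast
  obtain ys where ys: "fan f x s ys" "ys ! 0 = y0" "miss f (last ys) s"
    and full: "\<And>c. \<lbrakk>c \<in> A; c \<noteq> s\<rbrakk> \<Longrightarrow> \<not> miss f (last ys) c"
    using removable_or_fan[OF missing f e a(1) as a(2) nr] by blast
  let ?z = "last ys"
  have ne: "ys \<noteq> []" and dist: "distinct ys" and edges: "\<And>y. y \<in> set ys \<Longrightarrow> {x, y} \<in> E"
    and ch: "\<And>i. Suc i < length ys \<Longrightarrow> miss f (ys ! i) (f {x, ys ! Suc i})"
    using ys(1) by (auto simp: fan_def)
  have xz: "{x, ?z} \<in> E" using edges ne by simp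
  have zy: "?z \<noteq> y0" using missD'[OF ys(3), of x] xz e by auto
  have "length ys \<le> 4"
  proof -
    have "inj_on (\<lambda>y. f {x, y}) (set ys)"
      using col_nbr[OF f] edges by (auto simp: inj_on_def)
    moreover have "(\<lambda>y. f {x, y}) ` set ys \<subseteq> A - {\<alpha>}"
      using col_A[OF f] edges missD[OF a(2)] by auto
    ultimately have "card (set ys) \<le> card (A - {\<alpha>})"
      using card_inj_on_le finite_A by blast
    then show ?thesis using dist A a(1) finite_A by (simp add: distinct_card)
  qed
  moreover have "0 < length ys" using ne by simp
  ultimately have len: "length ys = 1 \<or> length ys = 2 \<or> length ys = 3 \<or> length ys = 4"
    by linarith
  have "movable f s {x, y0} {x, ?z}"
  proof -
    consider "length ys = 1" | "length ys = 2" | "length ys = 3" | "length ys = 4" using len by blast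
    then show ?thesis
    proof cases
      case 1
      then show ?thesis using zy ys(2) ne by (simp add: last_conv_nth)
    next
      case 2
      then obtain y1 where y: "ys = [y0, y1]"
        using ys(2) by (auto simp: numeral_2_eq_2 length_Suc_conv)
      have E2: "{x, y1} \<in> E" "y0 \<noteq> y1" "miss f y0 (f {x, y1})" "miss f y1 s"
        using edges[of y1] dist ch[of 0] ys(3) y by auto
      have xn: "x \<noteq> y0" "x \<noteq> y1" using edge_neq e(1) E2(1) by auto
      have s1: "f {x, y1} \<noteq> s" using missD'[OF E2(4,1)] .
      have "f \<approx> f({x, y0} := f {x, y1}, {x, y1} := s)"
        using keq_pair[OF f e(1) E2(1,2) e(2) refl E2(3,4)] .
      then show ?thesis
        unfolding movable_def using E2 e s1 y xn
        by (intro exI[of _ "f({x, y0} := f {x, y1}, {x, y1} := s)"]) (auto simp: doubleton_eq_iff)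
    next
      case 3
      then obtain y1 y2 where y: "ys = [y0, y1, y2]"
        using ys(2) by (auto simp: numeral_3_eq_3 length_Suc_conv)
      have cy: "cyc3 f x \<alpha> y0 s y1 (f {x, y1}) y2 (f {x, y2})"
        unfolding cyc3_def using f a e edges dist ch[of 0] ch[of 1] ys(3) y by auto
      note D = cyc3D[OF cy]
      have "{x, y0} \<noteq> {x, y1}" "{x, y1} \<noteq> {x, y2}" "{x, y0} \<noteq> {x, y2}"
        using D by (auto simp: doubleton_eq_iff)
      then have "\<forall>d\<in>E. rot3 f x y0 s y1 (f {x, y1}) y2 (f {x, y2}) d = s \<longleftrightarrow> f d = s \<and> d \<noteq> {x, y0} \<or> d = {x, y2}"
        using D(22-24) by (auto simp: rot3_def)
      then show ?thesis
        unfolding movable_def using cyc3_rotatable[OF missing A cy] y by auto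
    next
      case 4
      then obtain y1 y2 y3 where y: "ys = [y0, y1, y2, y3]"
        using ys(2) by (auto simp: eval_nat_numeral length_Suc_conv)
      have cy: "cyc4 f x \<alpha> y0 s y1 (f {x, y1}) y2 (f {x, y2}) y3 (f {x, y3})"
        unfolding cyc4_def using f a e edges dist ch[of 0] ch[of 1] ch[of 2] ys(3) y
        by (auto simp: numeral_2_eq_2 numeral_3_eq_3)
      note D = cyc4D[OF cy]
      show ?thesis
      proof (rule ccontr)
        assume nm: "\<not> ?thesis"
        then have ad: "{y0, y1} \<in> E \<and> {y0, y2} \<in> E \<and> {y0, y3} \<in> E \<and> {y1, y2} \<in> E \<and> {y1, y3} \<in> E \<and> {y2, y3} \<in> E"
          using cyc4_movable[OF missing A cy nr] y by simp
        have "card {x, y0, y1, y2, y3} = 5" using D(8-17) by simp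
        then obtain u v where "u \<in> {x, y0, y1, y2, y3}" "v \<in> {x, y0, y1, y2, y3}" "u \<noteq> v" "{u, v} \<notin> E"
          using no_K5 by blast
        then show False using ad D(18-21) by (auto simp: insert_commute)
      qed
    qed
  qed
  then show ?thesis using that xz zy ys(3) full by blast
qed

end

section \<open>Exchanging edges of matchings\<close>

text \<open>The part of the argument that is free of colours; \<open>\<N>\<close> will consist of
  the optimal classes of \<open>s\<close>. \<open>covered\<close> holds because adding an edge of
  \<open>M\<close> with two free ends would improve a class. \<open>exchange\<close> is the
  replacement obtained from a fan; its vertex \<open>z\<close> is covered by \<open>M\<close> as its
  degree is full. Either end of an edge can serve as the centre \<open>x\<close>.\<close>

locale matching_exchange =
  fixes E M :: "'a set set" and \<N> :: "'a set set set"
  assumes edgeD: "e \<in> E \<Longrightarrow> \<exists>u v. e = {u, v} \<and> u \<noteq> v"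
    and degree_le_4: "\<lbrakk>{v, a} \<in> E; {v, b} \<in> E; {v, c} \<in> E; {v, d} \<in> E; distinct [a, b, c, d]; {v, z} \<in> E\<rbrakk>
      \<Longrightarrow> z \<in> {a, b, c, d}"
    and M_sub: "M \<subseteq> E" and N_sub: "N \<in> \<N> \<Longrightarrow> N \<subseteq> E"
    and M_mate: "\<lbrakk>{u, v} \<in> M; {u, w} \<in> M\<rbrakk> \<Longrightarrow> v = w"
    and N_mate: "\<lbrakk>N \<in> \<N>; {u, v} \<in> N; {u, w} \<in> N\<rbrakk> \<Longrightarrow> v = w"
    and covered: "\<lbrakk>N \<in> \<N>; {u, v} \<in> M; u \<notin> \<Union>N\<rbrakk> \<Longrightarrow> \<exists>w. {v, w} \<in> N"
    and exchange: "\<lbrakk>N \<in> \<N>; {x, y} \<in> N; {x, y} \<notin> M\<rbrakk> \<Longrightarrow>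
      \<exists>z z'. z \<notin> \<Union>N \<and> {z, z'} \<in> M \<and> {x, z} \<in> E \<and> {x, z} \<notin> M \<and> insert {x, z} (N - {{x, y}}) \<in> \<N>"
begin

lemma neq: "{u, v} \<in> E \<Longrightarrow> u \<noteq> v"
  using edgeD[of "{u, v}"] by (auto simp: doubleton_eq_iff)

lemma free_exchange:
  assumes "N \<in> \<N>" "{x, y} \<in> N" "z \<notin> \<Union>N"
  shows "v \<notin> \<Union>(insert {x, z} (N - {{x, y}})) \<longleftrightarrow> v = y \<or> v \<notin> \<Union>N \<and> v \<noteq> z"
proof -
  have xy: "x \<noteq> y" using N_sub[OF assms(1)] assms(2) neq by blast
  have at: "e = {x, y}" if e: "e \<in> N" "u \<in> e" "u = x \<or> u = y" for e u
  proof -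
    obtain w where w: "e = {u, w}" using edgeD N_sub[OF assms(1)] e by blast
    have "{u, if u = x then y else x} \<in> N" using assms(2) e(3) xy by (auto simp: insert_commute)
    then show ?thesis using N_mate[OF assms(1), of u w] w e(1,3) by (auto simp: insert_commute split: if_splits)
  qed
  show ?thesis using at xy assms(2,3) by auto
qed

lemma not_M: "\<lbrakk>N \<in> \<N>; u0 \<notin> \<Union>N; {u0, u1} \<in> M; {u1, u2} \<in> N\<rbrakk> \<Longrightarrow> {u1, u2} \<notin> M"
  using M_mate[of u1 u2 u0] by (auto simp: insert_commute)

text \<open>The exchange around \<open>u2\<close> frees \<open>u1\<close>. Unless it uses
  \<open>u0\<close>, both ends of the edge \<open>{u0, u1}\<close> of \<open>M\<close> are free
  afterwards, against \<open>covered\<close>.\<close>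

lemma triangle:
  assumes N: "N \<in> \<N>" and u: "u0 \<notin> \<Union>N" "{u0, u1} \<in> M" "{u1, u2} \<in> N"
  shows "{u2, u0} \<in> E" and "insert {u2, u0} (N - {{u1, u2}}) \<in> \<N>"
proof -
  have e: "{u2, u1} \<in> N" "{u2, u1} \<notin> M" "{u1, u2} = {u2, u1}"
    using not_M[OF N u] u(3) by (simp_all add: insert_commute)
  obtain z z' where z: "z \<notin> \<Union>N" "{u2, z} \<in> E" "insert {u2, z} (N - {{u2, u1}}) \<in> \<N>"
    using exchange[OF N e(1,2)] by blast
  have "z = u0"
  proof (rule ccontr)
    assume "z \<noteq> u0"
    then have f: "v \<notin> \<Union>(insert {u2, z} (N - {{u2, u1}}))" if "v = u0 \<or> v = u1" for v
      using free_exchange[OF N e(1) z(1)] that u(1) by auto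
    obtain w where "{u1, w} \<in> insert {u2, z} (N - {{u2, u1}})"
      using covered[OF z(3) u(2)] f by blast
    then show False using f[of u1] by blast
  qed
  then show "{u2, u0} \<in> E" "insert {u2, u0} (N - {{u1, u2}}) \<in> \<N>" using z e(3) by auto
qed

text \<open>The exchange around \<open>u1\<close> cannot reach \<open>u0\<close>, since the new edge
  is not in \<open>M\<close>. So \<open>u0\<close> stays free while \<open>w\<close> becomes the
  partner of \<open>u1\<close>, and \<open>triangle\<close> for the new class joins
  \<open>u0\<close> to \<open>w\<close>.\<close>

lemma second_exchange:
  assumes N: "N \<in> \<N>" and u: "u0 \<notin> \<Union>N" "{u0, u1} \<in> M" "{u1, u2} \<in> N"
  obtains w w' where "w \<notin> \<Union>N" "{w, w'} \<in> M" "{u1, w} \<in> E" "{u0, w} \<in> E" "w \<noteq> u0"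
    "insert {u1, w} (N - {{u1, u2}}) \<in> \<N>"
proof -
  obtain w w' where w: "w \<notin> \<Union>N" "{w, w'} \<in> M" "{u1, w} \<in> E" "{u1, w} \<notin> M"
    "insert {u1, w} (N - {{u1, u2}}) \<in> \<N>"
    using exchange[OF N u(3) not_M[OF N u]] by blast
  have "w \<noteq> u0" using w(4) u(2) by (auto simp: insert_commute)
  moreover have "{w, u0} \<in> E"
    by (rule triangle(1)[OF w(5) _ u(2)]) (use free_exchange[OF N u(3) w(1)] u(1) \<open>w \<noteq> u0\<close> in auto)
  ultimately have "{u0, w} \<in> E" "w \<noteq> u0" by (simp_all add: insert_commute)
  then show ?thesis using that[OF w(1,2,3) _ _ w(5)] by blast
qed

text \<open>The remaining case \<open>w' = u2\<close> is the desired \<open>K4\<close>.\<close>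

definition double_triangle where
  "double_triangle N u0 u1 u2 w w' \<longleftrightarrow> N \<in> \<N> \<and> u0 \<notin> \<Union>N \<and> w \<notin> \<Union>N \<and> {u0, u1} \<in> M \<and> {w, w'} \<in> M \<and>
     {u1, u2} \<in> N \<and> {u1, w} \<in> E \<and> {u0, w} \<in> E \<and> insert {u1, w} (N - {{u1, u2}}) \<in> \<N> \<and> w' \<noteq> u2"

text \<open>Let \<open>w3\<close> be the partner of \<open>w'\<close> in \<open>N\<close>. Then
  \<open>w\<close> has its four neighbours, of which only \<open>u0\<close> is free, so the exchange
  around \<open>w'\<close> must reach \<open>u0\<close>. This makes the triples \<open>u0\<close>,
  \<open>u1\<close>, \<open>u2\<close> and \<open>w\<close>, \<open>w'\<close>, \<open>w3\<close>
  interchangeable, and facts about one transfer to the other.\<close>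

lemma double_triangle_symmetric:
  assumes dt: "double_triangle N u0 u1 u2 w w'"
  obtains w3 where "double_triangle N w w' w3 u0 u1"
    "{u0, u2} \<in> E" "{w, w3} \<in> E" "{w', u0} \<in> E" "distinct [u0, u1, u2, w, w', w3]"
    "\<And>v. {w, v} \<in> E \<Longrightarrow> v \<in> {u0, u1, w', w3}"
    "\<And>u3. {u2, u3} \<notin> M"
proof -
  have N: "N \<in> \<N>" and u: "u0 \<notin> \<Union>N" "{u0, u1} \<in> M" "{u1, u2} \<in> N"
    and w: "w \<notin> \<Union>N" "{w, w'} \<in> M" "{u1, w} \<in> E" "{u0, w} \<in> E"
    and N2': "insert {u1, w} (N - {{u1, u2}}) \<in> \<N>" and w'u2: "w' \<noteq> u2"
    using dt by (auto simp: double_triangle_def)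
  define N2 where "N2 = insert {u1, w} (N - {{u1, u2}})"
  have N2: "N2 \<in> \<N>" and u1w: "{u1, w} \<in> N2" using N2' by (simp_all add: N2_def)
  have f2: "v \<notin> \<Union>N2 \<longleftrightarrow> v = u2 \<or> v \<notin> \<Union>N \<and> v \<noteq> w" for v
    using free_exchange[OF N u(3) w(1)] by (simp add: N2_def)
  have u12: "u1 \<noteq> u2" "u0 \<noteq> u1" "u0 \<noteq> u2" "w \<noteq> u0" "w \<noteq> u1" "w \<noteq> u2" "w \<noteq> w'"
    using neq N_sub[OF N] M_sub u w by auto
  have w'u: "w' \<noteq> u0" "w' \<noteq> u1" using M_mate[of u0 u1 w] M_mate[of u1 u0 w] u w u12 by (auto simp: insert_commute)
  obtain w3 where w3: "{w', w3} \<in> N" using covered[OF N w(2,1)] by blast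
  have w3n: "w3 \<noteq> w'" using neq N_sub[OF N] w3 by auto
  have w3': "w3 \<noteq> u0" "w3 \<noteq> w" using w3 u(1) w(1) by auto
  have w3'': "w3 \<noteq> u1" "w3 \<noteq> u2"
    using N_mate[OF N, of u1 u2 w'] N_mate[OF N, of u2 u1 w'] u(3) w3 w'u w'u2 by (auto simp: insert_commute)
  have dist: "distinct [u0, u1, u2, w, w', w3]" using u12 w'u w3n w3' w3'' w'u2 by auto
  have ww3: "{w, w3} \<in> E" using triangle(1)[OF N w(1,2) w3] by (simp add: insert_commute)
  have nbw: "v \<in> {u0, u1, w', w3}" if "{w, v} \<in> E" for v
    by (rule degree_le_4[where v = w]) (use w M_sub ww3 dist that in \<open>auto simp: insert_commute\<close>)
  obtain q q' where q: "q \<notin> \<Union>N" "{w', q} \<in> E" "{w, q} \<in> E" "q \<noteq> w" "insert {w', q} (N - {{w', w3}}) \<in> \<N>"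
    using second_exchange[OF N w(1,2) w3] by metis
  have "q \<noteq> u1" "q \<noteq> w'" "q \<noteq> w3" using q(1) u(3) w3 by auto
  then have qu0: "q = u0" using nbw[OF q(3)] by simp
  have w'u0: "{w', u0} \<in> E" using q(2) qu0 by simp
  have u02: "{u0, u2} \<in> E" using triangle(1)[OF N u] by (simp add: insert_commute)
  have nbu: "v \<in> {w, w', u1, u2}" if "{u0, v} \<in> E" for v
    by (rule degree_le_4[where v = u0]) (use u w M_sub u02 w'u0 dist that in \<open>auto simp: insert_commute\<close>)
  \<comment> \<open>Suppose \<open>M\<close> joined \<open>u2\<close> to \<open>u3\<close>. In
    \<open>N2\<close> the vertex \<open>u2\<close> is free, and its only possible free neighbour is
    \<open>u0\<close>, so the exchange around \<open>u3\<close> would make \<open>u3\<close> a fifth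
    neighbour of \<open>u0\<close>.\<close>
  have no: "{u2, u3} \<notin> M" for u3
  proof
    assume u3: "{u2, u3} \<in> M"
    have u3n: "u3 \<notin> {u0, u1, u2, w, w'}"
      using M_mate[of u0 u1 u2] M_mate[of u1 u0 u2] M_mate[of w w' u2] M_mate[of w' w u2] u3 u(2) w(2) dist
        neq[of u2 u3] M_sub by (auto simp: insert_commute)
    have u2f: "u2 \<notin> \<Union>N2" using f2 by blast
    obtain u4 where u4: "{u3, u4} \<in> N2" using covered[OF N2 u3 u2f] by blast
    obtain p p' where p: "p \<notin> \<Union>N2" "{u3, p} \<in> E" "{u2, p} \<in> E" "p \<noteq> u2"
      using second_exchange[OF N2 u2f u3 u4] by metis
    have u4E: "{u4, u2} \<in> E" using triangle(1)[OF N2 u2f u3 u4] .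
    have u4n: "u4 \<noteq> u0" "u4 \<noteq> u1" "u4 \<noteq> u3"
    proof -
      show "u4 \<noteq> u0" using u4 f2[of u0] u(1) dist by auto
      show "u4 \<noteq> u1"
      proof
        assume "u4 = u1"
        then have "{u1, u3} \<in> N2" using u4 by (simp add: insert_commute)
        then show False using N_mate[OF N2 u1w] u3n by auto
      qed
      show "u4 \<noteq> u3" using neq[of u3 u4] N_sub[OF N2] u4 by auto
    qed
    have "p \<in> {u0, u1, u3, u4}"
      by (rule degree_le_4[where v = u2])
        (use u02 u(3) N_sub[OF N] M_sub u3 u4E dist u3n u4n p(3) in \<open>auto simp: insert_commute\<close>)
    moreover have "p \<noteq> u1" "p \<noteq> u3" "p \<noteq> u4" using p(1) u4 u1w by auto
    ultimately have "{u0, u3} \<in> E" using p(2) by (simp add: insert_commute)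
    then show False using nbu[of u3] u3n by auto
  qed
  have "double_triangle N w w' w3 u0 u1"
    unfolding double_triangle_def using N u w w3 w'u0 q(5) qu0 w3'' by (simp add: insert_commute)
  then show ?thesis using that u02 ww3 w'u0 dist nbw no by blast
qed

text \<open>After replacing \<open>{u1, u2}\<close> by \<open>{u1, w}\<close> and
  \<open>{w', w3}\<close> by \<open>{w', u0}\<close>, the only neighbour of \<open>w\<close> that
  can be free is \<open>w3\<close>. But an exchange around \<open>w\<close> requires a free
  neighbour covered by \<open>M\<close>, and \<open>w3\<close> is not covered by
  \<open>M\<close>.\<close>

lemma no_double_triangle: "\<not> double_triangle N u0 u1 u2 w w'"
proof
  assume dt: "double_triangle N u0 u1 u2 w w'"
  obtain w3 where dt': "double_triangle N w w' w3 u0 u1"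
    and e: "{u0, u2} \<in> E" "{w, w3} \<in> E" "{w', u0} \<in> E" and dist: "distinct [u0, u1, u2, w, w', w3]"
    and nbw: "\<And>v. {w, v} \<in> E \<Longrightarrow> v \<in> {u0, u1, w', w3}"
    using double_triangle_symmetric[OF dt] by metis
  have no3: "{w3, v} \<notin> M" for v using double_triangle_symmetric[OF dt'] by metis
  have N: "N \<in> \<N>" and u: "u0 \<notin> \<Union>N" "{u0, u1} \<in> M" "{u1, u2} \<in> N"
    and w: "w \<notin> \<Union>N" "{w, w'} \<in> M" "{u1, w} \<in> E" "{u0, w} \<in> E"
    and N2': "insert {u1, w} (N - {{u1, u2}}) \<in> \<N>" and w3: "{w', w3} \<in> N"
    using dt dt' by (auto simp: double_triangle_def)
  define N2 where "N2 = insert {u1, w} (N - {{u1, u2}})"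
  have N2: "N2 \<in> \<N>" and u1w: "{u1, w} \<in> N2" using N2' by (simp_all add: N2_def)
  have f2: "v \<notin> \<Union>N2 \<longleftrightarrow> v = u2 \<or> v \<notin> \<Union>N \<and> v \<noteq> w" for v
    using free_exchange[OF N u(3) w(1)] by (simp add: N2_def)
  have w3N2: "{w', w3} \<in> N2" "{w3, w'} \<in> N2" "{w', w3} \<notin> M" "{w3, w'} \<notin> M"
    using w3 dist no3 by (auto simp: N2_def doubleton_eq_iff insert_commute)
  \<comment> \<open>The exchange around \<open>w3\<close> frees \<open>w'\<close> and keeps
    \<open>{u1, w}\<close>, so \<open>triangle\<close> applies to \<open>w'\<close>,
    \<open>w\<close>, \<open>u1\<close>.\<close>
  have w'u1: "{w', u1} \<in> E"
  proof -
    obtain p p' where p: "p \<notin> \<Union>N2" "{p, p'} \<in> M" "{w3, p} \<in> E" "insert {w3, p} (N2 - {{w3, w'}}) \<in> \<N>"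
      using exchange[OF N2 w3N2(2,4)] by blast
    have "w' \<notin> \<Union>(insert {w3, p} (N2 - {{w3, w'}}))" using free_exchange[OF N2 w3N2(2) p(1)] by blast
    moreover have "{w', w} \<in> M" using w(2) by (simp add: insert_commute)
    moreover have "{w, u1} \<in> insert {w3, p} (N2 - {{w3, w'}})"
      using u1w dist by (auto simp: doubleton_eq_iff insert_commute)
    ultimately have "{u1, w'} \<in> E" by (rule triangle(1)[OF p(4)])
    then show ?thesis by (simp add: insert_commute)
  qed
  have nbw': "v \<in> {w, w3, u0, u1}" if "{w', v} \<in> E" for v
    by (rule degree_le_4[where v = w'])
      (use w'u1 e w M_sub w3 N_sub[OF N] dist that in \<open>auto simp: insert_commute\<close>)
  obtain z z' where z: "z \<notin> \<Union>N2" "{w', z} \<in> E" "{w', z} \<notin> M" "insert {w', z} (N2 - {{w', w3}}) \<in> \<N>"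
    using exchange[OF N2 w3N2(1,3)] by blast
  have "z \<noteq> w" "z \<noteq> u1" "z \<noteq> w3" using z(1) w3N2(1) u1w by auto
  then have z0: "z = u0" using nbw'[OF z(2)] by simp
  define N4 where "N4 = insert {w', u0} (N2 - {{w', w3}})"
  have N4: "N4 \<in> \<N>" using z(4) z0 by (simp add: N4_def)
  have uf: "u0 \<notin> \<Union>N2" using z(1) z0 by simp
  have wu1: "{w, u1} \<in> N4" "{w', u0} \<in> N4"
    using u1w dist by (auto simp: N4_def doubleton_eq_iff insert_commute)
  have "{w, u1} \<notin> M" using M_mate[of w w' u1] w(2) dist by auto
  then obtain y y' where y: "y \<notin> \<Union>N4" "{y, y'} \<in> M" "{w, y} \<in> E"
    using exchange[OF N4 wu1(1)] by blast
  have "y \<noteq> u0" "y \<noteq> u1" "y \<noteq> w'" using y(1) wu1 by auto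
  then have "y = w3" using nbw[OF y(3)] by simp
  then show False using y(2) no3 by blast
qed

theorem obtain_K4:
  assumes N: "N \<in> \<N>" and e: "e \<in> N" "e \<notin> M"
  obtains N u0 u1 u2 u3 where "N \<in> \<N>" "u0 \<notin> \<Union>N" "u3 \<notin> \<Union>N" "{u0, u1} \<in> M" "{u2, u3} \<in> M" "{u1, u2} \<in> N"
    "{u0, u2} \<in> E" "{u1, u3} \<in> E" "{u0, u3} \<in> E"
proof -
  obtain x y where xy: "e = {x, y}" using edgeD N_sub[OF N] e(1) by blast
  obtain u0 u1 where u: "u0 \<notin> \<Union>N" "{u0, u1} \<in> M" using exchange[OF N] e xy by metis
  obtain u2 where u2: "{u1, u2} \<in> N" using covered[OF N u(2,1)] by blast
  obtain w w' where w: "w \<notin> \<Union>N" "{w, w'} \<in> M" "{u1, w} \<in> E" "{u0, w} \<in> E" "w \<noteq> u0"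
    "insert {u1, w} (N - {{u1, u2}}) \<in> \<N>"
    using second_exchange[OF N u u2] by metis
  have "w' = u2"
    using no_double_triangle[of N u0 u1 u2 w w'] N u u2 w unfolding double_triangle_def by blast
  then show ?thesis
    using that[of N u0 w u1 u2] N u u2 w triangle(1)[OF N u u2] by (simp add: insert_commute)
qed

end

context palette_graph begin

section \<open>Turning a colour class into a given matching\<close>

definition color_class :: "('a set \<Rightarrow> nat) \<Rightarrow> nat \<Rightarrow> 'a set set" where
  "color_class f s = {e \<in> E. f e = s}"

text \<open>Orders the pairs \<open>(|M - N|, |N - M|)\<close> lexicographically, as the second entry is at most
  \<open>card E\<close>.\<close>

definition defect :: "'a set set \<Rightarrow> 'a set set \<Rightarrow> nat" where
  "defect M N = card (M - N) * Suc (card E) + card (N - M)"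

text \<open>A gain in the first entry outweighs any change of the second, which stays below
  \<open>Suc (card E)\<close>.\<close>

lemma defect_less:
  assumes "M' \<subset> M - N" "N' \<subseteq> E" "M \<subseteq> E" "M - N' = M'"
  shows "defect M N' < defect M N"
proof -
  have "card M' < card (M - N)"
    using assms(1,3) finite_E by (meson finite_Diff finite_subset psubset_card_mono)
  moreover have "card (N' - M) \<le> card E" using assms(2) finite_E by (intro card_mono) auto
  ultimately have "card M' * Suc (card E) + card (N' - M) < Suc (card M') * Suc (card E)"
    and "Suc (card M') * Suc (card E) \<le> card (M - N) * Suc (card E)"
    by (simp, intro mult_le_mono1, simp)
  then show ?thesis unfolding defect_def assms(4) by linarith
qed

lemma defect_exchange:
  assumes "N \<subseteq> E" "e \<in> N" "e \<notin> M" "e' \<notin> N" "e' \<notin> M"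
  shows "defect M (insert e' (N - {e})) = defect M N"
proof -
  have 1: "M - insert e' (N - {e}) = M - N" using assms by blast
  have 2: "insert e' (N - {e}) - M = insert e' ((N - M) - {e})" using assms by blast
  have fin: "finite (N - M)" using assms(1) finite_E by (meson finite_Diff finite_subset)
  have n: "e' \<notin> (N - M) - {e}" "e \<in> N - M" using assms by blast+
  have "card (insert e' ((N - M) - {e})) = card (N - M)"
    using card_insert_disjoint[OF finite_Diff[OF fin] n(1)] card_Suc_Diff1[OF fin n(2)] by (rule trans)
  then show ?thesis unfolding defect_def 1 2 by simp
qed

lemma defect_gain:
  assumes "N \<subseteq> E" "M \<subseteq> E" "e \<notin> M" "e' \<in> M" "e' \<notin> N"
  shows "defect M (insert e' (N - {e})) < defect M N"
proof (rule defect_less)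
  show "M - insert e' N \<subset> M - N" using assms(4,5) by blast
  show "insert e' (N - {e}) \<subseteq> E" using assms(1,2,4) by blast
  show "M - insert e' (N - {e}) = M - insert e' N" using assms(3) by blast
qed (fact assms(2))

lemma missing_color:
  assumes "col f" "card {e \<in> E. v \<in> e} < card A"
  shows "\<exists>c\<in>A. miss f v c"
proof (rule ccontr)
  assume "\<not> ?thesis"
  then have "A \<subseteq> f ` {e \<in> E. v \<in> e}" by (auto simp: miss_def)
  then have "card A \<le> card {e \<in> E. v \<in> e}" using finite_E by (intro surj_card_le) auto
  then show False using assms(2) by simp
qed

text \<open>All colours but \<open>s\<close> occur at \<open>v\<close>. This is how the end of a
  closed fan is seen to be covered by \<open>M\<close>.\<close>

lemma degree_full:
  assumes "col f" "s \<in> A" "card {e \<in> E. v \<in> e} < card A"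
    and "\<And>c. \<lbrakk>c \<in> A; c \<noteq> s\<rbrakk> \<Longrightarrow> \<not> miss f v c"
  shows "Suc (card {e \<in> E. v \<in> e}) = card A"
proof -
  have "A - {s} \<subseteq> f ` {e \<in> E. v \<in> e}" using assms(4) by (auto simp: miss_def)
  then have "card (A - {s}) \<le> card {e \<in> E. v \<in> e}" using finite_E by (intro surj_card_le) auto
  then show ?thesis using assms(2,3) finite_A by simp
qed

lemma card_star:
  assumes "finite B" "\<And>w. w \<in> B \<Longrightarrow> {v, w} \<in> E"
  shows "card B \<le> card {e \<in> E. v \<in> e}"
proof (rule card_inj_on_le[where f = "\<lambda>w. {v, w}"])
  show "inj_on (\<lambda>w. {v, w}) B" by (auto simp: inj_on_def doubleton_eq_iff)
qed (use assms finite_E in auto)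

text \<open>The degree of a vertex of a \<open>K5\<close> is exhausted inside \<open>W\<close> and
  is full, so \<open>M\<close> would match the five vertices of \<open>W\<close> perfectly among
  themselves.\<close>

lemma no_K5:
  assumes A: "card A \<le> 5" and M: "M \<subseteq> E" "\<And>e e'. \<lbrakk>e \<in> M; e' \<in> M; e \<inter> e' \<noteq> {}\<rbrakk> \<Longrightarrow> e = e'"
    and deg: "\<And>v. card {e \<in> E. v \<in> e} < card A"
    and full: "\<And>v. Suc (card {e \<in> E. v \<in> e}) = card A \<Longrightarrow> \<exists>e\<in>M. v \<in> e"
    and W: "card W = 5"
  shows "\<exists>u\<in>W. \<exists>v\<in>W. u \<noteq> v \<and> {u, v} \<notin> E"
proof (rule ccontr)
  assume "\<not> ?thesis"
  then have K: "\<And>u v. \<lbrakk>u \<in> W; v \<in> W; u \<noteq> v\<rbrakk> \<Longrightarrow> {u, v} \<in> E" by blast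
  have fin: "finite W" using W card.infinite by fastforce
  let ?C = "{e \<in> M. e \<subseteq> W}"
  have cov: "\<exists>e\<in>?C. v \<in> e" if v: "v \<in> W" for v
  proof -
    have c4: "card (W - {v}) = 4" using W v fin by simp
    have "card (W - {v}) \<le> card {e \<in> E. v \<in> e}" using K v fin by (intro card_star) auto
    then have "Suc (card {e \<in> E. v \<in> e}) = card A" using c4 deg[of v] A by linarith
    then obtain e where e: "e \<in> M" "v \<in> e" using full by blast
    obtain w where w: "e = {v, w}" "v \<noteq> w" using edge_with[of e v] e M(1) by blast
    have "w \<in> W"
    proof (rule ccontr)
      assume n: "w \<notin> W"
      have "card (insert w (W - {v})) = 5" using n fin c4 by simp
      moreover have "card (insert w (W - {v})) \<le> card {e \<in> E. v \<in> e}"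
        using K v fin w e M(1) by (intro card_star) auto
      ultimately show False using deg[of v] A by simp
    qed
    then show ?thesis using e w v by blast
  qed
  have "2 * card ?C = card (\<Union>?C)"
  proof (rule card_partition)
    show "finite ?C" using finite_subset[OF M(1) finite_E] by simp
    show "finite (\<Union>?C)" using fin by (rule finite_subset[rotated]) blast
    show "card c = 2" if c: "c \<in> ?C" for c
    proof -
      obtain u v where "c = {u, v}" "u \<noteq> v" using edgeD c M(1) by blast
      then show ?thesis by simp
    qed
    show "c \<inter> c' = {}" if "c \<in> ?C" "c' \<in> ?C" "c \<noteq> c'" for c c' using M(2) that by blast
  qed
  moreover have "\<Union>?C = W" using cov by blast
  ultimately have "2 * card ?C = 5" using W by simp
  then show False by presburger
qed

text \<open>By minimality, \<open>s\<close>, the colours of the two \<open>M\<close>-edges and the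
  colours missing at \<open>u1\<close> and \<open>u2\<close> are pairwise distinct, hence they are
  the whole palette. The colours of \<open>{u1, u3}\<close> and \<open>{u0, u2}\<close> are then
  forced, and none is left for \<open>{u0, u3}\<close>.\<close>

lemma K4_refuted:
  assumes A: "card A \<le> 5" and s: "s \<in> A" and f: "col f" and M: "M \<subseteq> E"
    and missing: "\<And>f v. col f \<Longrightarrow> \<exists>c\<in>A. miss f v c"
    and opt: "\<And>g. f \<approx> g \<Longrightarrow> defect M (color_class f s) \<le> defect M (color_class g s)"
    and u: "{u0, u1} \<in> M" "{u2, u3} \<in> M" "{u1, u2} \<in> E" "f {u1, u2} = s" "miss f u0 s" "miss f u3 s"
      "{u0, u2} \<in> E" "{u1, u3} \<in> E" "{u0, u3} \<in> E" "{u1, u2} \<notin> M"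
  shows False
proof -
  let ?N = "color_class f s"
  have E: "{u0, u1} \<in> E" "{u2, u3} \<in> E" "{u1, u0} \<in> E" "{u3, u2} \<in> E" "{u2, u1} \<in> E" "{u2, u0} \<in> E" "{u3, u1} \<in> E" "{u3, u0} \<in> E"
    using u M by (auto simp: insert_commute)
  have ne: "u0 \<noteq> u1" "u2 \<noteq> u3" "u1 \<noteq> u2" "u0 \<noteq> u2" "u1 \<noteq> u3" "u0 \<noteq> u3"
    using edge_neq E u by blast+
  let ?a = "f {u0, u1}" and ?b = "f {u2, u3}"
  have as: "?a \<noteq> s" "?b \<noteq> s" using missD[OF u(5) E(1)] missD'[OF u(6) E(2)] by auto
  have better: False if g: "f \<approx> g" and N: "\<And>e. e \<in> M \<Longrightarrow> f e = s \<Longrightarrow> g e = s"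
    and e: "e \<in> M" "f e \<noteq> s" "g e = s" for g e
  proof -
    have "defect M (color_class g s) < defect M ?N"
      by (rule defect_less[of "M - color_class g s"]) (use N e M in \<open>auto simp: color_class_def\<close>)
    then show False using opt[OF g] by simp
  qed
  \<comment> \<open>A fan cycle of length two at \<open>y\<close>: swapping it lets the
    \<open>M\<close>-edge \<open>{x, y}\<close> replace \<open>{y, z}\<close> in the class.\<close>
  have one: False if z: "{x, y} \<in> M" "f {x, y} \<noteq> s" "{y, z} \<in> E" "f {y, z} = s" "{y, z} \<notin> M" "miss f x s" "miss f z (f {x, y})" "x \<noteq> z" for x y z
  proof -
    have yx: "{y, x} = {x, y}" by (simp add: insert_commute)
    have xyE: "{y, x} \<in> E" using z(1) M yx by auto
    have k: "f \<approx> f({y, x} := s, {y, z} := f {x, y})"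
      by (rule keq_pair[OF f xyE z(3,8)]) (use z yx in auto)
    have n: "{y, z} \<noteq> {x, y}" using z(2,4) by auto
    show False by (rule better[OF k, of "{x, y}"]) (use z yx n in auto)
  qed
  have two: "\<not> miss f u2 ?a" using one[of u0 u1 u2] u as ne by blast
  have u21: "f {u2, u1} = s" "{u2, u1} \<notin> M" "f {u3, u2} = ?b" "{u3, u2} \<in> M" using u by (auto simp: insert_commute)
  have one': "\<not> miss f u1 ?b" using one[of u3 u2 u1] u u21 as ne E by metis
  \<comment> \<open>With equal colours the path \<open>u0\<close>, \<open>u1\<close>,
    \<open>u2\<close>, \<open>u3\<close> is an entire chain, and swapping it trades one edge outside
    \<open>M\<close> for two edges of \<open>M\<close>.\<close>
  have ab: "?a \<noteq> ?b"
  proof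
    assume ab: "?a = ?b"
    let ?S = "{u0, u1, u2, u3}"
    have only: "e \<in> {{u0, u1}, {u1, u2}, {u2, u3}}" if e: "e \<in> E" "f e = ?a \<or> f e = s" "v \<in> e" "v \<in> ?S" for e v
    proof (cases "f e = s")
      case True
      then have "v = u1 \<or> v = u2" using e u(5,6) unfolding miss_def by auto
      then show ?thesis using col_inj[OF f e(1) u(3), of v] e True u(4) by auto
    next
      case False
      then show ?thesis
        using e col_inj[OF f e(1) E(1), of v] col_inj[OF f e(1) E(2), of v] ab by auto
    qed
    have cl: "closed_on f ?a s ?S" unfolding closed_on_def using only by blast
    let ?g = "swap_on f ?a s ?S"
    have k: "f \<approx> ?g" using keq_swap[OF _ s cl] col_A[OF f E(1)] .
    have g: "?g {u0, u1} = s" using E by (simp add: swap_on_def swap_color_def)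
    show False
    proof (rule better[OF k _ u(1) as(1) g])
      fix e assume e: "e \<in> M" "f e = s"
      have "e \<inter> ?S = {}"
      proof (rule ccontr)
        assume "e \<inter> ?S \<noteq> {}"
        then obtain v where "v \<in> e" "v \<in> ?S" by blast
        then have "e \<in> {{u0, u1}, {u1, u2}, {u2, u3}}" using only e M by blast
        then show False using e as u(10) by auto
      qed
      then show "?g e = s" using e by (simp add: swap_on_def)
    qed
  qed
  obtain \<alpha> \<beta> where c: "\<alpha> \<in> A" "miss f u1 \<alpha>" "\<beta> \<in> A" "miss f u2 \<beta>"
    using missing[OF f, of u1] missing[OF f, of u2] by blast
  have c1: "\<alpha> \<noteq> s" "\<alpha> \<noteq> ?a" "\<beta> \<noteq> s" "\<beta> \<noteq> ?b" "\<alpha> \<noteq> ?b" "\<beta> \<noteq> ?a"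
    using missD[OF c(2) u(3)] missD'[OF c(2) E(1)] missD'[OF c(4) u(3)] missD[OF c(4) E(2)] c two one' u(4) by auto
  \<comment> \<open>A common missing colour would let \<open>{u1, u2}\<close> leave the class; here
    the second entry of the defect drops.\<close>
  have abn: "\<alpha> \<noteq> \<beta>"
  proof
    assume "\<alpha> = \<beta>"
    then have "removable f s {u1, u2}" using removable_recolor[OF f u(3,4) c(2) _ c(1)] c(4) by blast
    then obtain g where g: "f \<approx> g" "\<forall>d\<in>E. g d = s \<longleftrightarrow> f d = s \<and> d \<noteq> {u1, u2}" unfolding removable_def by blast
    then have N: "color_class g s = ?N - {{u1, u2}}" by (auto simp: color_class_def)
    have "{u1, u2} \<in> ?N - M" using u by (simp add: color_class_def)
    then have "card (color_class g s - M) < card (?N - M)" "M - color_class g s = M - ?N"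
      unfolding N using finite_E by (auto intro!: psubset_card_mono simp: color_class_def)
    then show False using opt[OF g(1)] unfolding defect_def by simp
  qed
  have "card {s, ?a, ?b, \<alpha>, \<beta>} = 5" using as ab c1 abn by auto
  moreover have "{s, ?a, ?b, \<alpha>, \<beta>} \<subseteq> A" using s c col_A[OF f] E by auto
  ultimately have "A = {s, ?a, ?b, \<alpha>, \<beta>}" using card_seteq[OF finite_A] A by metis
  then have col: "f e \<in> {s, ?a, ?b, \<alpha>, \<beta>}" if "e \<in> E" for e using col_A[OF f that] by simp
  have n: "f {v, p} \<noteq> f {v, q}" if "{v, p} \<in> E" "{v, q} \<in> E" "p \<noteq> q" for v p q
    using col_nbr[OF f that(1,2)] that(3) by blast
  have sy: "f {v, w} = f {w, v}" for v w by (simp add: insert_commute)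
  have "f {u1, u3} = \<beta>"
    using col[OF u(8)] missD'[OF u(6,8)] missD[OF c(2) u(8)] n[OF E(3) u(8)] n[OF E(4) E(7)] ne
    by (auto simp: sy[of u1 u0] sy[of u3 u1] sy[of u3 u2])
  moreover have "f {u0, u2} = \<alpha>"
    using col[OF u(7)] missD[OF u(5,7)] missD'[OF c(4) u(7)] n[OF E(1) u(7)] n[OF E(2) E(6)] ne
    by (auto simp: sy[of u2 u0])
  ultimately show False
    using col[OF u(9)] missD[OF u(5,9)] n[OF E(1) u(9)] n[OF E(4) E(8)] n[OF u(7) u(9)] n[OF E(7) E(8)] ne
    by (auto simp: sy[of u3 u0] sy[of u3 u1] sy[of u3 u2])
qed

text \<open>The assumptions \<open>deg\<close> and \<open>full\<close> are what a proper colouring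
  of \<open>E\<close> with \<open>card A - 1\<close> colours provides when \<open>M\<close> is one
  of its classes.\<close>

theorem class_to_matching:
  assumes A: "card A \<le> 5" and s: "s \<in> A" and f: "col f"
    and M: "M \<subseteq> E" "\<And>e e'. \<lbrakk>e \<in> M; e' \<in> M; e \<inter> e' \<noteq> {}\<rbrakk> \<Longrightarrow> e = e'"
    and deg: "\<And>v. card {e \<in> E. v \<in> e} < card A"
    and full: "\<And>v. Suc (card {e \<in> E. v \<in> e}) = card A \<Longrightarrow> \<exists>e\<in>M. v \<in> e"
  shows "\<exists>g. f \<approx> g \<and> color_class g s = M"
proof -
  have missing: "\<And>f v. col f \<Longrightarrow> \<exists>c\<in>A. miss f v c" using missing_color deg by blast
  have noK5: "\<And>W. card W = 5 \<Longrightarrow> \<exists>u\<in>W. \<exists>v\<in>W. u \<noteq> v \<and> {u, v} \<notin> E"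
    using no_K5[OF A M deg full] by blast
  let ?d = "\<lambda>g. defect M (color_class g s)"
  have "\<exists>g. f \<approx> g \<and> (\<forall>h. f \<approx> h \<longrightarrow> ?d g \<le> ?d h)"
    by (rule ex_has_least_nat[of "\<lambda>g. f \<approx> g" f ?d]) simp
  then obtain g0 where g0: "f \<approx> g0" and g0min: "\<And>h. f \<approx> h \<Longrightarrow> ?d g0 \<le> ?d h" by blast
  define opt where "opt g \<longleftrightarrow> f \<approx> g \<and> (\<forall>h. f \<approx> h \<longrightarrow> ?d g \<le> ?d h)" for g
  have optD: "?d g \<le> ?d h" if "opt g" "g \<approx> h" for g h
    using that keq_trans unfolding opt_def by blast
  have opt_col: "col g" if "opt g" for g using that keq_col f unfolding opt_def by blast
  define \<N> where "\<N> = {color_class g s | g. opt g}"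
  have cc: "\<lbrakk>e \<in> color_class g s; e' \<in> color_class g s; e \<inter> e' \<noteq> {}; col g\<rbrakk> \<Longrightarrow> e = e'" for e e' g
    unfolding color_class_def using col_inj by blast
  have free: "miss g v s \<longleftrightarrow> v \<notin> \<Union>(color_class g s)" for g v
    unfolding miss_def color_class_def by blast
  have fN: "finite (color_class g s)" for g using finite_E by (simp add: color_class_def)
  have covered: "\<exists>w. {v, w} \<in> color_class g s" if g: "opt g" and uv: "{u, v} \<in> M" "u \<notin> \<Union>(color_class g s)" for g u v
  proof (rule ccontr)
    assume n: "\<not> ?thesis"
    have m: "miss g u s" "miss g v s"
      using uv(2) n edge_with unfolding miss_def color_class_def by blast+
    have uvE: "{u, v} \<in> E" using uv M by blast
    have gt: "g \<approx> g({u, v} := s)" using keq_recolor(1)[OF opt_col[OF g] uvE m s] .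
    have "?d (g({u, v} := s)) < ?d g"
      by (rule defect_less[of "M - insert {u, v} (color_class g s)"])
        (use uv uvE M in \<open>auto simp: color_class_def\<close>)
    then show False using optD[OF g gt] by simp
  qed
  have nrem: "\<not> removable g s e" if g: "opt g" and e: "e \<in> color_class g s - M" for g e
  proof
    assume "removable g s e"
    then obtain h where h: "g \<approx> h" "\<forall>d\<in>E. h d = s \<longleftrightarrow> g d = s \<and> d \<noteq> e" unfolding removable_def by blast
    then have N: "color_class h s = color_class g s - {e}" by (auto simp: color_class_def)
    have "card (color_class h s - M) < card (color_class g s - M)" "M - color_class h s = M - color_class g s"
      unfolding N using e fN by (auto intro!: psubset_card_mono)
    then show False using optD[OF g h(1)] unfolding defect_def by simp
  qed
  interpret me: matching_exchange E M \<N>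
  proof
    show "\<exists>u v. e = {u, v} \<and> u \<noteq> v" if "e \<in> E" for e using edgeD that .
  next
    fix v a b c d z
    assume a: "{v, a} \<in> E" "{v, b} \<in> E" "{v, c} \<in> E" "{v, d} \<in> E" "distinct [a, b, c, d]" "{v, z} \<in> E"
    show "z \<in> {a, b, c, d}"
    proof (rule ccontr)
      assume "z \<notin> {a, b, c, d}"
      then have "card {z, a, b, c, d} = 5" using a(5) by simp
      moreover have "card {z, a, b, c, d} \<le> card {e \<in> E. v \<in> e}" using a by (intro card_star) auto
      ultimately show False using deg[of v] A by simp
    qed
  next
    show "M \<subseteq> E" by fact
    show "N \<subseteq> E" if "N \<in> \<N>" for N using that by (auto simp: \<N>_def color_class_def)
    show "v = w" if "{u, v} \<in> M" "{u, w} \<in> M" for u v w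
      using M(2)[OF that] by (auto simp: doubleton_eq_iff)
    show "v = w" if N: "N \<in> \<N>" "{u, v} \<in> N" "{u, w} \<in> N" for N u v w
    proof -
      obtain g where "N = color_class g s" "opt g" using N(1) by (auto simp: \<N>_def)
      then have "{u, v} = {u, w}" using cc[of "{u, v}" g "{u, w}"] N opt_col by blast
      then show ?thesis by (auto simp: doubleton_eq_iff)
    qed
    show "\<exists>w. {v, w} \<in> N" if "N \<in> \<N>" "{u, v} \<in> M" "u \<notin> \<Union>N" for N u v
      using that covered by (auto simp: \<N>_def)
  next
    fix N x y assume N: "N \<in> \<N>" and xy: "{x, y} \<in> N" "{x, y} \<notin> M"
    obtain g where g: "N = color_class g s" "opt g" using N by (auto simp: \<N>_def)
    have xyg: "{x, y} \<in> E" "g {x, y} = s" using xy(1) g(1) by (auto simp: color_class_def)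
    have nr: "\<not> removable g s {x, y}" using nrem[OF g(2)] xy g(1) by blast
    obtain z where z: "{x, z} \<in> E" "z \<noteq> y" "miss g z s" "\<And>c. \<lbrakk>c \<in> A; c \<noteq> s\<rbrakk> \<Longrightarrow> \<not> miss g z c"
      "movable g s {x, y} {x, z}"
      using removable_or_movable[OF missing A noK5 opt_col[OF g(2)] xyg nr] by blast
    obtain e where e: "e \<in> M" "z \<in> e"
      using full degree_full[OF opt_col[OF g(2)] s deg z(4)] by blast
    obtain z' where z': "e = {z, z'}" using edge_with e M(1) by blast
    have zz': "{z, z'} \<in> M" using e(1) z' by simp
    obtain h where h: "g \<approx> h" "\<forall>d\<in>E. h d = s \<longleftrightarrow> g d = s \<and> d \<noteq> {x, y} \<or> d = {x, z}"
      using z(5) unfolding movable_def by blast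
    then have Nh: "color_class h s = insert {x, z} (N - {{x, y}})" using z(1) g(1) by (auto simp: color_class_def)
    have zN: "z \<notin> \<Union>N" using z(3) free g(1) by blast
    have xzN: "{x, z} \<notin> N" using zN by blast
    have NE: "N \<subseteq> E" using g(1) by (auto simp: color_class_def)
    have xzM: "{x, z} \<notin> M"
    proof
      assume "{x, z} \<in> M"
      then have "?d h < defect M N" unfolding Nh by (rule defect_gain[OF NE M(1) xy(2) _ xzN])
      then show False using optD[OF g(2) h(1)] g(1) by simp
    qed
    have "?d h = defect M N" unfolding Nh by (rule defect_exchange[OF NE xy xzN xzM])
    then have "opt h" using g h(1) keq_trans unfolding opt_def by auto
    then have inN: "insert {x, z} (N - {{x, y}}) \<in> \<N>" unfolding \<N>_def Nh[symmetric] by blast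
    have "z \<notin> \<Union>N \<and> {z, z'} \<in> M \<and> {x, z} \<in> E \<and> {x, z} \<notin> M \<and> insert {x, z} (N - {{x, y}}) \<in> \<N>"
      by (intro conjI zN zz' z(1) xzM inN)
    then show "\<exists>z z'. z \<notin> \<Union>N \<and> {z, z'} \<in> M \<and> {x, z} \<in> E \<and> {x, z} \<notin> M \<and> insert {x, z} (N - {{x, y}}) \<in> \<N>"
      by (intro exI)
  qed
  have sub: "color_class g0 s \<subseteq> M"
  proof (rule ccontr)
    assume "\<not> ?thesis"
    then obtain e where e: "e \<in> color_class g0 s" "e \<notin> M" by blast
    have in0: "color_class g0 s \<in> \<N>" using g0 g0min unfolding \<N>_def opt_def by blast
    obtain N u0 u1 u2 u3 where N: "N \<in> \<N>" "u0 \<notin> \<Union>N" "u3 \<notin> \<Union>N" "{u0, u1} \<in> M" "{u2, u3} \<in> M" "{u1, u2} \<in> N"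
      "{u0, u2} \<in> E" "{u1, u3} \<in> E" "{u0, u3} \<in> E"
      by (rule me.obtain_K4[OF in0 e])
    obtain g where g: "N = color_class g s" "opt g" using N(1) by (auto simp: \<N>_def)
    have u12: "{u1, u2} \<in> E" "g {u1, u2} = s" using N(6) g(1) by (auto simp: color_class_def)
    have n: "{u1, u2} \<notin> M" using me.not_M[OF N(1,2,4,6)] .
    show False
      by (rule K4_refuted[OF A s opt_col[OF g(2)] M(1) missing optD[OF g(2)] N(4,5) u12 _ _ N(7,8,9) n])
        (use N(2,3) free g(1) in auto)
  qed
  have og: "opt g0" using g0 g0min unfolding opt_def by blast
  have "M \<subseteq> color_class g0 s"
  proof
    fix e assume e: "e \<in> M"
    then obtain u v where uv: "e = {u, v}" using edgeD M(1) by blast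
    show "e \<in> color_class g0 s"
    proof (cases "u \<in> \<Union>(color_class g0 s)")
      case True
      then obtain e' where "e' \<in> color_class g0 s" "u \<in> e'" by blast
      then show ?thesis using M(2)[OF e, of e'] sub uv by blast
    next
      case False
      then obtain w where w: "{v, w} \<in> color_class g0 s" using covered[OF og] e uv by blast
      then have "e = {v, w}" using M(2)[OF e, of "{v, w}"] sub uv by blast
      then show ?thesis using w by simp
    qed
  qed
  then show ?thesis using g0 sub by blast
qed


section \<open>From swaps to interchanges\<close>

text \<open>When every vertex misses a colour other than \<open>s\<close>, no fan can end at a
  vertex missing \<open>s\<close> alone, so each edge of the class is removable.\<close>

lemma clear_class:
  assumes missing: "\<And>f v. col f \<Longrightarrow> \<exists>c\<in>A. c \<noteq> s \<and> miss f v c" and f: "col f"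
  shows "\<exists>g. f \<approx> g \<and> color_class g s = {}"
  using f
proof (induction "card (color_class f s)" arbitrary: f rule: less_induct)
  case less
  show ?case
  proof (cases "color_class f s = {}")
    case True
    then show ?thesis by blast
  next
    case False
    then obtain e where e: "e \<in> E" "f e = s" by (auto simp: color_class_def)
    obtain x y where xy: "e = {x, y}" using edgeD e by blast
    obtain \<alpha> where a: "\<alpha> \<in> A" "\<alpha> \<noteq> s" "miss f x \<alpha>" using missing[OF less.prems] by blast
    have "removable f s {x, y}"
    proof (rule ccontr)
      assume n: "\<not> removable f s {x, y}"
      show False
      proof (rule removable_or_fan[OF _ less.prems _ _ a n])
        show "\<exists>c\<in>A. miss f v c" if "col f" for f v using missing[OF that] by blast
        show "{x, y} \<in> E" "f {x, y} = s" using e xy by auto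
        show False if "\<And>c. \<lbrakk>c \<in> A; c \<noteq> s\<rbrakk> \<Longrightarrow> \<not> miss f (last ys) c" for ys
          using missing[OF less.prems, of "last ys"] that by blast
      qed
    qed
    then obtain g where g: "f \<approx> g" "\<forall>d\<in>E. g d = s \<longleftrightarrow> f d = s \<and> d \<noteq> e" unfolding removable_def xy by blast
    have "color_class g s \<subset> color_class f s" using g(2) e by (auto simp: color_class_def)
    moreover have "finite (color_class f s)" using finite_E by (simp add: color_class_def)
    ultimately have "card (color_class g s) < card (color_class f s)" by (simp add: psubset_card_mono)
    then obtain h where "g \<approx> h" "color_class h s = {}" using less.hyps keq_col[OF g(1) less.prems] by blast
    then show ?thesis using g(1) keq_trans by blast
  qed
qed

text \<open>Components are split off one at a time: after the interchange on a component with vertex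
  set \<open>T\<close> there remains the swap on \<open>S - T\<close>.\<close>

lemma interchanges_swap_on:
  assumes "closed_on f a b S" "a \<in> {1..t}" "b \<in> {1..t}"
  shows "(interchange E t)\<^sup>*\<^sup>* f (swap_on f a b S)"
  using assms(1)
proof (induction "card {e \<in> E. (f e = a \<or> f e = b) \<and> e \<inter> S \<noteq> {}}" arbitrary: f S rule: less_induct)
  case less
  let ?D = "\<lambda>f S. {e \<in> E. (f e = a \<or> f e = b) \<and> e \<inter> S \<noteq> {}}"
  show ?case
  proof (cases "?D f S = {}")
    case True
    then have "swap_on f a b S = f" by (auto simp: swap_on_def swap_color_def fun_eq_iff)
    then show ?thesis by simp
  next
    case False
    then obtain e0 where e0: "e0 \<in> E" "f e0 = a \<or> f e0 = b" "e0 \<inter> S \<noteq> {}" by blast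
    let ?K = "kempe_edges E f a b"
    define C where "C = {e. (edge_adj ?K)\<^sup>*\<^sup>* e0 e}"
    define T where "T = \<Union>C"
    have K: "e \<in> ?K \<longleftrightarrow> e \<in> E \<and> (f e = a \<or> f e = b)" for e by (simp add: kempe_edges_def)
    have comp: "kempe_component E f a b C" unfolding kempe_component_def C_def using e0 K by blast
    have CK: "e \<in> ?K \<and> e \<subseteq> S" if "(edge_adj ?K)\<^sup>*\<^sup>* e0 e" for e
      using that
    proof induction
      case base
      then show ?case using e0 K less.prems unfolding closed_on_def by blast
    next
      case (step e e')
      have "e' \<in> ?K" "e \<inter> e' \<noteq> {}" using step.hyps(2) by (auto simp: edge_adj_def)
      moreover have "e' \<inter> S \<noteq> {}" using calculation(2) step.IH by blast
      ultimately show ?case using K less.prems unfolding closed_on_def by blast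
    qed
    have TS: "T \<subseteq> S" using CK unfolding T_def C_def by blast
    have CT: "e \<in> C" if e: "e \<in> ?K" "e \<inter> T \<noteq> {}" for e
    proof -
      obtain c where c: "c \<in> C" "e \<inter> c \<noteq> {}" using e(2) unfolding T_def by blast
      then have "edge_adj ?K c e" using CK[of c] e(1) unfolding edge_adj_def C_def by blast
      then show ?thesis using c(1) unfolding C_def by (simp add: rtranclp.rtrancl_into_rtrancl)
    qed
    have clT: "closed_on f a b T" unfolding closed_on_def using CT K T_def by blast
    let ?f1 = "swap_on f a b T"
    have f1: "(\<lambda>e. if e \<in> C then swap_color a b (f e) else f e) = ?f1"
    proof
      fix e
      have "e \<in> C \<Longrightarrow> e \<in> E \<and> e \<inter> T \<noteq> {}" using CK[of e] K edgeD[of e] unfolding C_def T_def by blast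
      moreover have "e \<in> E \<Longrightarrow> e \<inter> T \<noteq> {} \<Longrightarrow> e \<notin> C \<Longrightarrow> swap_color a b (f e) = f e"
        using CT[of e] K[of e] by (auto simp: swap_color_def)
      ultimately show "(if e \<in> C then swap_color a b (f e) else f e) = ?f1 e"
        by (auto simp: swap_on_def)
    qed
    have "interchange E t f ?f1" unfolding interchange_def using comp assms(2,3) f1 by metis
    have same: "?f1 e = a \<or> ?f1 e = b \<longleftrightarrow> f e = a \<or> f e = b" for e by (auto simp: swap_on_def swap_color_def)
    have cl1: "closed_on ?f1 a b (S - T)"
      using less.prems clT unfolding closed_on_def same by blast
    have "?D ?f1 (S - T) \<subset> ?D f S"
    proof -
      have "e0 \<subseteq> T" unfolding T_def C_def by blast
      then show ?thesis unfolding same using e0 by blast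
    qed
    then have "card (?D ?f1 (S - T)) < card (?D f S)" using finite_E by (simp add: psubset_card_mono)
    from less.hyps[OF this cl1] have "(interchange E t)\<^sup>*\<^sup>* ?f1 (swap_on ?f1 a b (S - T))" .
    moreover have "swap_on ?f1 a b (S - T) = swap_on f a b S"
    proof
      fix e
      show "swap_on ?f1 a b (S - T) e = swap_on f a b S e"
      proof (cases "e \<in> E \<and> (f e = a \<or> f e = b)")
        case True
        then have "e \<inter> T \<noteq> {} \<Longrightarrow> e \<subseteq> T" "e \<inter> S \<noteq> {} \<Longrightarrow> e \<subseteq> S"
          using clT less.prems unfolding closed_on_def by blast+
        then have "e \<inter> (S - T) \<noteq> {} \<longleftrightarrow> e \<inter> S \<noteq> {} \<and> e \<inter> T = {}" "e \<inter> T \<noteq> {} \<Longrightarrow> e \<inter> S \<noteq> {}"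
          using TS by blast+
        then show ?thesis by (auto simp: swap_on_def)
      next
        case False
        then show ?thesis by (auto simp: swap_on_def swap_color_def)
      qed
    qed
    ultimately show ?thesis
      using \<open>interchange E t f ?f1\<close> by (simp add: converse_rtranclp_into_rtranclp)
  qed
qed

lemma keq_interchanges:
  assumes "A \<subseteq> {1..t}" "f \<approx> g"
  shows "(interchange E t)\<^sup>*\<^sup>* f g"
  using assms(2)
proof induction
  case (step g h)
  obtain p q S where "p \<in> A" "q \<in> A" "closed_on g p q S" "h = swap_on g p q S"
    using step.hyps(2) unfolding swap_step_def by blast
  then have "(interchange E t)\<^sup>*\<^sup>* g h" using interchanges_swap_on assms(1) by blast
  then show ?case using step.IH by simp
qed simp

section \<open>Subgraphs with smaller palettes\<close>

text \<open>The edges outside \<open>E'\<close> avoid the palette \<open>A'\<close>, so sets closed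
  in the subgraph are closed in the whole graph.\<close>

lemma keq_subgraph:
  assumes sub: "E' \<subseteq> E" "A' \<subseteq> A" and f: "\<And>e. e \<in> E - E' \<Longrightarrow> f e \<notin> A'"
    and g: "(palette_graph.swap_step E' A')\<^sup>*\<^sup>* f g"
  shows "f \<approx> g" and "\<And>e. e \<notin> E' \<Longrightarrow> g e = f e"
proof -
  interpret H: palette_graph E' A'
    using finite_subset[OF sub(1) finite_E] finite_subset[OF sub(2) finite_A] edgeD sub(1)
    by unfold_locales blast+
  have "f \<approx> g \<and> (\<forall>e. e \<notin> E' \<longrightarrow> g e = f e)"
    using g
  proof induction
    case (step g h)
    obtain p q S where pq: "p \<in> A'" "q \<in> A'" "H.closed_on g p q S" "h = H.swap_on g p q S"
      using step.hyps(2) unfolding H.swap_step_def by blast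
    have out: "g e \<noteq> p" "g e \<noteq> q" if "e \<in> E - E'" for e using f[OF that] step.IH that pq by auto
    have cl: "closed_on g p q S" using pq(3) out unfolding H.closed_on_def closed_on_def by blast
    have "h = swap_on g p q S"
      unfolding pq(4) H.swap_on_def swap_on_def using out sub(1) by (auto simp: fun_eq_iff swap_color_def)
    then have "g \<approx> h" using keq_swap[OF _ _ cl] pq sub(2) by blast
    moreover have "h e = g e" if "e \<notin> E'" for e using that unfolding pq(4) H.swap_on_def by simp
    ultimately show ?case using step.IH keq_trans by auto
  qed simp
  then show "f \<approx> g" "\<And>e. e \<notin> E' \<Longrightarrow> g e = f e" by blast+
qed

end

lemma card_star_le:
  assumes "finite B" "g ` {e \<in> E. v \<in> e} \<subseteq> B"
    and "\<forall>e\<in>E. \<forall>e'\<in>E. e \<noteq> e' \<and> e \<inter> e' \<noteq> {} \<longrightarrow> g e \<noteq> g e'"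
  shows "card {e \<in> E. v \<in> e} \<le> card B"
proof (rule card_inj_on_le[OF _ assms(2,1)])
  show "inj_on g {e \<in> E. v \<in> e}" using assms(3) unfolding inj_on_def by blast
qed

lemma reduce_palette:
  assumes fin: "finite E" and edge: "\<And>e. e \<in> E \<Longrightarrow> \<exists>u v. e = {u, v} \<and> u \<noteq> v"
    and deg: "\<And>v. card {e \<in> E. v \<in> e} \<le> 4"
    and n: "5 \<le> n" "n \<le> t" and f: "palette_graph.col E {1..n} f"
  shows "\<exists>g. (palette_graph.swap_step E {1..t})\<^sup>*\<^sup>* f g \<and> palette_graph.col E {1..5} g"
  using n f
proof (induction n arbitrary: f rule: dec_induct)
  case base
  then show ?case by blast
next
  case (step n)
  interpret T: palette_graph E "{1..t}" using fin edge by unfold_locales auto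
  interpret N: palette_graph E "{1..Suc n}" using fin edge by unfold_locales auto
  interpret N': palette_graph E "{1..n}" using fin edge by unfold_locales auto
  let ?s = "Suc n"
  \<comment> \<open>At most four edges meet at a vertex, so five colours besides \<open>?s\<close>
    guarantee a missing colour other than \<open>?s\<close>.\<close>
  define A' where "A' = insert ?s {1..5::nat}"
  define E' where "E' = {e \<in> E. f e \<in> A'}"
  interpret H: palette_graph E' A' using fin edge by unfold_locales (auto simp: E'_def A'_def)
  have colf: "N.col f" by fact
  have Hcol: "H.col f" using colf unfolding H.col_def N.col_def by (auto simp: E'_def)
  have miss: "\<exists>c\<in>A'. c \<noteq> ?s \<and> H.miss h v c" if h: "H.col h" for h v
  proof (rule ccontr)
    assume neg: "\<not> ?thesis"
    have "{1..5} \<subseteq> h ` {e \<in> E. v \<in> e}"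
    proof
      fix c assume c: "c \<in> {1..5::nat}"
      then have "\<not> H.miss h v c" using neg step.hyps(1) by (auto simp: A'_def)
      then show "c \<in> h ` {e \<in> E. v \<in> e}" unfolding H.miss_def by (auto simp: E'_def)
    qed
    then have "card {1..5::nat} \<le> card {e \<in> E. v \<in> e}" using fin by (intro surj_card_le) auto
    then show False using deg[of v] by simp
  qed
  obtain g where g: "(palette_graph.swap_step E' A')\<^sup>*\<^sup>* f g" "H.color_class g ?s = {}"
    using H.clear_class[OF miss Hcol] by blast
  have sub: "E' \<subseteq> E" "A' \<subseteq> {1..t}" using step.prems(1) step.hyps by (auto simp: E'_def A'_def)
  have out: "\<And>e. e \<in> E - E' \<Longrightarrow> f e \<notin> A'" by (auto simp: E'_def)
  note lift = T.keq_subgraph[OF sub out g(1)]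
  have "T.col f" using colf step.prems(1) unfolding T.col_def N.col_def by fastforce
  then have colg: "T.col g" using T.keq_col[OF lift(1)] by blast
  have Hg: "H.col g" using H.keq_col[OF g(1) Hcol] .
  have "g e \<in> {1..n}" if e: "e \<in> E" for e
  proof (cases "e \<in> E'")
    case True
    then have "g e \<in> A'" "g e \<noteq> ?s" using H.col_A[OF Hg] g(2) by (auto simp: H.color_class_def)
    then show ?thesis using step.hyps by (auto simp: A'_def)
  next
    case False
    then have "g e = f e" "f e \<noteq> ?s" using lift(2) e by (auto simp: E'_def A'_def)
    then show ?thesis using N.col_A[OF colf e] by auto
  qed
  then have "N'.col g" using colg unfolding N'.col_def T.col_def by blast
  then obtain h where "(palette_graph.swap_step E {1..t})\<^sup>*\<^sup>* g h" "palette_graph.col E {1..5} h"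
    using step.IH[of g] step.prems(1) by auto
  then show ?case using T.keq_trans[OF lift(1)] by blast
qed

text \<open>Since the classes above \<open>k\<close> agree, the remaining edges have colours up to
  \<open>k\<close> or the spare colour 5 under \<open>f\<close>, but only colours up to
  \<open>k\<close> under \<open>g\<close>. Their degrees are thus below the palette size
  \<open>Suc k\<close>, and a vertex of degree \<open>k\<close> meets every class of
  \<open>g\<close>, in particular \<open>M\<close>.\<close>

lemma fix_color:
  assumes fin: "finite E" and edge: "\<And>e. e \<in> E \<Longrightarrow> \<exists>u v. e = {u, v} \<and> u \<noteq> v"
    and t: "5 \<le> t" and k: "1 \<le> k" "k \<le> 4"
    and f: "palette_graph.col E {1..5} f" and g: "palette_graph.col E {1..4} g"
    and fg: "\<And>e j. \<lbrakk>e \<in> E; k < j; j \<le> 4\<rbrakk> \<Longrightarrow> f e = j \<longleftrightarrow> g e = j"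
  shows "\<exists>h. (palette_graph.swap_step E {1..t})\<^sup>*\<^sup>* f h \<and> palette_graph.col E {1..5} h \<and>
    (\<forall>e\<in>E. \<forall>j. k \<le> j \<and> j \<le> 4 \<longrightarrow> (h e = j \<longleftrightarrow> g e = j))"
proof -
  interpret T: palette_graph E "{1..t}" using fin edge by unfold_locales auto
  interpret F: palette_graph E "{1..5}" using fin edge by unfold_locales auto
  interpret G: palette_graph E "{1..4}" using fin edge by unfold_locales auto
  define A' where "A' = insert 5 {1..k}"
  define E' where "E' = {e \<in> E. g e \<le> k}"
  define M where "M = {e \<in> E. g e = k}"
  interpret H: palette_graph E' A' using fin edge by unfold_locales (auto simp: E'_def A'_def)
  have cardA: "card A' = Suc k" using k(2) by (simp add: A'_def)
  have ge: "g e \<in> {1..4}" if "e \<in> E" for e using G.col_A[OF g that] .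
  have gp: "\<forall>e\<in>E. \<forall>e'\<in>E. e \<noteq> e' \<and> e \<inter> e' \<noteq> {} \<longrightarrow> g e \<noteq> g e'" using g unfolding G.col_def by blast
  have fA: "f e \<in> A'" if "e \<in> E'" for e
  proof -
    have "f e \<in> {1..5}" using F.col_A[OF f] that by (simp add: E'_def)
    moreover have "\<not> (k < f e \<and> f e \<le> 4)" using fg[of e "f e"] that by (auto simp: E'_def)
    ultimately show ?thesis by (auto simp: A'_def)
  qed
  have Hcol: "H.col f" using f fA unfolding H.col_def F.col_def by (auto simp: E'_def)
  have sub: "E' \<subseteq> E" "A' \<subseteq> {1..t}" using t k by (auto simp: E'_def A'_def)
  have out: "f e = g e \<and> f e \<notin> A'" if "e \<in> E - E'" for e
    using fg[of e "g e"] ge[of e] that by (auto simp: E'_def A'_def)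
  have out': "\<And>e. e \<in> E - E' \<Longrightarrow> f e \<notin> A'" using out by blast
  have sub5: "A' \<subseteq> {1..5}" using k by (auto simp: A'_def)
  have star: "card {e \<in> E'. v \<in> e} \<le> card B" if "g ` {e \<in> E'. v \<in> e} \<subseteq> B" "finite B" for v B
    using card_star_le[OF that(2,1)] gp by (auto simp: E'_def)
  have gE': "g ` {e \<in> E'. v \<in> e} \<subseteq> {1..k}" for v using ge by (auto simp: E'_def)
  have "\<exists>h. (palette_graph.swap_step E' A')\<^sup>*\<^sup>* f h \<and> H.color_class h k = M"
  proof (rule H.class_to_matching[OF _ _ Hcol])
    show "card A' \<le> 5" "k \<in> A'" using cardA k by (auto simp: A'_def)
    show "M \<subseteq> E'" by (auto simp: M_def E'_def)
    show "e = e'" if "e \<in> M" "e' \<in> M" "e \<inter> e' \<noteq> {}" for e e' using gp that by (auto simp: M_def)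
    show "card {e \<in> E'. v \<in> e} < card A'" for v using star[OF gE'[of v]] cardA by simp
    show "\<exists>e\<in>M. v \<in> e" if "Suc (card {e \<in> E'. v \<in> e}) = card A'" for v
    proof (rule ccontr)
      assume "\<not> ?thesis"
      then have "k \<notin> g ` {e \<in> E'. v \<in> e}" by (auto simp: M_def E'_def)
      then have "g ` {e \<in> E'. v \<in> e} \<subseteq> {1..k} - {k}" using gE'[of v] by blast
      then have "card {e \<in> E'. v \<in> e} \<le> card ({1..k} - {k})" by (rule star) simp
      then show False using that cardA k by simp
    qed
  qed
  then obtain h where h: "(palette_graph.swap_step E' A')\<^sup>*\<^sup>* f h" "H.color_class h k = M" by blast
  note lift = T.keq_subgraph[OF sub out' h(1)]
  have colh: "palette_graph.col E {1..5} h"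
    using F.keq_col[OF F.keq_subgraph(1)[OF sub(1) sub5 out' h(1)] f] .
  have hA: "h e \<in> A'" if "e \<in> E'" for e using H.col_A[OF H.keq_col[OF h(1) Hcol] that] .
  have "h e = j \<longleftrightarrow> g e = j" if e: "e \<in> E" and j: "k \<le> j" "j \<le> 4" for e j
  proof (cases "e \<in> E'")
    case True
    have "e \<in> H.color_class h k \<longleftrightarrow> e \<in> M" using h(2) by simp
    then have "h e = k \<longleftrightarrow> g e = k" using True e by (simp add: H.color_class_def M_def)
    then show ?thesis using hA[OF True] True j by (auto simp: E'_def A'_def)
  next
    case False
    then show ?thesis using lift(2) out e by auto
  qed
  then show ?thesis using lift(1) colh by blast
qed

theorem theorem1p3:
  fixes V :: "'a set" and E :: "'a set set" and t :: nat
    and f g :: "'a set \<Rightarrow> nat"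
  assumes "simple_graph V E"
    and "class1 V E"
    and "max_degree V E = 4"
    and "t \<ge> 5"
    and "proper_edge_coloring E t f"
    and "proper_edge_coloring E 4 g"
  shows "\<exists>g'. (interchange E t)\<^sup>*\<^sup>* f g' \<and> (\<forall>e\<in>E. g' e = g e)"
proof -
  have edge: "\<exists>u v. e = {u, v} \<and> u \<noteq> v" if "e \<in> E" for e
    using assms(1) that unfolding simple_graph_def by blast
  have "E \<subseteq> Pow V"
  proof
    fix e assume "e \<in> E"
    then obtain u v where "e = {u, v}" "u \<in> V" "v \<in> V" using assms(1) unfolding simple_graph_def by blast
    then show "e \<in> Pow V" by simp
  qed
  moreover have "finite V" using assms(1) by (simp add: simple_graph_def)
  ultimately have fin: "finite E" by (simp add: finite_subset)
  interpret T: palette_graph E "{1..t}" using fin edge by unfold_locales auto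
  have col: "palette_graph.col E {1..n} h \<longleftrightarrow> proper_edge_coloring E n h" for n h
  proof -
    interpret N: palette_graph E "{1..n}" using fin edge by unfold_locales auto
    show ?thesis unfolding N.col_def proper_edge_coloring_def ..
  qed
  have g: "palette_graph.col E {1..4} g" using assms(6) col by blast
  have "card {e \<in> E. v \<in> e} \<le> card {1..4::nat}" for v
    by (rule card_star_le[of _ g]) (use assms(6) in \<open>auto simp: proper_edge_coloring_def\<close>)
  then have deg: "card {e \<in> E. v \<in> e} \<le> 4" for v by simp
  obtain f5 where f5: "T.keq f f5" "palette_graph.col E {1..5} f5"
    using reduce_palette[OF fin edge deg assms(4) order_refl] assms(5) col by blast
  \<comment> \<open>Here \<open>i\<close> counts the classes settled so far, from colour 4
    downwards.\<close>
  have "\<exists>h. T.keq f h \<and> palette_graph.col E {1..5} h \<and> (\<forall>e\<in>E. \<forall>j. 4 - i < j \<and> j \<le> 4 \<longrightarrow> (h e = j \<longleftrightarrow> g e = j))"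
    if "i \<le> 4" for i
    using that
  proof (induction i)
    case 0
    then show ?case using f5 by auto
  next
    case (Suc i)
    then obtain h where h: "T.keq f h" "palette_graph.col E {1..5} h"
      "\<forall>e\<in>E. \<forall>j. 4 - i < j \<and> j \<le> 4 \<longrightarrow> (h e = j \<longleftrightarrow> g e = j)" by auto
    have k: "1 \<le> 4 - i" "4 - i \<le> 4" using Suc.prems by auto
    obtain h' where h': "T.keq h h'" "palette_graph.col E {1..5} h'"
      "\<forall>e\<in>E. \<forall>j. 4 - i \<le> j \<and> j \<le> 4 \<longrightarrow> (h' e = j \<longleftrightarrow> g e = j)"
      using fix_color[OF fin edge assms(4) k h(2) g] h(3) by blast
    have "4 - i \<le> j" if "4 - Suc i < j" for j using that Suc.prems by linarith
    then show ?case using h'(2,3) T.keq_trans[OF h(1) h'(1)] by blast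
  qed
  from this[of 4] obtain h where h: "T.keq f h"
    "\<forall>e\<in>E. \<forall>j. 0 < j \<and> j \<le> 4 \<longrightarrow> (h e = j \<longleftrightarrow> g e = j)" by auto
  \<comment> \<open>Every edge has a colour in 1 to 4 under \<open>g\<close>, so agreement of these
    classes determines \<open>h\<close> on \<open>E\<close>.\<close>
  have "h e = g e" if "e \<in> E" for e
    using h(2) assms(6) that unfolding proper_edge_coloring_def by fastforce
  then show ?thesis using T.keq_interchanges[OF _ h(1)] by auto
qed

end
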